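(* Let $M$ and $N$ be smooth Banach manifolds modeled on the Banach spaces $\mathbb{E}$ and $\mathbb{E}'$, let $g:M\to N$ be a smooth map, and let $\nabla_M$ and $\nabla_N$ be $g$-related linear connections on $M$ and $N$. Equip $\pi^\infty_M:T^\infty M\to M$ and $\pi^\infty_N:T^\infty N\to N$ with the generalized Fréchet vector bundle structures induced by $\nabla_M$ and $\nabla_N$. Then the pair $(T^\infty g,g):(T^\infty M,\pi^\infty_M,M)\to(T^\infty N,\pi^\infty_N,N)$ is a generalized vector bundle morphism. Moreover, if $g$ is a diffeomorphism, then $(T^\infty g,g)$ is a (generalized) vector bundle isomorphism.
   Context: All manifolds and maps are smooth ($C^\infty$ in the Fréchet sense), modeled on real Banach spaces. **Higher order tangent bundles.** For $x\in M$ and $k\in\mathbb{N}$, two smooth curves $\gamma_1,\gamma_2:(-\epsilon,\epsilon)\to M$ with $\gamma_1(0)=\gamma_2(0)=x$ are $k$-equivalent if (in a chart) their derivatives at $0$ of orders $1,\dots,k$ agree; $[\gamma,x]_k$ is the class of $\gamma$, $T^k_xM$ the set of classes, $T^kM=\bigcup_xT^k_xM$, $\pi^k_M([\gamma,x]_k)=x$. The $k$'th order differential of $g$ is $T^kg:T^kM\to T^kN$, $[\gamma,x]_k\mapsto[g\circ\gamma,g(x)]_k$. For $j\ge i$ let $\pi^{j,i}_M:T^jM\to T^iM$, $[\gamma,x]_j\mapsto[\gamma,x]_i$ (similarly on $N$). Then $T^\infty M:=\varprojlim T^kM$ along these maps, $\pi^\infty_M:T^\infty M\to M$ is the natural projection,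 and, since $\pi^{j,i}_N\circ T^jg=T^ig\circ\pi^{j,i}_M$, the limit map $T^\infty g:=\varprojlim T^kg:T^\infty M\to T^\infty N$ exists. **Linear connections and $g$-relatedness.** A linear connection $\nabla$ on $M$ is given in charts $(U_\alpha,\phi_\alpha)$ by smooth Christoffel symbols: $\Gamma_\alpha(x,\xi)y$, $x\in\phi_\alpha(U_\alpha)$, bilinear in $(\xi,y)\in\mathbb{E}^2$; its connection map $TTM\to TM$ is locally $(x,\xi;y,\eta)\mapsto(x,\eta+\Gamma_\alpha(x,\xi)y)$. $\nabla_M$ and $\nabla_N$ are $g$-related if their connection maps $K_M,K_N$ satisfy $K_N\circ TTg=Tg\circ K_M$; locally, with $g_{\beta\alpha}=\psi_\beta\circ g\circ\phi_\alpha^{-1}$ for charts $(U_\alpha,\phi_\alpha)$ of $M$ and $(V_\beta,\psi_\beta)$ of $N$ with $g(U_\alpha)\subseteq V_\beta$, $$dg_{\beta\alpha}(x)[\Gamma^M_\alpha(x,\xi)y]=d^2g_{\beta\alpha}(x)(\xi,y)+\Gamma^N_\beta\big(g_{\beta\alpha}(x),dg_{\beta\alpha}(x)\xi\big)dg_{\beta\alpha}(x)y .$$ **Local components induced by a linear connection.** Given $\nabla$ on $M$, define $M^{1}_\alpha(x,\xi_1)y=\Gamma_\alpha(x,\xi_1)y$ and, for $j\ge2$, $$M^{j}_\alpha(x,\xi_1,\dots,\xi_j)y=\frac1j\Big(\sum_{i=1}^{j}\partial_iM^{j-1}_\alpha(x,\xi_1,\dots,\xi_{j-1})(y,i\xi_i)+M^{1}_\alpha(x,\xi_1)\big[M^{j-1}_\alpha(x,\xi_1,\dots,\xi_{j-1})y\big]\Big),$$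 where $\partial_iM^{j-1}_\alpha(\cdot)(y,w)$ is the partial derivative of $M^{j-1}_\alpha(\cdot)y$ with respect to its $i$-th variable ($x$ being the first, $\xi_{i-1}$ the $i$-th) in the direction $w$. **Induced vector bundle structures.** For each $k\in\mathbb{N}$ it is known that the maps $$\Phi^k_\alpha:(\pi^k_M)^{-1}(U_\alpha)\to\phi_\alpha(U_\alpha)\times\mathbb{E}^k,\quad [\gamma,x]_k\mapsto(\gamma_\alpha(0),\gamma_\alpha^{(1)}(0),z^2_\alpha,\dots,z^k_\alpha),\qquad \gamma_\alpha=\phi_\alpha\circ\gamma,$$ $$z^i_\alpha=\frac1i\Big\{\frac{\gamma_\alpha^{(i)}(0)}{(i-1)!}+\sum_{j=1}^{i-1}M^{j}_\alpha\Big[\gamma_\alpha(0),\gamma_\alpha^{(1)}(0),\dots,\frac{\gamma_\alpha^{(j)}(0)}{j!}\Big]\frac{\gamma_\alpha^{(i-j)}(0)}{(i-j-1)!}\Big\}\quad(2\le i\le k),$$ are trivializations of a smooth vector bundle structure on $\pi^k_M:T^kM\to M$ with fibre $\mathbb{E}^k$. Write $\Phi^k_{\alpha,x}:T^k_xM\to\mathbb{E}^k$ for the restriction to the fibre over $x$. For each $x$ these are compatible with the projections, with limit $\Phi^\infty_{\alpha,x}=\varprojlim\Phi^k_{\alpha,x}:T^\infty_xM\to\mathbb{F}:=\varprojlim\mathbb{E}^k$, where the connecting maps $\rho_{ji}:\mathbb{E}^j\to\mathbb{E}^i$ are the projections to the first $i$ factors. The resulting maps trivialize $T^\infty M$ as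 a generalized Fréchet vector bundle over $M$ with fibre $\mathbb{F}$. The same construction on $N$ gives $\Psi^k_{\beta,y}$, $\Psi^\infty_{\beta,y}$, $\rho'_{ji}$ and the fibre $\mathbb{F}'=\varprojlim\mathbb{E}'^k$. **Generalized vector bundle morphism.** Let $$\mathcal{H}(\mathbb{F},\mathbb{F}')=\Big\{(l_k)_{k\in\mathbb{N}}\in\prod_{k=1}^\infty\mathcal{L}(\mathbb{E}^k,\mathbb{E}'^k):\ \rho'_{ji}\circ l_j=l_i\circ\rho_{ji}\ \ \forall j\ge i\Big\},$$ a Fréchet space which is the projective limit of the Banach spaces $\mathcal{H}^k(\mathbb{E}^k,\mathbb{E}'^k)$ of finite families $(l_i)_{1\le i\le k}\in\prod_{i=1}^k\mathcal{L}(\mathbb{E}^i,\mathbb{E}'^i)$ satisfying the same compatibility for $1\le i\le j\le k$; let $\varepsilon:\mathcal{H}(\mathbb{F},\mathbb{F}')\to\mathcal{L}(\mathbb{F},\mathbb{F}')$, $(l_k)\mapsto\varprojlim l_k$. A map into $\mathcal{H}(\mathbb{F},\mathbb{F}')$ is called (generalized) smooth if all its components into the Banach spaces $\mathcal{H}^k(\mathbb{E}^k,\mathbb{E}'^k)$ are smooth. The pair $(T^\infty g,g)$ is a generalized vector bundle morphism if $\pi^\infty_N\circ T^\infty g=g\circ\pi^\infty_M$, $T^\infty g$ is continuous linear on fibres, and, for trivializations with $g(U_\alpha)\subseteq V_\beta$, the map $U_\alpha\to\mathcal{L}(\mathbb{F},\mathbb{F}')$, $x\mapsto\Psi^\infty_{\beta,g(x)}\circ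 T^\infty_xg\circ(\Phi^\infty_{\alpha,x})^{-1}$, factors as $\varepsilon$ composed with a generalized smooth map $U_\alpha\to\mathcal{H}(\mathbb{F},\mathbb{F}')$. It is an isomorphism if it has an inverse which is also a generalized vector bundle morphism. *)

theory Defs
  imports "HOL-Analysis.Analysis"
begin

section \<open>Smooth maps between Banach spaces\<close>

definition bounded_multilinear ::
  "nat \<Rightarrow> ('a::real_normed_vector list \<Rightarrow> 'b::real_normed_vector) \<Rightarrow> bool" where
  "bounded_multilinear k L \<longleftrightarrow>
     (\<forall>vs i. length vs = k \<and> i < k \<longrightarrow> linear (\<lambda>v. L (vs[i := v]))) \<and>
     (\<exists>C. \<forall>vs. length vs = k \<longrightarrow> norm (L vs) \<le> C * prod_list (map norm vs))"

text \<open>Frechet smoothness on an open set. \<open>D x\<close> restricted to lists of length \<open>k\<close> is the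
  \<open>k\<close>-th derivative at \<open>x\<close>, a bounded \<open>k\<close>-linear map. The last clause says that
  \<open>x \<mapsto> D x\<close> (lists of length \<open>k\<close>) is Frechet differentiable for the operator norm of
  \<open>k\<close>-linear maps, with derivative \<open>h \<mapsto> D x (h # _)\<close>. Lists are used because the iterated
  type of bounded linear maps would depend on \<open>k\<close>.\<close>

definition smooth_on ::
  "'a::real_normed_vector set \<Rightarrow> ('a \<Rightarrow> 'b::real_normed_vector) \<Rightarrow> bool" where
  "smooth_on S f \<longleftrightarrow> open S \<and>
     (\<exists>D :: 'a \<Rightarrow> 'a list \<Rightarrow> 'b. \<forall>x\<in>S.
        D x [] = f x \<and>
        (\<forall>k. bounded_multilinear k (D x)) \<and>
        (\<forall>k. \<forall>e>0. \<exists>d>0. \<forall>y\<in>S. norm (y - x) < d \<longrightarrow>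
           (\<forall>vs. length vs = k \<longrightarrow>
              norm (D y vs - D x vs - D x ((y - x) # vs))
                \<le> e * norm (y - x) * prod_list (map norm vs))))"

section \<open>Banach manifolds\<close>

text \<open>Manifolds are given as in Lang's book: an atlas is a set of pairs \<open>(U, \<phi>)\<close>, the
  underlying set is the union of the chart domains, and the topology is the one induced by the
  charts. No separation axiom is imposed. Values of \<open>\<phi>\<close> outside \<open>U\<close> are irrelevant.\<close>

type_synonym ('m, 'e) chart = "'m set \<times> ('m \<Rightarrow> 'e)"
type_synonym ('m, 'e) atlas = "('m, 'e) chart set"

definition carrier :: "('m, 'e) atlas \<Rightarrow> 'm set" where
  "carrier A = (\<Union>c\<in>A. fst c)"

definition compatible :: "('m, 'e::banach) chart \<Rightarrow> ('m, 'e) chart \<Rightarrow> bool" where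
  "compatible c d \<longleftrightarrow> (case c of (U, \<phi>) \<Rightarrow> case d of (V, \<psi>) \<Rightarrow>
     smooth_on (\<phi> ` (U \<inter> V)) (\<psi> \<circ> inv_into U \<phi>) \<and>
     smooth_on (\<psi> ` (U \<inter> V)) (\<phi> \<circ> inv_into V \<psi>))"

text \<open>The maximal atlas generated by \<open>A\<close>; note that \<^const>\<open>smooth_on\<close> includes openness of
  the set.\<close>

definition charts :: "('m, 'e::banach) atlas \<Rightarrow> ('m, 'e) atlas" where
  "charts A = {(U, \<phi>). U \<subseteq> carrier A \<and> inj_on \<phi> U \<and> open (\<phi> ` U) \<and>
     (\<forall>d\<in>A. compatible (U, \<phi>) d)}"

definition smooth_atlas :: "('m, 'e::banach) atlas \<Rightarrow> bool" where
  "smooth_atlas A \<longleftrightarrow> A \<subseteq> charts A"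

definition smooth_map ::
  "('m, 'e::banach) atlas \<Rightarrow> ('n, 'f::banach) atlas \<Rightarrow> ('m \<Rightarrow> 'n) \<Rightarrow> bool" where
  "smooth_map A B g \<longleftrightarrow> g \<in> carrier A \<rightarrow> carrier B \<and>
     (\<forall>x\<in>carrier A. \<exists>(U, \<phi>)\<in>charts A. \<exists>(V, \<psi>)\<in>charts B.
        x \<in> U \<and> g ` U \<subseteq> V \<and> smooth_on (\<phi> ` U) (\<psi> \<circ> g \<circ> inv_into U \<phi>))"

definition inverse_on :: "'a set \<Rightarrow> 'b set \<Rightarrow> ('a \<Rightarrow> 'b) \<Rightarrow> ('b \<Rightarrow> 'a) \<Rightarrow> bool" where
  "inverse_on X Y f h \<longleftrightarrow> (\<forall>x\<in>X. h (f x) = x) \<and> (\<forall>y\<in>Y. f (h y) = y)"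

definition diffeomorphism ::
  "('m, 'e::banach) atlas \<Rightarrow> ('n, 'f::banach) atlas \<Rightarrow> ('m \<Rightarrow> 'n) \<Rightarrow> bool" where
  "diffeomorphism A B g \<longleftrightarrow> smooth_map A B g \<and>
     (\<exists>h. smooth_map B A h \<and> inverse_on (carrier A) (carrier B) g h)"

section \<open>Higher order tangent bundles\<close>

definition nth_vderiv :: "nat \<Rightarrow> (real \<Rightarrow> 'e::real_normed_vector) \<Rightarrow> real \<Rightarrow> 'e" where
  "nth_vderiv k f = ((\<lambda>h t. vector_derivative h (at t)) ^^ k) f"

text \<open>A curve \<open>(-\<epsilon>, \<epsilon>) \<rightarrow> M\<close> is a total function of which only the values near \<open>0\<close> matter.\<close>

definition smooth_curve :: "('m, 'e::banach) atlas \<Rightarrow> (real \<Rightarrow> 'm) \<Rightarrow> bool" where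
  "smooth_curve A \<gamma> \<longleftrightarrow> (\<exists>\<epsilon>>0. smooth_map {({-\<epsilon><..<\<epsilon>}, \<lambda>t::real. t)} A \<gamma>)"

definition k_equivalent ::
  "('m, 'e::banach) atlas \<Rightarrow> nat \<Rightarrow> (real \<Rightarrow> 'm) \<Rightarrow> (real \<Rightarrow> 'm) \<Rightarrow> bool" where
  "k_equivalent A k \<gamma> \<delta> \<longleftrightarrow> \<gamma> 0 = \<delta> 0 \<and>
     (\<exists>(U, \<phi>)\<in>charts A. \<gamma> 0 \<in> U \<and>
        (\<forall>i\<in>{1..k}. nth_vderiv i (\<phi> \<circ> \<gamma>) 0 = nth_vderiv i (\<phi> \<circ> \<delta>) 0))"

type_synonym 'm jet = "(real \<Rightarrow> 'm) set"

text \<open>The class \<open>[\<gamma>, \<gamma> 0]\<^sub>k\<close>. Maps on classes are defined below through their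
  representatives, by a union of classes or by \<^const>\<open>the_elem\<close>, as usual for quotients.\<close>

definition jet_of :: "('m, 'e::banach) atlas \<Rightarrow> nat \<Rightarrow> (real \<Rightarrow> 'm) \<Rightarrow> 'm jet" where
  "jet_of A k \<gamma> = {\<delta>. smooth_curve A \<delta> \<and> k_equivalent A k \<gamma> \<delta>}"

definition Tk :: "nat \<Rightarrow> ('m, 'e::banach) atlas \<Rightarrow> 'm jet set" where
  "Tk k A = {jet_of A k \<gamma> |\<gamma>. smooth_curve A \<gamma>}"

definition base_point :: "'m jet \<Rightarrow> 'm" where
  "base_point u = the_elem ((\<lambda>\<gamma>. \<gamma> 0) ` u)"

text \<open>\<open>jet_proj A i\<close> is the map \<open>\<pi>\<^bsup>j,i\<^esup>\<close> for every \<open>j \<ge> i\<close>.\<close>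

definition jet_proj :: "('m, 'e::banach) atlas \<Rightarrow> nat \<Rightarrow> 'm jet \<Rightarrow> 'm jet" where
  "jet_proj A i u = (\<Union>\<gamma>\<in>u. jet_of A i \<gamma>)"

text \<open>\<open>Tk_map k B g\<close> is \<open>T\<^sup>k g\<close> for a map \<open>g\<close> into the manifold \<open>B\<close>.\<close>

definition Tk_map :: "nat \<Rightarrow> ('n, 'f::banach) atlas \<Rightarrow> ('m \<Rightarrow> 'n) \<Rightarrow> 'm jet \<Rightarrow> 'n jet" where
  "Tk_map k B g u = (\<Union>\<gamma>\<in>u. jet_of B k (g \<circ> \<gamma>))"

text \<open>Projective limits are indexed from \<open>k = 0\<close>; here \<open>T\<^sup>0 M\<close> is a copy of \<open>M\<close>, so that
  the additional component of a thread is its base point.\<close>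

definition Tinf :: "('m, 'e::banach) atlas \<Rightarrow> (nat \<Rightarrow> 'm jet) set" where
  "Tinf A = {u. (\<forall>k. u k \<in> Tk k A) \<and> (\<forall>i j. i \<le> j \<longrightarrow> jet_proj A i (u j) = u i)}"

definition Tinf_proj :: "(nat \<Rightarrow> 'm jet) \<Rightarrow> 'm" where
  "Tinf_proj u = base_point (u 0)"

definition Tinf_map ::
  "('n, 'f::banach) atlas \<Rightarrow> ('m \<Rightarrow> 'n) \<Rightarrow> (nat \<Rightarrow> 'm jet) \<Rightarrow> (nat \<Rightarrow> 'n jet)" where
  "Tinf_map B g u = (\<lambda>k. Tk_map k B g (u k))"

section \<open>Linear connections\<close>

definition tangent_chart ::
  "('m, 'e::banach) atlas \<Rightarrow> ('m, 'e) chart \<Rightarrow> ('m jet, 'e \<times> 'e) chart" where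
  "tangent_chart A c = (case c of (U, \<phi>) \<Rightarrow>
     ({u \<in> Tk 1 A. base_point u \<in> U},
      \<lambda>u. the_elem ((\<lambda>\<gamma>. (\<phi> (\<gamma> 0), nth_vderiv 1 (\<phi> \<circ> \<gamma>) 0)) ` u)))"

definition tangent_atlas :: "('m, 'e::banach) atlas \<Rightarrow> ('m jet, 'e \<times> 'e) atlas" where
  "tangent_atlas A = tangent_chart A ` charts A"

text \<open>\<open>TTM\<close> is \<open>Tk 1 (tangent_atlas M)\<close>, and \<open>double_tangent_chart\<close> is the chart
  \<open>(x, \<xi>; y, \<eta>)\<close> that a chart of \<open>M\<close> induces on it.\<close>

definition double_tangent_chart ::
  "('m, 'e::banach) atlas \<Rightarrow> ('m, 'e) chart
     \<Rightarrow> ('m jet jet, ('e \<times> 'e) \<times> ('e \<times> 'e)) chart" where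
  "double_tangent_chart A c = tangent_chart (tangent_atlas A) (tangent_chart A c)"

type_synonym ('m, 'e) christoffel = "('m, 'e) chart \<Rightarrow> 'e \<Rightarrow> 'e \<Rightarrow>\<^sub>L 'e \<Rightarrow>\<^sub>L 'e"

text \<open>\<open>\<Gamma>\<close> are the Christoffel symbols, \<open>K\<close> is the connection map; each determines the other,
  and the existence of \<open>K\<close> encodes the transformation law of \<open>\<Gamma>\<close>.\<close>

definition linear_connection ::
  "('m, 'e::banach) atlas \<Rightarrow> ('m, 'e) christoffel \<Rightarrow> ('m jet jet \<Rightarrow> 'm jet) \<Rightarrow> bool" where
  "linear_connection A \<Gamma> K \<longleftrightarrow> (\<forall>c\<in>charts A.
     smooth_on (snd c ` fst c) (\<Gamma> c) \<and>
     (\<forall>\<theta> \<in> fst (double_tangent_chart A c).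
        K \<theta> \<in> fst (tangent_chart A c) \<and>
        (case snd (double_tangent_chart A c) \<theta> of ((x, \<xi>), (y, \<eta>)) \<Rightarrow>
           snd (tangent_chart A c) (K \<theta>) = (x, \<eta> + \<Gamma> c x \<xi> y))))"

definition g_related ::
  "('m, 'e::banach) atlas \<Rightarrow> ('n, 'f::banach) atlas \<Rightarrow> ('m \<Rightarrow> 'n) \<Rightarrow>
   ('m jet jet \<Rightarrow> 'm jet) \<Rightarrow> ('n jet jet \<Rightarrow> 'n jet) \<Rightarrow> bool" where
  "g_related A B g K K' \<longleftrightarrow> (\<forall>\<theta> \<in> Tk 1 (tangent_atlas A).
     K' (Tk_map 1 (tangent_atlas B) (Tk_map 1 B g) \<theta>) = Tk_map 1 B g (K \<theta>))"

text \<open>\<open>local_component G j \<xi> y\<close> is \<open>M\<^sup>j(x, \<xi>\<^sub>1, \<dots>, \<xi>\<^sub>j) y\<close> with \<open>x = \<xi> 0\<close>, so that the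
  \<open>i\<close>-th variable is \<open>\<xi> (i - 1)\<close>. The value for \<open>j = 0\<close> is not used.\<close>

fun local_component ::
  "('e::banach \<Rightarrow> 'e \<Rightarrow>\<^sub>L 'e \<Rightarrow>\<^sub>L 'e) \<Rightarrow> nat \<Rightarrow> (nat \<Rightarrow> 'e) \<Rightarrow> 'e \<Rightarrow> 'e" where
  "local_component G 0 \<xi> y = y"
| "local_component G (Suc 0) \<xi> y = G (\<xi> 0) (\<xi> 1) y"
| "local_component G (Suc (Suc n)) \<xi> y = (1 / real (Suc (Suc n))) *\<^sub>R
     ((\<Sum>i = 1..Suc (Suc n).
         frechet_derivative (\<lambda>u. local_component G (Suc n) (\<xi>(i - 1 := u)) y)
           (at (\<xi> (i - 1))) (real i *\<^sub>R \<xi> i))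
      + G (\<xi> 0) (\<xi> 1) (local_component G (Suc n) \<xi> y))"

section \<open>The model fibres\<close>

text \<open>\<open>\<bbbE>\<^sup>k\<close> is the closed subspace of sequences supported in \<open>{1..k}\<close> of the Banach space of
  bounded sequences, so it carries the maximum norm. In this encoding \<open>trunc i\<close> is the
  connecting map \<open>\<bbbE>\<^sup>j \<rightarrow> \<bbbE>\<^sup>i\<close>, \<open>i \<le> j\<close>.\<close>

type_synonym 'e bseq = "nat \<Rightarrow>\<^sub>C 'e"

definition tuple :: "nat \<Rightarrow> (nat \<Rightarrow> 'a::real_normed_vector) \<Rightarrow> 'a bseq" where
  "tuple k z = Bcontfun (\<lambda>i. if i \<in> {1..k} then z i else 0)"

definition power_space :: "nat \<Rightarrow> 'e::real_normed_vector bseq set" where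
  "power_space k = {v. \<forall>i. i \<notin> {1..k} \<longrightarrow> apply_bcontfun v i = 0}"

definition trunc :: "nat \<Rightarrow> 'e::real_normed_vector bseq \<Rightarrow> 'e bseq" where
  "trunc i v = tuple i (apply_bcontfun v)"

text \<open>The limit \<open>\<bbbF>\<close>, a subset of the countable product with the product topology. As
  \<open>\<bbbE>\<^sup>0 = 0\<close>, the index \<open>0\<close> contributes nothing, here and in the spaces below.\<close>

definition model_fibre :: "(nat \<Rightarrow> 'e::real_normed_vector bseq) set" where
  "model_fibre = {v. (\<forall>k. v k \<in> power_space k) \<and> (\<forall>i j. i \<le> j \<longrightarrow> trunc i (v j) = v i)}"

definition continuous_linear_fibre ::
  "((nat \<Rightarrow> 'e::real_normed_vector bseq) \<Rightarrow> (nat \<Rightarrow> 'f::real_normed_vector bseq)) \<Rightarrow> bool" where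
  "continuous_linear_fibre T \<longleftrightarrow> T \<in> model_fibre \<rightarrow> model_fibre \<and>
     (\<forall>v\<in>model_fibre. \<forall>w\<in>model_fibre. T (\<lambda>k. v k + w k) = (\<lambda>k. T v k + T w k)) \<and>
     (\<forall>a. \<forall>v\<in>model_fibre. T (\<lambda>k. a *\<^sub>R v k) = (\<lambda>k. a *\<^sub>R T v k)) \<and>
     continuous_on model_fibre T"

text \<open>\<open>\<L>(\<bbbE>\<^sup>k, \<bbbE>'\<^sup>k)\<close>, embedded isometrically into the operators on bounded sequences by
  precomposition with the norm one projection \<open>trunc k\<close> onto \<open>\<bbbE>\<^sup>k\<close>.\<close>

definition power_operators ::
  "nat \<Rightarrow> ('e::real_normed_vector bseq \<Rightarrow>\<^sub>L 'f::real_normed_vector bseq) set" where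
  "power_operators k =
     {l. \<forall>v. blinfun_apply l v \<in> power_space k \<and> blinfun_apply l (trunc k v) = blinfun_apply l v}"

definition H_space ::
  "(nat \<Rightarrow> ('e::real_normed_vector bseq \<Rightarrow>\<^sub>L 'f::real_normed_vector bseq)) set" where
  "H_space = {l. (\<forall>k. l k \<in> power_operators k) \<and>
     (\<forall>i j. i \<le> j \<longrightarrow>
        (\<forall>v\<in>power_space j. trunc i (blinfun_apply (l j) v) = blinfun_apply (l i) (trunc i v)))}"

text \<open>The map \<open>\<epsilon>\<close>.\<close>

definition H_limit ::
  "(nat \<Rightarrow> ('e::real_normed_vector bseq \<Rightarrow>\<^sub>L 'f::real_normed_vector bseq)) \<Rightarrow>
   (nat \<Rightarrow> 'e bseq) \<Rightarrow> (nat \<Rightarrow> 'f bseq)" where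
  "H_limit l v = (\<lambda>k. blinfun_apply (l k) (v k))"

text \<open>A map into \<open>\<H>(\<bbbF>, \<bbbF>')\<close>, defined on the domain of a chart \<open>c\<close>, is smooth when each
  component into \<open>\<H>\<^sup>k\<close> is. Here \<open>tuple k\<close> places the finite family \<open>(l\<^sub>i)\<close>, \<open>1 \<le> i \<le> k\<close>,
  in the Banach space of bounded operator sequences, of which \<open>\<H>\<^sup>k\<close> is a closed subspace.\<close>

definition generalized_smooth ::
  "('m, 'e0::banach) chart \<Rightarrow>
   ('m \<Rightarrow> nat \<Rightarrow> ('e::banach bseq \<Rightarrow>\<^sub>L 'f::banach bseq)) \<Rightarrow> bool" where
  "generalized_smooth c L \<longleftrightarrow> L \<in> fst c \<rightarrow> H_space \<and>
     (\<forall>k. smooth_on (snd c ` fst c) (\<lambda>p. tuple k (L (inv_into (fst c) (snd c) p))))"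

section \<open>Generalized vector bundles and their morphisms\<close>

text \<open>The data of a generalized vector bundle with fibre \<open>\<bbbF>\<close>: total space, atlas of the base,
  projection, and for each chart and base point the fibre map of the trivialization.\<close>

record (overloaded) ('u, 'm, 'e) gv_bundle =
  total_space :: "'u set"
  base_atlas :: "('m, 'e) atlas"
  projection :: "'u \<Rightarrow> 'm"
  fibre_triv :: "('m, 'e) chart \<Rightarrow> 'm \<Rightarrow> 'u \<Rightarrow> (nat \<Rightarrow> 'e bseq)"

definition fibre :: "('u, 'm, 'e) gv_bundle \<Rightarrow> 'm \<Rightarrow> 'u set" where
  "fibre X x = {u \<in> total_space X. projection X u = x}"

definition local_rep ::
  "('u, 'm, 'e::banach) gv_bundle \<Rightarrow> ('w, 'n, 'f::banach) gv_bundle \<Rightarrow> ('u \<Rightarrow> 'w) \<Rightarrow> ('m \<Rightarrow> 'n) \<Rightarrow>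
   ('m, 'e) chart \<Rightarrow> ('n, 'f) chart \<Rightarrow> 'm \<Rightarrow> (nat \<Rightarrow> 'e bseq) \<Rightarrow> (nat \<Rightarrow> 'f bseq)" where
  "local_rep X Y G g c d x =
     fibre_triv Y d (g x) \<circ> G \<circ> inv_into (fibre X x) (fibre_triv X c x)"

text \<open>In the third conjunct, the topological vector space structures of the fibres are those
  transported from the model fibre by trivializations around \<open>x\<close> and \<open>g x\<close>.\<close>

definition gvb_morphism ::
  "('u, 'm, 'e::banach) gv_bundle \<Rightarrow> ('w, 'n, 'f::banach) gv_bundle \<Rightarrow> ('u \<Rightarrow> 'w) \<Rightarrow> ('m \<Rightarrow> 'n) \<Rightarrow> bool"
  where
  "gvb_morphism X Y G g \<longleftrightarrow>
     smooth_map (base_atlas X) (base_atlas Y) g \<and>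
     G \<in> total_space X \<rightarrow> total_space Y \<and>
     (\<forall>u\<in>total_space X. projection Y (G u) = g (projection X u)) \<and>
     (\<forall>c\<in>charts (base_atlas X). \<forall>d\<in>charts (base_atlas Y). \<forall>x\<in>fst c. g x \<in> fst d \<longrightarrow>
        continuous_linear_fibre (local_rep X Y G g c d x)) \<and>
     (\<forall>c\<in>charts (base_atlas X). \<forall>d\<in>charts (base_atlas Y). g ` fst c \<subseteq> fst d \<longrightarrow>
        (\<exists>L. generalized_smooth c L \<and>
           (\<forall>x\<in>fst c. \<forall>v\<in>model_fibre. local_rep X Y G g c d x v = H_limit (L x) v)))"

definition gvb_isomorphism ::
  "('u, 'm, 'e::banach) gv_bundle \<Rightarrow> ('w, 'n, 'f::banach) gv_bundle \<Rightarrow> ('u \<Rightarrow> 'w) \<Rightarrow> ('m \<Rightarrow> 'n) \<Rightarrow> bool"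
  where
  "gvb_isomorphism X Y G g \<longleftrightarrow> gvb_morphism X Y G g \<and>
     (\<exists>G' g'. gvb_morphism Y X G' g' \<and>
        inverse_on (total_space X) (total_space Y) G G' \<and>
        inverse_on (carrier (base_atlas X)) (carrier (base_atlas Y)) g g')"

section \<open>The bundle structure induced by a linear connection\<close>

text \<open>\<open>z_coord G f i\<close> is \<open>z\<^sup>i\<close> for \<open>f = \<phi> \<circ> \<gamma>\<close>. For \<open>i = 1\<close> the formula reduces to \<open>f'(0)\<close>,
  the first fibre coordinate.\<close>

definition z_coord ::
  "('e::banach \<Rightarrow> 'e \<Rightarrow>\<^sub>L 'e \<Rightarrow>\<^sub>L 'e) \<Rightarrow> (real \<Rightarrow> 'e) \<Rightarrow> nat \<Rightarrow> 'e" where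
  "z_coord G f i = (1 / real i) *\<^sub>R
     ((1 / fact (i - 1)) *\<^sub>R nth_vderiv i f 0 +
      (\<Sum>j = 1..i - 1. local_component G j (\<lambda>l. (1 / fact l) *\<^sub>R nth_vderiv l f 0)
         ((1 / fact (i - j - 1)) *\<^sub>R nth_vderiv (i - j) f 0)))"

text \<open>\<open>Phi \<Gamma> c k\<close> is the trivialization \<open>\<Phi>\<^sup>k\<close> over the domain of \<open>c\<close>; its restriction to the
  fibre over \<open>x\<close> is the second component.\<close>

definition Phi ::
  "('m, 'e::banach) christoffel \<Rightarrow> ('m, 'e) chart \<Rightarrow> nat \<Rightarrow> 'm jet \<Rightarrow> 'e \<times> 'e bseq" where
  "Phi \<Gamma> c k u =
     the_elem ((\<lambda>\<gamma>. (snd c (\<gamma> 0), tuple k (z_coord (\<Gamma> c) (snd c \<circ> \<gamma>)))) ` u)"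

definition Tinf_bundle ::
  "('m, 'e::banach) atlas \<Rightarrow> ('m, 'e) christoffel \<Rightarrow> (nat \<Rightarrow> 'm jet, 'm, 'e) gv_bundle" where
  "Tinf_bundle A \<Gamma> =
     \<lparr>total_space = Tinf A, base_atlas = A, projection = Tinf_proj,
      fibre_triv = (\<lambda>c x u k. snd (Phi \<Gamma> c k (u k)))\<rparr>"

end

theory Submission
  imports Defs
begin

text \<open>
  Write \<open>\<nabla>V = V' + \<Gamma>(f, f')V\<close> for the covariant derivative of a vector field along a local curve \<open>f\<close>.
  The operators \<open>j! M\<^sup>j\<close>, evaluated on the jet of \<open>f\<close>, satisfy the recursion of \<open>(d/dt + \<Gamma>)\<^sup>j\<close>, so
  by Leibniz' rule \<open>z\<^sup>i = \<nabla>\<^sup>i\<^sup>-\<^sup>1f' / i!\<close>. Relatedness of the connections says that the local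
  representative \<open>h\<close> of \<open>g\<close> intertwines the two covariant derivatives; hence \<open>z\<^sup>i\<close> of \<open>h \<circ> f\<close> is
  \<open>dh\<close> applied to \<open>z\<^sup>i\<close> of \<open>f\<close>, and in the trivializations \<open>T\<^sup>\<infinity>g\<close> acts diagonally by the
  differential of \<open>h\<close>. The inverse of a diffeomorphism again relates the connections.

  Smoothness in the sense of \<^const>\<open>smooth_on\<close> is handled through sets of functions: the
  derivatives of \<open>f\<close> in directions of norm at most one form a set of functions of the same type as
  \<open>f\<close>. Differentiability of order \<open>n\<close> that is uniform in such a set is therefore definable by
  recursion on \<open>n\<close>, and the chain rule of order \<open>n\<close> is proved by induction, although the iterated
  operator-valued derivatives all have different types.
\<close>

section \<open>Equi-differentiable sets of functions\<close>

text \<open>The Taylor coefficients \<open>f^(l)/l!\<close> of a curve satisfy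
  \<open>(f^(l)/l!)' = (l+1) f^(l+1)/(l+1)!\<close>. Hence the weighted sum of partial derivatives
  in the definition of M^j is the time derivative of M^(j-1) along the curve; this is where the
  weights come from. When dh is differentiated along f, the term d^2h that appears is exactly the
  one in the relatedness formula, so it cancels at every order and no higher derivative of h
  survives.

  Two obstacles shape the rest. M^j has a number of arguments that grows with j and is defined by
  partial derivatives of total functions; it is moved to the Banach space of bounded sequences,
  where all partial derivatives are values of one differential. And relatedness is a statement about
  connection maps on TTM: the local formula is read off from one double tangent vector, where d^2h
  occurs with its arguments exchanged, so symmetry of second derivatives is required.

  The local representative of a bundle map is formed with a chosen inverse of the trivialization.
  That the trivialization is onto follows from the fact that z^i is triangular in the derivatives of
  the curve.\<close>

definition dir_deriv :: "('a::real_normed_vector \<Rightarrow> 'b::real_normed_vector) \<Rightarrow> 'a \<Rightarrow> 'a \<Rightarrow> 'b"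
  where "dir_deriv f v = (\<lambda>x. frechet_derivative f (at x) v)"

definition pointwise_bounded ::
  "'a set \<Rightarrow> ('a \<Rightarrow> 'b::real_normed_vector) set \<Rightarrow> bool" where
  "pointwise_bounded S F \<longleftrightarrow> (\<forall>x\<in>S. \<exists>C. \<forall>f\<in>F. norm (f x) \<le> C)"

text \<open>Uniformity of the remainder in F is what yields differentiability for an operator norm:
  take for F the derivatives of a map along all lists of k vectors of norm at most one.\<close>

definition equi_differentiable ::
  "'a::real_normed_vector set \<Rightarrow> ('a \<Rightarrow> 'b::real_normed_vector) set \<Rightarrow> bool" where
  "equi_differentiable S F \<longleftrightarrow> (\<forall>x\<in>S. (\<forall>f\<in>F. f differentiable (at x)) \<and>
     (\<forall>e>0. \<exists>d>0. \<forall>y. norm (y - x) < d \<longrightarrow>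
        (\<forall>f\<in>F. norm (f y - f x - dir_deriv f (y - x) x) \<le> e * norm (y - x))))"

definition unit_derivs ::
  "('a::real_normed_vector \<Rightarrow> 'b::real_normed_vector) set \<Rightarrow> ('a \<Rightarrow> 'b) set" where
  "unit_derivs F = {dir_deriv f v | f v. f \<in> F \<and> norm v \<le> 1}"

text \<open>Order 0 asks for bounds at each point only. On a set of unit derivatives such a bound
  says that the differentials are bounded operators; continuity comes with differentiability, hence
  from order 1 on.\<close>

primrec equi_C ::
  "nat \<Rightarrow> 'a::real_normed_vector set \<Rightarrow> ('a \<Rightarrow> 'b::real_normed_vector) set \<Rightarrow> bool" where
  "equi_C 0 S F = pointwise_bounded S F"
| "equi_C (Suc n) S F =
     (pointwise_bounded S F \<and> equi_differentiable S F \<and> equi_C n S (unit_derivs F))"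

lemma dir_deriv_eq:
  "(f has_derivative f') (at x) \<Longrightarrow> dir_deriv f v x = f' v"
  unfolding dir_deriv_def by (metis frechet_derivative_at)

lemma has_derivative_dir_deriv:
  "f differentiable (at x) \<Longrightarrow> (f has_derivative (\<lambda>v. dir_deriv f v x)) (at x)"
  unfolding dir_deriv_def by (simp add: frechet_derivative_works)

text \<open>True also where f is not differentiable: the choice made by
  \<open>frechet_derivative\<close> depends only on the set of candidate derivatives, and that set
  is determined near x.\<close>

lemma dir_deriv_cong:
  assumes "open S" "x \<in> S" "\<And>y. y \<in> S \<Longrightarrow> f y = g y"
  shows "dir_deriv f v x = dir_deriv g v x"
proof -
  have "(f has_derivative f') (at x) = (g has_derivative f') (at x)" for f'
    using assms by (metis (mono_tags) has_derivative_transform_within_open)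
  then show ?thesis unfolding dir_deriv_def frechet_derivative_def by simp
qed

lemma differentiable_cong_open:
  assumes "open S" "x \<in> S" "\<And>y. y \<in> S \<Longrightarrow> f y = g y" "g differentiable (at x)"
  shows "f differentiable (at x)"
  using assms unfolding differentiable_def
  by (metis (mono_tags) has_derivative_transform_within_open)

lemma pointwise_boundedI:
  "(\<And>x. x \<in> S \<Longrightarrow> \<exists>C. \<forall>f\<in>F. norm (f x) \<le> C) \<Longrightarrow> pointwise_bounded S F"
  unfolding pointwise_bounded_def by blast

lemma pointwise_boundedE:
  assumes "pointwise_bounded S F" "x \<in> S"
  obtains C where "C > 0" "\<And>f. f \<in> F \<Longrightarrow> norm (f x) \<le> C"
proof -
  obtain C where "\<forall>f\<in>F. norm (f x) \<le> C" using assms unfolding pointwise_bounded_def by blast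
  then show ?thesis using that[of "max C 1"] by (auto simp: le_max_iff_disj)
qed

lemma equi_differentiableE:
  assumes "equi_differentiable S F" "x \<in> S" "e > 0"
  obtains d where "d > 0" "\<And>y f. norm (y - x) < d \<Longrightarrow> f \<in> F \<Longrightarrow>
    norm (f y - f x - dir_deriv f (y - x) x) \<le> e * norm (y - x)"
  using assms unfolding equi_differentiable_def by metis

lemma equi_differentiable_has_derivative:
  assumes "equi_differentiable S F" "x \<in> S" "f \<in> F"
  shows "(f has_derivative (\<lambda>v. dir_deriv f v x)) (at x)"
  using assms unfolding equi_differentiable_def by (simp add: has_derivative_dir_deriv)

lemma equi_C_bounded: "equi_C n S F \<Longrightarrow> pointwise_bounded S F"
  by (cases n) auto

text \<open>Formulas for derivatives hold on S only, while functions are total. Covering up to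
  agreement on S therefore takes the place of inclusion whenever a set of derivatives is
  computed.\<close>

lemma equi_C_cover:
  assumes "open S" "equi_C n S G" "\<And>f. f \<in> F \<Longrightarrow> \<exists>g\<in>G. \<forall>x\<in>S. f x = g x"
  shows "equi_C n S F"
  using assms(2,3)
proof (induction n arbitrary: F G)
  case bdd: (0 F G)
  then show ?case unfolding equi_C.simps pointwise_bounded_def by metis
next
  case (Suc n F G)
  have b: "pointwise_bounded S F"
    using Suc.prems unfolding equi_C.simps pointwise_bounded_def by metis
  have dd: "equi_differentiable S F"
    unfolding equi_differentiable_def
  proof (intro ballI conjI allI impI)
    fix x f assume x: "x \<in> S" "f \<in> F"
    then obtain g where "g \<in> G" "\<forall>x\<in>S. f x = g x" using Suc.prems by blast
    then show "f differentiable (at x)"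
      using differentiable_cong_open[OF assms(1) x(1), of f g] Suc.prems x
      by (auto simp: equi_differentiable_def)
  next
    fix x and e :: real assume x: "x \<in> S" "e > 0"
    obtain d where d: "d > 0" "\<And>y g. norm (y - x) < d \<Longrightarrow> g \<in> G \<Longrightarrow>
      norm (g y - g x - dir_deriv g (y - x) x) \<le> e * norm (y - x)"
      using equi_differentiableE[of S G x e] Suc.prems(1) x by auto
    obtain r where r: "r > 0" "ball x r \<subseteq> S" using assms(1) x openE by blast
    show "\<exists>d>0. \<forall>y. norm (y - x) < d \<longrightarrow>
       (\<forall>f\<in>F. norm (f y - f x - dir_deriv f (y - x) x) \<le> e * norm (y - x))"
    proof (intro exI[of _ "min d r"] conjI allI impI ballI)
      fix y f assume y: "norm (y - x) < min d r" "f \<in> F"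
      obtain g where g: "g \<in> G" "\<forall>x\<in>S. f x = g x" using Suc.prems y by blast
      have "y \<in> S" using y r by (auto simp: dist_norm norm_minus_commute subset_eq)
      moreover have "dir_deriv f (y - x) x = dir_deriv g (y - x) x"
        using dir_deriv_cong assms(1) x(1) g(2) by blast
      ultimately show "norm (f y - f x - dir_deriv f (y - x) x) \<le> e * norm (y - x)"
        using d(2)[of y g] g x y by auto
    qed (use d r in auto)
  qed
  have "equi_C n S (unit_derivs F)"
  proof (rule Suc.IH)
    show "equi_C n S (unit_derivs G)" using Suc.prems by simp
    fix h assume "h \<in> unit_derivs F"
    then obtain f v where h: "h = dir_deriv f v" "f \<in> F" "norm v \<le> 1"
      unfolding unit_derivs_def by blast
    obtain g where g: "g \<in> G" "\<forall>x\<in>S. f x = g x" using Suc.prems h by blast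
    have "\<forall>x\<in>S. h x = dir_deriv g v x"
      using dir_deriv_cong[OF assms(1)] g(2) h(1) by blast
    then show "\<exists>g\<in>unit_derivs G. \<forall>x\<in>S. h x = g x"
      using g(1) h(3) unfolding unit_derivs_def by blast
  qed
  then show ?case using b dd by simp
qed

lemma equi_C_subset: "open S \<Longrightarrow> equi_C n S G \<Longrightarrow> F \<subseteq> G \<Longrightarrow> equi_C n S F"
  by (rule equi_C_cover) auto

lemma equi_C_domain: "equi_C n S F \<Longrightarrow> T \<subseteq> S \<Longrightarrow> equi_C n T F"
proof (induction n arbitrary: F)
  case 0 then show ?case by (simp add: pointwise_bounded_def subset_eq)
next
  case (Suc n)
  then show ?case by (simp add: pointwise_bounded_def equi_differentiable_def subset_eq)
qed

lemma equi_C_local: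
  "(\<And>x. x \<in> S \<Longrightarrow> \<exists>T. x \<in> T \<and> equi_C n T F) \<Longrightarrow> equi_C n S F"
proof (induction n arbitrary: F)
  case 0 then show ?case by (force simp: pointwise_bounded_def)
next
  case (Suc n)
  have "pointwise_bounded S F" "equi_differentiable S F"
    using Suc.prems unfolding equi_C.simps pointwise_bounded_def equi_differentiable_def by meson+
  moreover have "equi_C n S (unit_derivs F)"
    using Suc.prems by (intro Suc.IH) (metis equi_C.simps(2))
  ultimately show ?case by simp
qed

lemma equi_C_Suc_imp: "equi_C (Suc n) S F \<Longrightarrow> equi_C n S F"
  by (induction n arbitrary: F) auto

text \<open>The constant \<open>K\<close> in the remainder estimate is there so that estimates obtained by adding
  and multiplying bounds need no rescaling of \<open>e\<close>.\<close>

lemma equi_C_SucI: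
  assumes "open S" and "pointwise_bounded S (\<Phi> ` I)"
    and lin: "\<And>x i. x \<in> S \<Longrightarrow> i \<in> I \<Longrightarrow> linear (D i x)"
    and bdd: "\<And>x i. x \<in> S \<Longrightarrow> i \<in> I \<Longrightarrow> \<exists>C. \<forall>v. norm (D i x v) \<le> C * norm v"
    and rem: "\<And>x. x \<in> S \<Longrightarrow> \<exists>K. \<forall>e. 0 < e \<and> e \<le> 1 \<longrightarrow> (\<exists>d>0. \<forall>y\<in>S. norm (y - x) < d \<longrightarrow>
      (\<forall>i\<in>I. norm (\<Phi> i y - \<Phi> i x - D i x (y - x)) \<le> K * e * norm (y - x)))"
    and der: "equi_C n S {\<lambda>x. D i x v | i v. i \<in> I \<and> norm v \<le> 1}"
  shows "equi_C (Suc n) S (\<Phi> ` I)"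
    and "\<And>x i. x \<in> S \<Longrightarrow> i \<in> I \<Longrightarrow> (\<Phi> i has_derivative D i x) (at x)"
proof -
  have rem': "\<exists>d>0. \<forall>y. norm (y - x) < d \<longrightarrow>
      (\<forall>i\<in>I. norm (\<Phi> i y - \<Phi> i x - D i x (y - x)) \<le> e * norm (y - x))"
    if x: "x \<in> S" "e > 0" for x and e :: real
  proof -
    obtain r where r: "r > 0" "ball x r \<subseteq> S" using assms(1) x openE by blast
    obtain K where K: "\<forall>e. 0 < e \<and> e \<le> 1 \<longrightarrow> (\<exists>d>0. \<forall>y\<in>S. norm (y - x) < d \<longrightarrow>
      (\<forall>i\<in>I. norm (\<Phi> i y - \<Phi> i x - D i x (y - x)) \<le> K * e * norm (y - x)))"
      using rem[OF x(1)] by blast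
    \<comment> \<open>Chosen so that K * e' \<le> e and e' \<le> 1; the summand 1 keeps the
      denominator positive when K = 0.\<close>
    define e' where "e' = min 1 (e / (\<bar>K\<bar> + 1))"
    have e': "0 < e'" "e' \<le> 1" using x by (auto simp: e'_def)
    have "K * e' \<le> \<bar>K\<bar> * (e / (\<bar>K\<bar> + 1))"
      using e' by (intro mult_mono) (auto simp: e'_def)
    also have "\<dots> \<le> e" using x by (simp add: field_simps)
    finally have Ke: "K * e' \<le> e" .
    obtain d where d: "d > 0" "\<forall>y\<in>S. norm (y - x) < d \<longrightarrow>
      (\<forall>i\<in>I. norm (\<Phi> i y - \<Phi> i x - D i x (y - x)) \<le> K * e' * norm (y - x))"
      using K e' by blast
    show ?thesis
    proof (intro exI[of _ "min d r"] conjI allI impI ballI)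
      fix y i assume y: "norm (y - x) < min d r" "i \<in> I"
      then have "y \<in> S" using r by (auto simp: dist_norm norm_minus_commute subset_eq)
      then have "norm (\<Phi> i y - \<Phi> i x - D i x (y - x)) \<le> K * e' * norm (y - x)" using d y by auto
      also have "\<dots> \<le> e * norm (y - x)" using Ke by (intro mult_right_mono) auto
      finally show "norm (\<Phi> i y - \<Phi> i x - D i x (y - x)) \<le> e * norm (y - x)" .
    qed (use d r in auto)
  qed
  have bl: "bounded_linear (D i x)" if x: "x \<in> S" "i \<in> I" for x i
  proof -
    obtain C where C: "\<forall>v. norm (D i x v) \<le> C * norm v" using bdd[OF x] by blast
    interpret linear "D i x" by (rule lin[OF x])
    show ?thesis using C by (intro bounded_linear_intro[of _ C]) (auto simp: add scale mult.commute)
  qed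
  show hd: "(\<Phi> i has_derivative D i x) (at x)" if x: "x \<in> S" "i \<in> I" for x i
    unfolding has_derivative_at_alt using bl[OF x] rem'[OF x(1)] x(2) by meson
  have dd: "dir_deriv (\<Phi> i) v x = D i x v" if "x \<in> S" "i \<in> I" for x i v
    using hd[OF that] by (rule dir_deriv_eq)
  have "equi_differentiable S (\<Phi> ` I)"
    unfolding equi_differentiable_def
  proof (intro ballI conjI allI impI)
    fix x f assume "x \<in> S" "f \<in> \<Phi> ` I"
    then show "f differentiable (at x)" using hd unfolding differentiable_def by blast
  next
    fix x and e :: real assume "x \<in> S" "0 < e"
    then show "\<exists>d>0. \<forall>y. norm (y - x) < d \<longrightarrow>
       (\<forall>f\<in>\<Phi> ` I. norm (f y - f x - dir_deriv f (y - x) x) \<le> e * norm (y - x))"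
      using rem'[of x e] dd[of x] by simp
  qed
  moreover have "equi_C n S (unit_derivs (\<Phi> ` I))"
    using dd by (intro equi_C_cover[OF assms(1) der]) (force simp: unit_derivs_def)
  ultimately show "equi_C (Suc n) S (\<Phi> ` I)" using assms(2) by simp
qed

lemma equi_C_unit_derivs: "equi_C (Suc n) S F \<Longrightarrow> equi_C n S (unit_derivs F)"
  by simp

lemma unit_derivsI: "f \<in> F \<Longrightarrow> norm v \<le> 1 \<Longrightarrow> dir_deriv f v \<in> unit_derivs F"
  unfolding unit_derivs_def by blast

lemma linear_norm_le_unit:
  assumes "linear L" and "\<And>v. norm v \<le> 1 \<Longrightarrow> norm (L v) \<le> C"
  shows "norm (L v) \<le> C * norm v"
proof (cases "v = 0")
  case True then show ?thesis using linear_0[OF assms(1)] by simp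
next
  case False
  have "L v = norm v *\<^sub>R L (v /\<^sub>R norm v)"
    using False by (simp add: linear_scale[OF assms(1)])
  then have "norm (L v) = norm v * norm (L (v /\<^sub>R norm v))" by simp
  also have "\<dots> \<le> norm v * C" using False by (intro mult_left_mono assms(2)) auto
  finally show ?thesis by (simp add: mult.commute)
qed

lemma equi_C_dir_deriv_bound:
  assumes "equi_C (Suc n) S F" "x \<in> S"
  obtains C where "C > 0" "\<And>f v. f \<in> F \<Longrightarrow> norm (dir_deriv f v x) \<le> C * norm v"
proof -
  obtain C where C: "C > 0" "\<And>h. h \<in> unit_derivs F \<Longrightarrow> norm (h x) \<le> C"
    using pointwise_boundedE[OF equi_C_bounded[OF equi_C_unit_derivs[OF assms(1)]] assms(2)] by blast
  have "norm (dir_deriv f v x) \<le> C * norm v" if f: "f \<in> F" for f v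
  proof (rule linear_norm_le_unit)
    show "linear (\<lambda>v. dir_deriv f v x)"
      using equi_differentiable_has_derivative[of S F x f] assms f
      by (auto dest: has_derivative_bounded_linear bounded_linear.linear)
    show "norm (dir_deriv f v x) \<le> C" if "norm v \<le> 1" for v
      using C(2) unit_derivsI[OF f that] by blast
  qed
  then show ?thesis using that C(1) by blast
qed

lemma equi_C_SucE:
  assumes "equi_C (Suc n) S F" "x \<in> S"
  obtains C where "C > 0" "\<And>f. f \<in> F \<Longrightarrow> norm (f x) \<le> C"
    "\<And>f v. f \<in> F \<Longrightarrow> norm (dir_deriv f v x) \<le> C * norm v"
proof -
  obtain C where C: "C > 0" "\<And>f. f \<in> F \<Longrightarrow> norm (f x) \<le> C"
    using pointwise_boundedE[OF equi_C_bounded[OF assms(1)] assms(2)] by blast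
  obtain D where D: "D > 0" "\<And>f v. f \<in> F \<Longrightarrow> norm (dir_deriv f v x) \<le> D * norm v"
    using equi_C_dir_deriv_bound[OF assms] by blast
  show ?thesis
  proof (rule that[of "C + D"])
    show "norm (f x) \<le> C + D" if "f \<in> F" for f using C(2)[OF that] D(1) by simp
    show "norm (dir_deriv f v x) \<le> (C + D) * norm v" if "f \<in> F" for f v
      using D(2)[OF that, of v] C(1) by (simp add: distrib_right add_increasing)
  qed (use C D in simp)
qed

lemma equi_C_linear_dir_deriv:
  assumes "equi_C (Suc n) S F" "x \<in> S" "f \<in> F"
  shows "linear (\<lambda>v. dir_deriv f v x)"
  using equi_differentiable_has_derivative[of S F x f] assms
  by (auto dest: has_derivative_bounded_linear bounded_linear.linear)

lemma equi_C_remainder: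
  assumes "equi_C (Suc n) S F" "x \<in> S" "e > 0"
  obtains d where "d > 0" "\<And>y f. norm (y - x) < d \<Longrightarrow> f \<in> F \<Longrightarrow>
    norm (f y - f x - dir_deriv f (y - x) x) \<le> e * norm (y - x)"
  using equi_differentiableE[of S F x e] assms by auto

section \<open>Sum, product and chain rule of order n\<close>

lemma pointwise_bounded_add:
  assumes "pointwise_bounded S F" "pointwise_bounded S G"
  shows "pointwise_bounded S ((\<lambda>(f, g) x. f x + g x) ` (F \<times> G))"
proof (rule pointwise_boundedI)
  fix x assume x: "x \<in> S"
  obtain C where C: "\<And>f. f \<in> F \<Longrightarrow> norm (f x) \<le> C"
    using pointwise_boundedE[OF assms(1) x] by metis
  obtain D where D: "\<And>f. f \<in> G \<Longrightarrow> norm (f x) \<le> D"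
    using pointwise_boundedE[OF assms(2) x] by metis
  show "\<exists>C. \<forall>h\<in>(\<lambda>(f, g) x. f x + g x) ` (F \<times> G). norm (h x) \<le> C"
    using C D by (intro exI[of _ "C + D"]) (auto intro!: norm_triangle_mono)
qed

text \<open>All sums of pairs are taken at once: a unit derivative of such a sum is the sum of a
  pair of unit derivatives, so the induction hypothesis covers it.\<close>

lemma equi_C_add:
  fixes F G :: "('a::real_normed_vector \<Rightarrow> 'b::real_normed_vector) set"
  assumes "open S" "equi_C n S F" "equi_C n S G"
  shows "equi_C n S ((\<lambda>(f, g) x. f x + g x) ` (F \<times> G))"
  using assms(2,3)
proof (induction n arbitrary: F G)
  case 0
  then show ?case by (simp add: pointwise_bounded_add)
next
  case (Suc n)
  define D where "D = (\<lambda>(f :: 'a \<Rightarrow> 'b, g) x v. dir_deriv f v x + dir_deriv g v x)"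
  show ?case
  proof (rule equi_C_SucI(1)[where D=D])
    show "pointwise_bounded S ((\<lambda>(f, g) x. f x + g x) ` (F \<times> G))"
      using Suc.prems by (intro pointwise_bounded_add equi_C_bounded)
  next
    fix x i assume "x \<in> S" "i \<in> F \<times> G"
    then show "linear (D i x)"
      using equi_C_linear_dir_deriv[OF Suc.prems(1)] equi_C_linear_dir_deriv[OF Suc.prems(2)]
      by (auto simp: D_def intro!: linear_compose_add)
  next
    fix x i assume x: "x \<in> S" and i: "i \<in> F \<times> G"
    obtain C where C: "\<And>f v. f \<in> F \<Longrightarrow> norm (dir_deriv f v x) \<le> C * norm v"
      using equi_C_SucE[OF Suc.prems(1) x] by metis
    obtain C' where C': "\<And>f v. f \<in> G \<Longrightarrow> norm (dir_deriv f v x) \<le> C' * norm v"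
      using equi_C_SucE[OF Suc.prems(2) x] by metis
    show "\<exists>C. \<forall>v. norm (D i x v) \<le> C * norm v"
      using i C C' by (intro exI[of _ "C + C'"])
        (auto simp: D_def distrib_right intro!: norm_triangle_mono)
  next
    fix x assume x: "x \<in> S"
    show "\<exists>K. \<forall>e. 0 < e \<and> e \<le> 1 \<longrightarrow> (\<exists>d>0. \<forall>y\<in>S. norm (y - x) < d \<longrightarrow>
      (\<forall>i\<in>F \<times> G. norm ((case i of (f, g) \<Rightarrow> \<lambda>x. f x + g x) y
         - (case i of (f, g) \<Rightarrow> \<lambda>x. f x + g x) x - D i x (y - x)) \<le> K * e * norm (y - x)))"
    proof (rule exI[of _ 2], intro allI impI)
      fix e :: real assume e: "0 < e \<and> e \<le> 1"
      obtain d1 where d1: "d1 > 0" "\<And>y f. norm (y - x) < d1 \<Longrightarrow> f \<in> F \<Longrightarrow>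
        norm (f y - f x - dir_deriv f (y - x) x) \<le> e * norm (y - x)"
        using equi_C_remainder[OF Suc.prems(1) x] e by blast
      obtain d2 where d2: "d2 > 0" "\<And>y f. norm (y - x) < d2 \<Longrightarrow> f \<in> G \<Longrightarrow>
        norm (f y - f x - dir_deriv f (y - x) x) \<le> e * norm (y - x)"
        using equi_C_remainder[OF Suc.prems(2) x] e by blast
      have "norm (f y + g y - (f x + g x) - (dir_deriv f (y - x) x + dir_deriv g (y - x) x))
         \<le> 2 * e * norm (y - x)"
        if y: "norm (y - x) < min d1 d2" "f \<in> F" "g \<in> G" for y f g
      proof -
        have "f y + g y - (f x + g x) - (dir_deriv f (y - x) x + dir_deriv g (y - x) x) =
          (f y - f x - dir_deriv f (y - x) x) + (g y - g x - dir_deriv g (y - x) x)" by simp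
        also have "norm \<dots> \<le> e * norm (y - x) + e * norm (y - x)"
          using d1(2)[of y f] d2(2)[of y g] y by (intro norm_triangle_mono) auto
        finally show ?thesis by simp
      qed
      then show "\<exists>d>0. \<forall>y\<in>S. norm (y - x) < d \<longrightarrow>
        (\<forall>i\<in>F \<times> G. norm ((case i of (f, g) \<Rightarrow> \<lambda>x. f x + g x) y
         - (case i of (f, g) \<Rightarrow> \<lambda>x. f x + g x) x - D i x (y - x)) \<le> 2 * e * norm (y - x))"
        using d1(1) d2(1) by (intro exI[of _ "min d1 d2"]) (auto simp: D_def)
    qed
  next
    show "equi_C n S {\<lambda>x. D i x v | i v. i \<in> F \<times> G \<and> norm v \<le> 1}"
    proof (rule equi_C_subset[OF assms(1) Suc.IH[of "unit_derivs F" "unit_derivs G"]])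
      show "{\<lambda>x. D i x v | i v. i \<in> F \<times> G \<and> norm v \<le> 1}
        \<subseteq> (\<lambda>(f, g) x. f x + g x) ` (unit_derivs F \<times> unit_derivs G)"
        by (force simp: D_def dest: unit_derivsI)
    qed (use Suc.prems in auto)
  qed (rule assms(1))
qed

text \<open>A member W of \<W> stands for the operator-valued map that sends x to
  \<open>\<lambda>w. W w x\<close>. Its values on the unit ball are functions of x alone, and
  \<open>equi_C\<close> of these values is regularity in the operator norm.\<close>

definition unit_values :: "('b::real_normed_vector \<Rightarrow> 'a \<Rightarrow> 'c) set \<Rightarrow> ('a \<Rightarrow> 'c) set" where
  "unit_values \<W> = {W w | W w. W \<in> \<W> \<and> norm w \<le> 1}"

lemma unit_valuesI: "W \<in> \<W> \<Longrightarrow> norm w \<le> 1 \<Longrightarrow> W w \<in> unit_values \<W>"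
  unfolding unit_values_def by blast

lemma pointwise_bounded_eval:
  assumes "pointwise_bounded S (unit_values \<W>)" "pointwise_bounded S P"
    and "\<And>W x. W \<in> \<W> \<Longrightarrow> x \<in> S \<Longrightarrow> linear (\<lambda>w. W w x)"
  shows "pointwise_bounded S ((\<lambda>(W, p) x. W (p x) x) ` (\<W> \<times> P))"
proof (rule pointwise_boundedI)
  fix x assume x: "x \<in> S"
  obtain C where C: "C > 0" "\<And>f. f \<in> unit_values \<W> \<Longrightarrow> norm (f x) \<le> C"
    using pointwise_boundedE[OF assms(1) x] by metis
  obtain D where D: "D > 0" "\<And>p. p \<in> P \<Longrightarrow> norm (p x) \<le> D"
    using pointwise_boundedE[OF assms(2) x] by metis
  have "norm (W (p x) x) \<le> C * D" if "W \<in> \<W>" "p \<in> P" for W p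
  proof -
    have "norm (W (p x) x) \<le> C * norm (p x)"
      using linear_norm_le_unit[OF assms(3)[OF that(1) x]] C(2) unit_valuesI[OF that(1)] by blast
    also have "\<dots> \<le> C * D" using C(1) D(2)[OF that(2)] by simp
    finally show ?thesis .
  qed
  then show "\<exists>C. \<forall>h\<in>(\<lambda>(W, p) x. W (p x) x) ` (\<W> \<times> P). norm (h x) \<le> C" by auto
qed

text \<open>Unit vectors w are covered by the hypothesis, all others by homogeneity. Linearity in w
  survives differentiation because it is an identity between functions of x on the open set
  S.\<close>

lemma linear_family_dir_deriv:
  fixes \<W> :: "('b::real_normed_vector \<Rightarrow> 'a::real_normed_vector \<Rightarrow> 'c::real_normed_vector) set"
  assumes "open S" "equi_C (Suc n) S (unit_values \<W>)"
    and lin: "\<And>W x. W \<in> \<W> \<Longrightarrow> x \<in> S \<Longrightarrow> linear (\<lambda>w. W w x)"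
    and "W \<in> \<W>" "x \<in> S"
  shows "(W w has_derivative (\<lambda>h. dir_deriv (W w) h x)) (at x)"
    and "linear (\<lambda>w. dir_deriv (W w) h x)"
proof -
  have diff: "W w differentiable (at x)" if x: "x \<in> S" for w x
  proof -
    \<comment> \<open>Positive even for w = 0, and w divided by c lies in the unit ball.\<close>
    define c where "c = norm w + 1"
    have c: "c > 0" unfolding c_def by (simp add: add_nonneg_pos)
    have u: "norm (w /\<^sub>R c) \<le> 1" using c by (simp add: c_def field_simps)
    have "W (w /\<^sub>R c) differentiable (at x)"
      using assms(2) x unit_valuesI[OF assms(4) u] by (auto simp: equi_differentiable_def)
    then have "(\<lambda>y. c *\<^sub>R W (w /\<^sub>R c) y) differentiable (at x)"
      by (intro differentiable_scaleR) auto
    then show ?thesis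
      using c linear_scale[OF lin[OF assms(4)]]
      by (elim differentiable_cong_open[OF assms(1) x, rotated]) simp
  qed
  show der: "(W w has_derivative (\<lambda>h. dir_deriv (W w) h x)) (at x)" for w
    by (rule has_derivative_dir_deriv[OF diff[OF assms(5)]])
  show "linear (\<lambda>w. dir_deriv (W w) h x)"
  proof (rule linearI)
    fix v w
    have "dir_deriv (W (v + w)) h x = dir_deriv (\<lambda>y. W v y + W w y) h x"
      using lin[OF assms(4)] by (intro dir_deriv_cong[OF assms(1,5)]) (simp add: linear_add[of "\<lambda>w. W w _"])
    also have "\<dots> = dir_deriv (W v) h x + dir_deriv (W w) h x"
      by (rule dir_deriv_eq[OF has_derivative_add[OF der der]])
    finally show "dir_deriv (W (v + w)) h x = dir_deriv (W v) h x + dir_deriv (W w) h x" .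
  next
    fix c w
    have "dir_deriv (W (c *\<^sub>R w)) h x = dir_deriv (\<lambda>y. c *\<^sub>R W w y) h x"
      using lin[OF assms(4)] by (intro dir_deriv_cong[OF assms(1,5)]) (simp add: linear_scale[of "\<lambda>w. W w _"])
    also have "\<dots> = c *\<^sub>R dir_deriv (W w) h x"
      by (rule dir_deriv_eq[OF has_derivative_scaleR_right[OF der]])
    finally show "dir_deriv (W (c *\<^sub>R w)) h x = c *\<^sub>R dir_deriv (W w) h x" .
  qed
qed

text \<open>The product rule. The derivative has two summands, and both are again evaluations: of
  derivatives of \<W> at p, and of \<W> at derivatives of p. With sets in both places the induction
  hypothesis applies to each.\<close>

lemma equi_C_eval:
  fixes \<W> :: "('b::real_normed_vector \<Rightarrow> 'a::real_normed_vector \<Rightarrow> 'c::real_normed_vector) set"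
  assumes "open S" "equi_C n S (unit_values \<W>)" "equi_C n S P"
    and "\<And>W x. W \<in> \<W> \<Longrightarrow> x \<in> S \<Longrightarrow> linear (\<lambda>w. W w x)"
  shows "equi_C n S ((\<lambda>(W, p) x. W (p x) x) ` (\<W> \<times> P))"
  using assms(2-4)
proof (induction n arbitrary: \<W> P)
  case 0
  then show ?case by (simp add: pointwise_bounded_eval)
next
  case (Suc n)
  note lin = Suc.prems(3)
  have W_der: "(W w has_derivative (\<lambda>h. dir_deriv (W w) h x)) (at x)"
    and W_lin: "linear (\<lambda>w. dir_deriv (W w) h x)" if "W \<in> \<W>" "x \<in> S" for W w h x
    using linear_family_dir_deriv[OF assms(1) Suc.prems(1) _ that] lin by blast+
  define D where "D = (\<lambda>(W :: 'b \<Rightarrow> 'a \<Rightarrow> 'c, p) x v. dir_deriv (W (p x)) v x + W (dir_deriv p v x) x)"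
  have W_lin2: "linear (\<lambda>h. dir_deriv (W w) h x)" if "W \<in> \<W>" "x \<in> S" for W w x
    using W_der[OF that] by (rule bounded_linear.linear[OF has_derivative_bounded_linear])
  have bound: "\<exists>C>0. (\<forall>W\<in>\<W>. \<forall>w h. norm (W w x) \<le> C * norm w \<and>
      norm (dir_deriv (W w) h x) \<le> C * norm h * norm w) \<and>
      (\<forall>p\<in>P. \<forall>h. norm (p x) \<le> C \<and> norm (dir_deriv p h x) \<le> C * norm h)" if x: "x \<in> S" for x
  proof -
    obtain C where C: "C > 0" "\<And>f. f \<in> unit_values \<W> \<Longrightarrow> norm (f x) \<le> C"
      "\<And>f v. f \<in> unit_values \<W> \<Longrightarrow> norm (dir_deriv f v x) \<le> C * norm v"
      using equi_C_SucE[OF Suc.prems(1) x] by metis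
    obtain E where E: "E > 0" "\<And>f. f \<in> P \<Longrightarrow> norm (f x) \<le> E"
      "\<And>f v. f \<in> P \<Longrightarrow> norm (dir_deriv f v x) \<le> E * norm v"
      using equi_C_SucE[OF Suc.prems(2) x] by metis
    have a: "norm (W w x) \<le> C * norm w" if "W \<in> \<W>" for W w
      using linear_norm_le_unit[OF lin[OF that x]] C(2) unit_valuesI[OF that] by blast
    have b: "norm (dir_deriv (W w) h x) \<le> C * norm h * norm w" if "W \<in> \<W>" for W w h
      using linear_norm_le_unit[OF W_lin[OF that x]] C(3) unit_valuesI[OF that] by blast
    have m: "C * u \<le> (C + E) * u" "E * u \<le> (C + E) * u" if "u \<ge> 0" for u
      using C(1) E(1) that by (auto intro!: mult_right_mono)
    show ?thesis
    proof (intro exI[of _ "C + E"] conjI ballI allI)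
      fix W w h assume W: "W \<in> \<W>"
      show "norm (W w x) \<le> (C + E) * norm w" using a[OF W, of w] m(1)[of "norm w"] by simp
      show "norm (dir_deriv (W w) h x) \<le> (C + E) * norm h * norm w"
        using b[OF W, of w h] m(1)[of "norm h * norm w"] by (simp add: mult.assoc)
    next
      fix p h assume p: "p \<in> P"
      show "norm (p x) \<le> C + E" using E(2)[OF p] C(1) by simp
      show "norm (dir_deriv p h x) \<le> (C + E) * norm h" using E(3)[OF p, of h] m(2)[of "norm h"] by simp
    qed (use C E in simp)
  qed
  show ?case
  proof (rule equi_C_SucI(1)[where D=D])
    show "pointwise_bounded S ((\<lambda>(W, p) x. W (p x) x) ` (\<W> \<times> P))"
      using Suc.prems by (intro pointwise_bounded_eval equi_C_bounded)
  next
    fix x i assume x: "x \<in> S" and i: "i \<in> \<W> \<times> P"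
    have "linear (\<lambda>v. W (dir_deriv p v x) x)" if "W \<in> \<W>" "p \<in> P" for W p
      using linear_compose[OF equi_C_linear_dir_deriv[OF Suc.prems(2) x that(2)] lin[OF that(1) x]]
      by (simp add: o_def)
    then show "linear (D i x)"
      using i x W_lin2 by (auto simp: D_def intro!: linear_compose_add)
  next
    fix x i assume x: "x \<in> S" and i: "i \<in> \<W> \<times> P"
    obtain C where C: "C > 0" "\<forall>W\<in>\<W>. \<forall>w h. norm (W w x) \<le> C * norm w \<and>
      norm (dir_deriv (W w) h x) \<le> C * norm h * norm w"
      "\<forall>p\<in>P. \<forall>h. norm (p x) \<le> C \<and> norm (dir_deriv p h x) \<le> C * norm h"
      using bound[OF x] by blast
    have "norm (dir_deriv (W (p x)) v x + W (dir_deriv p v x) x) \<le> (C * C + C * C) * norm v"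
      if "W \<in> \<W>" "p \<in> P" for W p v
    proof -
      have "norm (dir_deriv (W (p x)) v x) \<le> C * norm v * norm (p x)" using C that by blast
      also have "\<dots> \<le> C * norm v * C" using C that by (intro mult_left_mono) auto
      finally have 1: "norm (dir_deriv (W (p x)) v x) \<le> C * norm v * C" .
      have "norm (W (dir_deriv p v x) x) \<le> C * norm (dir_deriv p v x)" using C that by blast
      also have "\<dots> \<le> C * (C * norm v)" using C that by (intro mult_left_mono) auto
      finally have 2: "norm (W (dir_deriv p v x) x) \<le> C * (C * norm v)" .
      show ?thesis using norm_triangle_mono[OF 1 2] by (simp add: algebra_simps)
    qed
    then show "\<exists>C. \<forall>v. norm (D i x v) \<le> C * norm v"
      using i by (auto simp: D_def)
  next
    fix x assume x: "x \<in> S"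
    obtain C where C: "C > 0" "\<And>W w. W \<in> \<W> \<Longrightarrow> norm (W w x) \<le> C * norm w"
      "\<And>W w h. W \<in> \<W> \<Longrightarrow> norm (dir_deriv (W w) h x) \<le> C * norm h * norm w"
      "\<And>p. p \<in> P \<Longrightarrow> norm (p x) \<le> C" "\<And>p h. p \<in> P \<Longrightarrow> norm (dir_deriv p h x) \<le> C * norm h"
      using bound[OF x] by metis
    show "\<exists>K. \<forall>e. 0 < e \<and> e \<le> 1 \<longrightarrow> (\<exists>d>0. \<forall>y\<in>S. norm (y - x) < d \<longrightarrow>
      (\<forall>i\<in>\<W> \<times> P. norm ((case i of (W, p) \<Rightarrow> \<lambda>x. W (p x) x) y
         - (case i of (W, p) \<Rightarrow> \<lambda>x. W (p x) x) x - D i x (y - x)) \<le> K * e * norm (y - x)))"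
    \<comment> \<open>The sum of three error constants: moving the base point while the argument is
      p y, passing from p y to p x in the derivative of W, and the remainder of p.\<close>
    proof (rule exI[of _ "2 * C + 1 + C * (C + 1) + C"], intro allI impI)
      fix e :: real assume e: "0 < e \<and> e \<le> 1"
      obtain d1 where d1: "d1 > 0" "\<And>y f. norm (y - x) < d1 \<Longrightarrow> f \<in> unit_values \<W> \<Longrightarrow>
        norm (f y - f x - dir_deriv f (y - x) x) \<le> e * norm (y - x)"
        using equi_C_remainder[OF Suc.prems(1) x] e by blast
      obtain d2 where d2: "d2 > 0" "\<And>y f. norm (y - x) < d2 \<Longrightarrow> f \<in> P \<Longrightarrow>
        norm (f y - f x - dir_deriv f (y - x) x) \<le> e * norm (y - x)"
        using equi_C_remainder[OF Suc.prems(2) x] e by blast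
      \<comment> \<open>The bound by e serves the second error: it is a product of two increments of
        the size of norm (y - x), and one of them has to supply the factor e.\<close>
      define d where "d = min (min d1 d2) e"
      have "norm (W (p y) y - W (p x) x - (dir_deriv (W (p x)) (y - x) x + W (dir_deriv p (y - x) x) x))
         \<le> (2 * C + 1 + C * (C + 1) + C) * e * norm (y - x)"
        if y: "norm (y - x) < d" "y \<in> S" and W: "W \<in> \<W>" and p: "p \<in> P" for y W p
      proof -
        let ?h = "y - x" and ?r = "p y - p x - dir_deriv p (y - x) x"
        have yd: "norm ?h < d1" "norm ?h < d2" "norm ?h < e" using y by (auto simp: d_def)
        have r: "norm ?r \<le> e * norm ?h" using d2(2)[OF yd(2) p] .
        have dp: "norm (p y - p x) \<le> (C + 1) * norm ?h"
        proof -
          have "norm (p y - p x) \<le> norm ?r + norm (dir_deriv p ?h x)" by norm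
          also have "\<dots> \<le> e * norm ?h + C * norm ?h" using r C(5)[OF p] by (intro add_mono) auto
          also have "\<dots> \<le> 1 * norm ?h + C * norm ?h" using e by (intro add_mono mult_right_mono) auto
          finally show ?thesis by (simp add: algebra_simps)
        qed
        have py: "norm (p y) \<le> 2 * C + 1"
        proof -
          have "norm (p y) \<le> norm (p x) + norm (p y - p x)" by norm
          also have "\<dots> \<le> C + (C + 1) * 1"
            using dp C(4)[OF p] yd e C(1) by (intro add_mono order_trans[OF dp] mult_left_mono) auto
          finally show ?thesis by simp
        qed
        have wr: "norm (W w y - W w x - dir_deriv (W w) ?h x) \<le> e * norm ?h * norm w" for w
        proof (rule linear_norm_le_unit)
          show "linear (\<lambda>w. W w y - W w x - dir_deriv (W w) ?h x)"
            using lin[OF W] x y W_lin[OF W x] by (intro linear_compose_sub) auto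
        qed (use d1(2)[OF yd(1)] unit_valuesI[OF W] in blast)
        have 1: "norm (W (p y) y - W (p y) x - dir_deriv (W (p y)) ?h x) \<le> (2 * C + 1) * e * norm ?h"
          using wr[of "p y"] mult_left_mono[OF py, of "e * norm ?h"] e by (simp add: algebra_simps)
        have 2: "norm (dir_deriv (W (p y)) ?h x - dir_deriv (W (p x)) ?h x) \<le> C * (C + 1) * e * norm ?h"
        proof -
          have "dir_deriv (W (p y)) ?h x - dir_deriv (W (p x)) ?h x = dir_deriv (W (p y - p x)) ?h x"
            by (rule linear_diff[OF W_lin[OF W x], symmetric])
          also have "norm \<dots> \<le> C * norm ?h * norm (p y - p x)" by (rule C(3)[OF W])
          also have "\<dots> \<le> C * norm ?h * ((C + 1) * e)"
            using dp yd C(1) by (intro mult_left_mono order_trans[OF dp]) auto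
          finally show ?thesis by (simp add: algebra_simps)
        qed
        have 3: "norm (W ?r x) \<le> C * e * norm ?h"
          using order_trans[OF C(2)[OF W] mult_left_mono[OF r]] C(1) by (simp add: mult.assoc)
        have "W ?r x = W (p y) x - W (p x) x - W (dir_deriv p ?h x) x"
          by (simp only: linear_diff[OF lin[OF W x]])
        then have "W (p y) y - W (p x) x - (dir_deriv (W (p x)) ?h x + W (dir_deriv p ?h x) x) =
          (W (p y) y - W (p y) x - dir_deriv (W (p y)) ?h x)
          + (dir_deriv (W (p y)) ?h x - dir_deriv (W (p x)) ?h x) + W ?r x" by simp
        also have "norm \<dots> \<le> (2 * C + 1) * e * norm ?h + C * (C + 1) * e * norm ?h + C * e * norm ?h"
          using 1 2 3 by (intro norm_triangle_mono)
        also have "\<dots> = (2 * C + 1 + C * (C + 1) + C) * e * norm ?h" by (simp add: algebra_simps)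
        finally show ?thesis .
      qed
      then show "\<exists>d>0. \<forall>y\<in>S. norm (y - x) < d \<longrightarrow>
        (\<forall>i\<in>\<W> \<times> P. norm ((case i of (W, p) \<Rightarrow> \<lambda>x. W (p x) x) y
         - (case i of (W, p) \<Rightarrow> \<lambda>x. W (p x) x) x - D i x (y - x))
           \<le> (2 * C + 1 + C * (C + 1) + C) * e * norm (y - x))"
        using d1(1) d2(1) e by (intro exI[of _ d]) (auto simp: D_def d_def)
    qed
  next
    \<comment> \<open>The derivatives of the families in unit directions h, again linear in w. Read
      with w fixed, their unit values are unit derivatives of the unit values of \<W>.\<close>
    let ?V = "{\<lambda>w. dir_deriv (W w) h | W h. W \<in> \<W> \<and> norm h \<le> 1}"
    let ?A = "(\<lambda>(W, p) x. W (p x) x) ` (?V \<times> P)"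
    let ?B = "(\<lambda>(W, p) x. W (p x) x) ` (\<W> \<times> unit_derivs P)"
    have "unit_values ?V \<subseteq> unit_derivs (unit_values \<W>)"
      unfolding unit_values_def unit_derivs_def by blast
    then have "equi_C n S (unit_values ?V)"
      using equi_C_subset[OF assms(1) equi_C_unit_derivs[OF Suc.prems(1)]] by blast
    then have A: "equi_C n S ?A"
      using Suc.prems(2) W_lin by (intro Suc.IH) (auto intro: equi_C_Suc_imp)
    have B: "equi_C n S ?B"
      using Suc.prems lin by (intro Suc.IH) (auto intro: equi_C_Suc_imp)
    show "equi_C n S {\<lambda>x. D i x v | i v. i \<in> \<W> \<times> P \<and> norm v \<le> 1}"
    proof (rule equi_C_subset[OF assms(1) equi_C_add[OF assms(1) A B]], rule subsetI)
      fix f assume "f \<in> {\<lambda>x. D i x v | i v. i \<in> \<W> \<times> P \<and> norm v \<le> 1}"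
      then obtain W p v where f: "f = (\<lambda>x. dir_deriv (W (p x)) v x + W (dir_deriv p v x) x)"
        "W \<in> \<W>" "p \<in> P" "norm v \<le> 1" by (auto simp: D_def)
      have "(\<lambda>x. dir_deriv (W (p x)) v x) \<in> ?A"
        using f by (intro image_eqI[of _ _ "(\<lambda>w. dir_deriv (W w) v, p)"]) auto
      moreover have "(\<lambda>x. W (dir_deriv p v x) x) \<in> ?B"
        using f unit_derivsI[of p P v] by (intro image_eqI[of _ _ "(W, dir_deriv p v)"]) auto
      ultimately show "f \<in> (\<lambda>(f, g) x. f x + g x) ` (?A \<times> ?B)"
        unfolding f(1) by (intro image_eqI[of _ _ "(\<lambda>x. dir_deriv (W (p x)) v x, \<lambda>x. W (dir_deriv p v x) x)"]) auto
    qed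
  qed (rule assms(1))
qed

text \<open>Only the outer function ranges over a set. The derivative of a composite is an
  evaluation in the sense of \<open>equi_C_eval\<close>: an operator that depends on x through f,
  applied to a derivative of f. The operators are controlled by the induction hypothesis for
  \<open>unit_derivs H\<close> with the same f.\<close>

lemma equi_C_compose:
  fixes f :: "'a::real_normed_vector \<Rightarrow> 'b::real_normed_vector"
    and H :: "('b \<Rightarrow> 'c::real_normed_vector) set"
  assumes "open S" "f ` S \<subseteq> T" "equi_C n S {f}" "equi_C n T H"
  shows "equi_C n S ((\<lambda>h x. h (f x)) ` H)"
  using assms(3,4)
proof (induction n arbitrary: H)
  case 0
  then show ?case using assms(2) by (auto simp: pointwise_bounded_def)
next
  case (Suc n)
  define D where "D = (\<lambda>h x v. dir_deriv h (dir_deriv f v x) (f x) :: 'c)"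
  have f_lin: "linear (\<lambda>v. dir_deriv f v x)" if "x \<in> S" for x
    using equi_C_linear_dir_deriv[OF Suc.prems(1) that] by simp
  have h_lin: "linear (\<lambda>v. dir_deriv h v (f x))" if "x \<in> S" "h \<in> H" for x h
    using equi_C_linear_dir_deriv[OF Suc.prems(2)] assms(2) that by blast
  show ?case
  proof (rule equi_C_SucI(1)[where D=D])
    show "pointwise_bounded S ((\<lambda>h x. h (f x)) ` H)"
      using equi_C_bounded[OF Suc.prems(2)] assms(2) by (auto simp: pointwise_bounded_def)
  next
    fix x h assume "x \<in> S" "h \<in> H"
    then show "linear (D h x)"
      using linear_compose[OF f_lin h_lin] by (simp add: D_def o_def)
  next
    fix x h assume x: "x \<in> S" and h: "h \<in> H"
    then have fx: "f x \<in> T" using assms(2) by blast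
    obtain C where C: "C > 0"
      "\<And>g v. g \<in> H \<Longrightarrow> norm (dir_deriv g v (f x)) \<le> C * norm v"
      using equi_C_SucE[OF Suc.prems(2) fx] by metis
    obtain C' where C': "\<And>v. norm (dir_deriv f v x) \<le> C' * norm v"
      using equi_C_SucE[OF Suc.prems(1) x] by (metis singletonI)
    have "norm (D h x v) \<le> C * C' * norm v" for v
      unfolding D_def using order_trans[OF C(2)[OF h] mult_left_mono[OF C']] C(1)
      by (simp add: mult.assoc)
    then show "\<exists>C. \<forall>v. norm (D h x v) \<le> C * norm v" by blast
  next
    fix x assume x: "x \<in> S"
    then have fx: "f x \<in> T" using assms(2) by blast
    obtain C where C: "C > 0" "\<And>g v. g \<in> H \<Longrightarrow> norm (dir_deriv g v (f x)) \<le> C * norm v"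
      using equi_C_SucE[OF Suc.prems(2) fx] by metis
    obtain C' where C': "C' > 0" "\<And>v. norm (dir_deriv f v x) \<le> C' * norm v"
      using equi_C_SucE[OF Suc.prems(1) x] by (metis singletonI)
    show "\<exists>K. \<forall>e. 0 < e \<and> e \<le> 1 \<longrightarrow> (\<exists>d>0. \<forall>y\<in>S. norm (y - x) < d \<longrightarrow>
      (\<forall>h\<in>H. norm (h (f y) - h (f x) - D h x (y - x)) \<le> K * e * norm (y - x)))"
    \<comment> \<open>C' + 1 bounds the increment of f, which enters the remainder of h; C bounds
      the derivative of h, applied to the remainder of f.\<close>
    proof (rule exI[of _ "C' + 1 + C"], intro allI impI)
      fix e :: real assume e: "0 < e \<and> e \<le> 1"
      obtain d1 where d1: "d1 > 0" "\<And>y h. norm (y - f x) < d1 \<Longrightarrow> h \<in> H \<Longrightarrow>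
        norm (h y - h (f x) - dir_deriv h (y - f x) (f x)) \<le> e * norm (y - f x)"
        using equi_C_remainder[OF Suc.prems(2) fx] e by blast
      obtain d2 where d2: "d2 > 0" "\<And>y. norm (y - x) < d2 \<Longrightarrow>
        norm (f y - f x - dir_deriv f (y - x) x) \<le> e * norm (y - x)"
        using equi_C_remainder[OF Suc.prems(1) x] e by (metis singletonI)
      \<comment> \<open>The second bound keeps f y within d1 of f x.\<close>
      define d where "d = min d2 (d1 / (C' + 1))"
      have d0: "d > 0" using d1 d2 C' by (auto simp: d_def)
      have "norm (h (f y) - h (f x) - D h x (y - x)) \<le> (C' + 1 + C) * e * norm (y - x)"
        if y: "norm (y - x) < d" and h: "h \<in> H" for y h
      proof -
        let ?k = "y - x" and ?r = "f y - f x - dir_deriv f (y - x) x"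
        have r: "norm ?r \<le> e * norm ?k" using d2(2) y by (auto simp: d_def)
        have df: "norm (f y - f x) \<le> (C' + 1) * norm ?k"
        proof -
          have "norm (f y - f x) \<le> norm ?r + norm (dir_deriv f ?k x)" by norm
          also have "\<dots> \<le> e * norm ?k + C' * norm ?k" using r C'(2) by (intro add_mono) auto
          also have "\<dots> \<le> 1 * norm ?k + C' * norm ?k" using e by (intro add_mono mult_right_mono) auto
          finally show ?thesis by (simp add: algebra_simps)
        qed
        have "norm ?k < d1 / (C' + 1)" using y by (simp add: d_def)
        then have "norm (f y - f x) < d1"
          using df C'(1) by (simp add: pos_less_divide_eq mult.commute)
        then have 1: "norm (h (f y) - h (f x) - dir_deriv h (f y - f x) (f x)) \<le> (C' + 1) * e * norm ?k"
          using order_trans[OF d1(2)[OF _ h] mult_left_mono[OF df]] e by (simp add: mult_ac)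
        have 2: "norm (dir_deriv h ?r (f x)) \<le> C * e * norm ?k"
          using order_trans[OF C(2)[OF h] mult_left_mono[OF r]] C(1) by (simp add: mult.assoc)
        have "dir_deriv h ?r (f x) = dir_deriv h (f y - f x) (f x) - D h x ?k"
          unfolding D_def by (rule linear_diff[OF h_lin[OF x h]])
        then have "h (f y) - h (f x) - D h x ?k =
          (h (f y) - h (f x) - dir_deriv h (f y - f x) (f x)) + dir_deriv h ?r (f x)" by simp
        also have "norm \<dots> \<le> (C' + 1) * e * norm ?k + C * e * norm ?k"
          using 1 2 by (rule norm_triangle_mono)
        also have "\<dots> = (C' + 1 + C) * e * norm ?k" by (simp add: algebra_simps)
        finally show ?thesis .
      qed
      then show "\<exists>d>0. \<forall>y\<in>S. norm (y - x) < d \<longrightarrow>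
        (\<forall>h\<in>H. norm (h (f y) - h (f x) - D h x (y - x)) \<le> (C' + 1 + C) * e * norm (y - x))"
        using d0 by blast
    qed
  next
    \<comment> \<open>The outer derivatives along f, as operators; on unit vectors they are the
      compositions of \<open>unit_derivs H\<close> with f.\<close>
    let ?\<W> = "{\<lambda>w x. dir_deriv h w (f x) | h. h \<in> H}"
    have "equi_C n S ((\<lambda>h x. h (f x)) ` unit_derivs H)"
      using Suc.prems by (intro Suc.IH) (auto intro: equi_C_Suc_imp)
    then have W: "equi_C n S (unit_values ?\<W>)"
      by (rule equi_C_subset[OF assms(1)]) (auto simp: unit_values_def unit_derivs_def)
    show "equi_C n S {\<lambda>x. D h x v | h v. h \<in> H \<and> norm v \<le> 1}"
    proof (rule equi_C_subset[OF assms(1) equi_C_eval[OF assms(1) W equi_C_unit_derivs[OF Suc.prems(1)]]])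
      show "{\<lambda>x. D h x v | h v. h \<in> H \<and> norm v \<le> 1}
        \<subseteq> (\<lambda>(W, p) x. W (p x) x) ` (?\<W> \<times> unit_derivs {f})"
        by (force simp: D_def unit_derivs_def)
    qed (use h_lin in auto)
  qed (rule assms(1))
qed

section \<open>Operator-valued maps\<close>

lemma linear_blinfun_apply: "linear (blinfun_apply f)"
  by (rule bounded_linear.linear[OF blinfun.bounded_linear_right])

text \<open>The operator norm is a supremum over unit vectors w, and the hypothesis is uniform in w.
  So the derivative of F can be assembled from the derivatives of its values, taken together as an
  operator in w.\<close>

lemma equi_C_blinfun:
  fixes \<F> :: "('a::real_normed_vector \<Rightarrow> 'b::real_normed_vector \<Rightarrow>\<^sub>L 'c::real_normed_vector) set"
  assumes "open S" "equi_C n S {\<lambda>x. blinfun_apply (F x) w | F w. F \<in> \<F> \<and> norm w \<le> 1}"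
  shows "equi_C n S \<F>"
proof -
  have bounded: "pointwise_bounded S \<F>"
    if bdd: "pointwise_bounded S {\<lambda>x. blinfun_apply (F x) w | F w. F \<in> \<F> \<and> norm w \<le> 1}"
    for \<F> :: "('a \<Rightarrow> 'b \<Rightarrow>\<^sub>L 'c) set"
  proof (rule pointwise_boundedI)
    fix x assume "x \<in> S"
    obtain C where C: "C > 0"
      "\<And>f. f \<in> {\<lambda>x. blinfun_apply (F x) w | F w. F \<in> \<F> \<and> norm w \<le> 1} \<Longrightarrow> norm (f x) \<le> C"
      using pointwise_boundedE[OF bdd \<open>x \<in> S\<close>] by blast
    have "norm (F x) \<le> C" if F: "F \<in> \<F>" for F
    proof (rule norm_blinfun_bound)
      show "norm (blinfun_apply (F x) w) \<le> C * norm w" for w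
        using C(2) F by (intro linear_norm_le_unit linear_blinfun_apply) blast
    qed (use C(1) in simp)
    then show "\<exists>C. \<forall>F\<in>\<F>. norm (F x) \<le> C" by blast
  qed
  show ?thesis
    using assms(2)
  proof (induction n arbitrary: \<F>)
    case 0
    then show ?case by (simp add: bounded)
  next
    case (Suc n)
    let ?V = "\<lambda>\<F>::('a \<Rightarrow> 'b \<Rightarrow>\<^sub>L 'c) set. {\<lambda>x. blinfun_apply (F x) w | F w. F \<in> \<F> \<and> norm w \<le> 1}"
    let ?\<W> = "(\<lambda>F w x. blinfun_apply (F x) w) ` \<F>"
    \<comment> \<open>Off S the function under \<open>Blinfun\<close> need not be bounded linear; on
      S it is, which is the content of \<open>D_apply\<close>.\<close>
    define D where "D = (\<lambda>(F :: 'a \<Rightarrow> 'b \<Rightarrow>\<^sub>L 'c) x v. Blinfun (\<lambda>w. dir_deriv (\<lambda>x. blinfun_apply (F x) w) v x))"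
    have uv: "unit_values ?\<W> = ?V \<F>"
    proof (intro subset_antisym subsetI)
      fix f assume "f \<in> ?V \<F>"
      then obtain F w where "f = (\<lambda>x. blinfun_apply (F x) w)" "F \<in> \<F>" "norm w \<le> 1" by blast
      then show "f \<in> unit_values ?\<W>"
        using unit_valuesI[of "\<lambda>w x. blinfun_apply (F x) w" ?\<W> w] by blast
    qed (auto simp: unit_values_def)
    have VF: "(\<lambda>x. blinfun_apply (F x) w) \<in> ?V \<F>" if "F \<in> \<F>" "norm w \<le> 1" for F w
      using that by blast
    have hd: "((\<lambda>x. blinfun_apply (F x) w) has_derivative (\<lambda>h. dir_deriv (\<lambda>x. blinfun_apply (F x) w) h x)) (at x)"
      and lin_w: "linear (\<lambda>w. dir_deriv (\<lambda>x. blinfun_apply (F x) w) h x)" if "F \<in> \<F>" "x \<in> S" for F x w h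
      using linear_family_dir_deriv[where \<W>="?\<W>" and n=n and S=S and W="\<lambda>w x. blinfun_apply (F x) w" and x=x]
        assms(1) Suc.prems that by (auto simp only: uv intro: linear_blinfun_apply)
    have bound: "\<exists>C>0. \<forall>F\<in>\<F>. \<forall>w h. norm (dir_deriv (\<lambda>x. blinfun_apply (F x) w) h x) \<le> C * norm h * norm w"
      if x: "x \<in> S" for x
    proof -
      obtain C where C: "C > 0" "\<And>f v. f \<in> ?V \<F> \<Longrightarrow> norm (dir_deriv f v x) \<le> C * norm v"
        using equi_C_dir_deriv_bound[OF Suc.prems x] by blast
      have "norm (dir_deriv (\<lambda>x. blinfun_apply (F x) w) h x) \<le> C * norm h * norm w" if "F \<in> \<F>" for F w h
        using linear_norm_le_unit[OF lin_w[OF that x]] C(2) VF[OF that] by blast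
      then show ?thesis using C(1) by blast
    qed
    have D_apply: "blinfun_apply (D F x v) w = dir_deriv (\<lambda>x. blinfun_apply (F x) w) v x"
      if Fx: "F \<in> \<F>" "x \<in> S" for F x v w
    proof -
      obtain C where "\<forall>F\<in>\<F>. \<forall>w h. norm (dir_deriv (\<lambda>x. blinfun_apply (F x) w) h x) \<le> C * norm h * norm w"
        using bound[OF Fx(2)] by blast
      then have "bounded_linear (\<lambda>w. dir_deriv (\<lambda>x. blinfun_apply (F x) w) v x)"
        using linear_add[OF lin_w[OF Fx]] linear_scale[OF lin_w[OF Fx]] Fx(1)
        by (intro bounded_linear_intro[of _ "C * norm v"]) (auto simp: mult.commute)
      then show ?thesis unfolding D_def by (simp add: bounded_linear_Blinfun_apply)
    qed
    have lin_v: "linear (\<lambda>h. dir_deriv (\<lambda>x. blinfun_apply (F x) w) h x)" if "F \<in> \<F>" "x \<in> S" for F x w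
      using hd[OF that] by (rule bounded_linear.linear[OF has_derivative_bounded_linear])
    have "equi_C (Suc n) S ((\<lambda>F. F) ` \<F>)"
    proof (rule equi_C_SucI(1)[where D=D])
      show "pointwise_bounded S ((\<lambda>F. F) ` \<F>)"
        using bounded[OF equi_C_bounded[OF Suc.prems]] by simp
    next
      fix x F assume x: "x \<in> S" "F \<in> \<F>"
      show "linear (D F x)"
        using linear_add[OF lin_v[OF x(2,1)]] linear_scale[OF lin_v[OF x(2,1)]]
        by (intro linearI blinfun_eqI) (simp_all add: D_apply[OF x(2,1)] blinfun.add_left blinfun.scaleR_left)
    next
      fix x F assume x: "x \<in> S" "F \<in> \<F>"
      obtain C where "C > 0" "\<forall>F\<in>\<F>. \<forall>w h. norm (dir_deriv (\<lambda>x. blinfun_apply (F x) w) h x) \<le> C * norm h * norm w"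
        using bound[OF x(1)] by blast
      then have "norm (D F x v) \<le> C * norm v" for v
        using x by (intro norm_blinfun_bound) (auto simp: D_apply)
      then show "\<exists>C. \<forall>v. norm (D F x v) \<le> C * norm v" by blast
    next
      fix x assume x: "x \<in> S"
      show "\<exists>K. \<forall>e. 0 < e \<and> e \<le> 1 \<longrightarrow> (\<exists>d>0. \<forall>y\<in>S. norm (y - x) < d \<longrightarrow>
        (\<forall>F\<in>\<F>. norm (F y - F x - D F x (y - x)) \<le> K * e * norm (y - x)))"
      proof (rule exI[of _ 1], intro allI impI)
        fix e :: real assume e: "0 < e \<and> e \<le> 1"
        obtain d where d: "d > 0" "\<And>y f. norm (y - x) < d \<Longrightarrow> f \<in> ?V \<F> \<Longrightarrow>
          norm (f y - f x - dir_deriv f (y - x) x) \<le> e * norm (y - x)"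
          using equi_C_remainder[OF Suc.prems x] e by blast
        have "norm (F y - F x - D F x (y - x)) \<le> 1 * e * norm (y - x)"
          if y: "norm (y - x) < d" and F: "F \<in> \<F>" for y F
        proof (rule norm_blinfun_bound)
          show "norm (blinfun_apply (F y - F x - D F x (y - x)) w) \<le> 1 * e * norm (y - x) * norm w" for w
          proof (rule linear_norm_le_unit[OF linear_blinfun_apply])
            fix w :: 'b assume "norm w \<le> 1"
            then show "norm (blinfun_apply (F y - F x - D F x (y - x)) w) \<le> 1 * e * norm (y - x)"
              using d(2)[OF y VF[OF F]] by (simp add: blinfun.diff_left D_apply[OF F x])
          qed
        qed (use e in auto)
        then show "\<exists>d>0. \<forall>y\<in>S. norm (y - x) < d \<longrightarrow>
          (\<forall>F\<in>\<F>. norm (F y - F x - D F x (y - x)) \<le> 1 * e * norm (y - x))"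
          using d(1) by blast
      qed
    next
      let ?\<G> = "{\<lambda>x. D F x v | F v. F \<in> \<F> \<and> norm v \<le> 1}"
      show "equi_C n S ?\<G>"
      proof (rule Suc.IH, rule equi_C_cover[OF assms(1) equi_C_unit_derivs[OF Suc.prems]])
        fix f assume "f \<in> ?V ?\<G>"
        then obtain F v w where f: "f = (\<lambda>x. blinfun_apply (D F x v) w)" "F \<in> \<F>" "norm v \<le> 1" "norm w \<le> 1"
          by blast
        show "\<exists>g\<in>unit_derivs (?V \<F>). \<forall>x\<in>S. f x = g x"
          by (rule bexI[OF _ unit_derivsI[OF VF[OF f(2,4)] f(3)]]) (simp add: f D_apply)
      qed
    qed (rule assms(1))
    then show ?case by simp
  qed
qed

section \<open>Calculus of smooth maps\<close>

lemma prod_list_norm_le_1: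
  "(\<And>v. v \<in> set vs \<Longrightarrow> norm v \<le> 1) \<Longrightarrow> prod_list (map norm vs) \<le> 1"
  by (induction vs) (auto intro!: mult_le_one prod_list_nonneg)

lemma prod_list_norm_nonneg: "0 \<le> prod_list (map norm vs)"
  by (rule prod_list_nonneg) auto

text \<open>The derivative of \<open>\<lambda>x. D x vs\<close> in the direction v is
  \<open>\<lambda>x. D x (v # vs)\<close>. Lists of k unit vectors thus lead to lists of k + 1 unit
  vectors, and the induction on n runs over all k simultaneously.\<close>

lemma smooth_on_imp_equi_C:
  assumes "smooth_on S f"
  shows "equi_C n S {f}"
proof -
  obtain D where D: "\<forall>x\<in>S. D x [] = f x \<and>
        (\<forall>k. bounded_multilinear k (D x)) \<and>
        (\<forall>k. \<forall>e>0. \<exists>d>0. \<forall>y\<in>S. norm (y - x) < d \<longrightarrow>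
           (\<forall>vs. length vs = k \<longrightarrow>
              norm (D y vs - D x vs - D x ((y - x) # vs))
                \<le> e * norm (y - x) * prod_list (map norm vs)))" and S: "open S"
    using assms unfolding smooth_on_def by blast
  define I where "I = (\<lambda>k. {vs :: 'a list. length vs = k \<and> (\<forall>v\<in>set vs. norm v \<le> 1)})"
  have lin: "linear (\<lambda>v. D x (v # vs))" if "x \<in> S" for x vs
  proof -
    have "bounded_multilinear (length (0 # vs)) (D x)" using D that by blast
    \<comment> \<open>The head 0 is a placeholder that gives the list its length; the update
      overwrites it by v.\<close>
    then have "linear (\<lambda>v. D x ((0 # vs)[0 := v]))" unfolding bounded_multilinear_def by blast
    then show ?thesis by simp
  qed
  have bdd: "\<exists>C\<ge>0. \<forall>vs. length vs = k \<longrightarrow> norm (D x vs) \<le> C * prod_list (map norm vs)" if "x \<in> S" for x k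
  proof -
    have "bounded_multilinear k (D x)" using D that by blast
    then obtain C where C: "\<forall>vs. length vs = k \<longrightarrow> norm (D x vs) \<le> C * prod_list (map norm vs)"
      unfolding bounded_multilinear_def by blast
    have "norm (D x vs) \<le> \<bar>C\<bar> * prod_list (map norm vs)" if "length vs = k" for vs
      using C[rule_format, OF that] mult_right_mono[OF abs_ge_self[of C] prod_list_norm_nonneg[of vs]] by linarith
    then show ?thesis by (intro exI[of _ "\<bar>C\<bar>"]) auto
  qed
  have rem: "\<exists>d>0. \<forall>y\<in>S. norm (y - x) < d \<longrightarrow> (\<forall>vs. length vs = k \<longrightarrow>
      norm (D y vs - D x vs - D x ((y - x) # vs)) \<le> e * norm (y - x) * prod_list (map norm vs))"
    if "x \<in> S" "e > 0" for x k and e :: real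
    using D that by blast
  have "equi_C n S ((\<lambda>vs x. D x vs) ` I k)" for n k
  proof (induction n arbitrary: k)
    case 0
    show ?case unfolding equi_C.simps
    proof (rule pointwise_boundedI)
      fix x assume "x \<in> S"
      then obtain C where C: "C \<ge> 0" "\<forall>vs. length vs = k \<longrightarrow> norm (D x vs) \<le> C * prod_list (map norm vs)"
        using bdd by blast
      have "norm (D x vs) \<le> C" if "vs \<in> I k" for vs
        using C that mult_left_mono[OF prod_list_norm_le_1 C(1), of vs]
        by (fastforce simp: I_def)
      then show "\<exists>C. \<forall>f\<in>(\<lambda>vs x. D x vs) ` I k. norm (f x) \<le> C" by blast
    qed
  next
    case (Suc n)
    show ?case
    proof (rule equi_C_SucI(1)[where D="\<lambda>vs x v. D x (v # vs)"])
      show "pointwise_bounded S ((\<lambda>vs x. D x vs) ` I k)"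
        by (rule equi_C_bounded[OF Suc.IH])
    next
      fix x vs assume x: "x \<in> S" and vs: "vs \<in> I k"
      show "linear (\<lambda>v. D x (v # vs))" by (rule lin[OF x])
      obtain C where C: "C \<ge> 0" "\<forall>vs. length vs = Suc k \<longrightarrow> norm (D x vs) \<le> C * prod_list (map norm vs)"
        using bdd[OF x] by blast
      have "norm (D x (v # vs)) \<le> C * norm v" for v
      proof -
        have "norm (D x (v # vs)) \<le> C * (norm v * prod_list (map norm vs))"
          using C(2)[rule_format, of "v # vs"] vs by (simp add: I_def)
        also have "\<dots> \<le> C * (norm v * 1)"
          using C(1) vs by (intro mult_left_mono prod_list_norm_le_1) (auto simp: I_def)
        finally show ?thesis by simp
      qed
      then show "\<exists>C. \<forall>v. norm (D x (v # vs)) \<le> C * norm v" by blast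
    next
      fix x assume x: "x \<in> S"
      show "\<exists>K. \<forall>e. 0 < e \<and> e \<le> 1 \<longrightarrow> (\<exists>d>0. \<forall>y\<in>S. norm (y - x) < d \<longrightarrow>
        (\<forall>vs\<in>I k. norm (D y vs - D x vs - D x ((y - x) # vs)) \<le> K * e * norm (y - x)))"
      proof (rule exI[of _ 1], intro allI impI)
        fix e :: real assume e: "0 < e \<and> e \<le> 1"
        obtain d where d: "d > 0" "\<forall>y\<in>S. norm (y - x) < d \<longrightarrow> (\<forall>vs. length vs = k \<longrightarrow>
              norm (D y vs - D x vs - D x ((y - x) # vs)) \<le> e * norm (y - x) * prod_list (map norm vs))"
          using rem[OF x] e by blast
        have "norm (D y vs - D x vs - D x ((y - x) # vs)) \<le> 1 * e * norm (y - x)"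
          if "y \<in> S" "norm (y - x) < d" "vs \<in> I k" for y vs
        proof -
          have "e * norm (y - x) * prod_list (map norm vs) \<le> e * norm (y - x) * 1"
            using e that by (intro mult_left_mono prod_list_norm_le_1) (auto simp: I_def)
          then show ?thesis using d that by (fastforce simp: I_def)
        qed
        then show "\<exists>d>0. \<forall>y\<in>S. norm (y - x) < d \<longrightarrow>
          (\<forall>vs\<in>I k. norm (D y vs - D x vs - D x ((y - x) # vs)) \<le> 1 * e * norm (y - x))"
          using d(1) by blast
      qed
    next
      have "(\<lambda>x. D x (v # vs)) \<in> (\<lambda>vs x. D x vs) ` I (Suc k)" if "vs \<in> I k" "norm v \<le> 1" for v vs
        using that by (intro image_eqI[of _ _ "v # vs"]) (auto simp: I_def)
      then show "equi_C n S {\<lambda>x. D x (v # vs) | vs v. vs \<in> I k \<and> norm v \<le> 1}"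
        by (intro equi_C_subset[OF S Suc.IH[of "Suc k"]]) blast
    qed (rule S)
  qed
  from equi_C_subset[OF S this[of n 0], of "{\<lambda>x. D x []}"] have "equi_C n S {\<lambda>x. D x []}"
    by (auto simp: I_def)
  then show ?thesis by (rule equi_C_cover[OF S]) (use D in auto)
qed

text \<open>The head of the list is the direction of the last differentiation, to match
  \<open>D x (h # vs)\<close> in \<open>smooth_on\<close>, for which this is the witness.\<close>

definition iter_deriv ::
  "('a::real_normed_vector \<Rightarrow> 'b::real_normed_vector) \<Rightarrow> 'a list \<Rightarrow> 'a \<Rightarrow> 'b" where
  "iter_deriv f vs = foldr (\<lambda>v g. dir_deriv g v) vs f"

lemma iter_deriv_simps [simp]:
  "iter_deriv f [] = f" "iter_deriv f (v # vs) = dir_deriv (iter_deriv f vs) v"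
  by (simp_all add: iter_deriv_def)

lemma smooth_on_iff_equi_C:
  fixes f :: "'a::real_normed_vector \<Rightarrow> 'b::real_normed_vector"
  shows "smooth_on S f \<longleftrightarrow> open S \<and> (\<forall>n. equi_C n S {f})"
proof
  show "smooth_on S f \<Longrightarrow> open S \<and> (\<forall>n. equi_C n S {f})"
    using smooth_on_imp_equi_C by (auto simp: smooth_on_def)
next
  assume "open S \<and> (\<forall>n. equi_C n S {f})"
  then have S: "open S" and f: "\<And>n. equi_C n S {f}" by auto
  define K where "K = (\<lambda>k. {iter_deriv f vs | vs. length vs = k \<and> (\<forall>v\<in>set vs. norm v \<le> 1)})"
  have K: "equi_C n S (K k)" for n k
  proof (induction k arbitrary: n)
    case 0
    then show ?case using f by (simp add: K_def)
  next
    case (Suc k)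
    have "K (Suc k) \<subseteq> unit_derivs (K k)"
      unfolding K_def unit_derivs_def by (fastforce simp: length_Suc_conv)
    then show ?case using equi_C_subset[OF S equi_C_unit_derivs[OF Suc.IH]] by blast
  qed
  \<comment> \<open>Normalizes every entry. A zero entry stays zero, since inverse 0 = 0, and then
    both sides of \<open>hom\<close> vanish.\<close>
  define u where "u = map (\<lambda>v::'a. v /\<^sub>R norm v)"
  have u_len [simp]: "length (u vs) = length vs" for vs by (simp add: u_def)
  have uK: "iter_deriv f (u vs) \<in> K (length vs)" for vs
    unfolding K_def by (auto intro!: exI[of _ "u vs"] simp: u_def norm_inverse_le_norm divide_simps)
  have diff_u: "iter_deriv f (u vs) differentiable (at x)" if "x \<in> S" for vs x
    using K[of "Suc 0" "length vs"] uK that by (auto simp: equi_differentiable_def)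
  \<comment> \<open>Homogeneity in every slot carries the uniform statements from lists of unit
    vectors, where \<open>K\<close> applies, to all lists.\<close>
  have hom: "iter_deriv f vs x = prod_list (map norm vs) *\<^sub>R iter_deriv f (u vs) x" if "x \<in> S" for vs x
    using that
  proof (induction vs arbitrary: x)
    case (Cons v vs)
    let ?c = "prod_list (map norm vs)"
    have "iter_deriv f (v # vs) x = dir_deriv (\<lambda>x. ?c *\<^sub>R iter_deriv f (u vs) x) v x"
      unfolding iter_deriv_simps by (rule dir_deriv_cong[OF S Cons.prems Cons.IH])
    also have "\<dots> = ?c *\<^sub>R dir_deriv (iter_deriv f (u vs)) v x"
      by (rule dir_deriv_eq[OF has_derivative_scaleR_right[OF has_derivative_dir_deriv[OF diff_u[OF Cons.prems]]]])
    also have "dir_deriv (iter_deriv f (u vs)) v x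
      = dir_deriv (iter_deriv f (u vs)) (norm v *\<^sub>R (v /\<^sub>R norm v)) x" by (cases "v = 0") auto
    also have "\<dots> = norm v *\<^sub>R dir_deriv (iter_deriv f (u vs)) (v /\<^sub>R norm v) x"
      by (rule linear_scale[OF bounded_linear.linear[OF has_derivative_bounded_linear
            [OF has_derivative_dir_deriv[OF diff_u[OF Cons.prems]]]]])
    finally show ?case by (simp add: u_def mult.commute)
  qed (simp add: u_def)
  have diff: "iter_deriv f vs differentiable (at x)" if "x \<in> S" for vs x
  proof (rule differentiable_cong_open[OF S that hom])
    show "(\<lambda>x. prod_list (map norm vs) *\<^sub>R iter_deriv f (u vs) x) differentiable (at x)"
      using has_derivative_scaleR_right[OF has_derivative_dir_deriv[OF diff_u[OF that]]]
      unfolding differentiable_def by blast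
  qed
  have dir_hom: "dir_deriv (iter_deriv f vs) v x = prod_list (map norm vs) *\<^sub>R dir_deriv (iter_deriv f (u vs)) v x"
    if "x \<in> S" for vs x v
  proof -
    have "dir_deriv (iter_deriv f vs) v x = dir_deriv (\<lambda>x. prod_list (map norm vs) *\<^sub>R iter_deriv f (u vs) x) v x"
      by (rule dir_deriv_cong[OF S that hom])
    then show ?thesis
      using dir_deriv_eq[OF has_derivative_scaleR_right[OF has_derivative_dir_deriv[OF diff_u[OF that]]]] by simp
  qed
  \<comment> \<open>The head slot is linear as the argument of a differential. For a later slot,
    linearity of the inner derivative is an identity on S, which is differentiated.\<close>
  have slot: "linear (\<lambda>v. iter_deriv f (vs[i := v]) x)" if "x \<in> S" "i < length vs" for vs i x
    using that
  proof (induction vs arbitrary: i x)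
    case (Cons a vs)
    show ?case
    proof (cases i)
      case 0
      then show ?thesis
        using bounded_linear.linear[OF has_derivative_bounded_linear[OF has_derivative_dir_deriv[OF diff[OF Cons.prems(1)]]]]
        by simp
    next
      case (Suc j)
      have j: "j < length vs" using Cons.prems Suc by simp
      note l = Cons.IH[OF _ j]
      note hd = has_derivative_dir_deriv[OF diff[OF Cons.prems(1)]]
      show ?thesis
      proof (rule linearI)
        fix v w
        have "dir_deriv (iter_deriv f (vs[j := v + w])) a x
          = dir_deriv (\<lambda>x. iter_deriv f (vs[j := v]) x + iter_deriv f (vs[j := w]) x) a x"
          by (rule dir_deriv_cong[OF S Cons.prems(1)]) (rule linear_add[OF l])
        also have "\<dots> = dir_deriv (iter_deriv f (vs[j := v])) a x + dir_deriv (iter_deriv f (vs[j := w])) a x"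
          by (rule dir_deriv_eq[OF has_derivative_add[OF hd hd]])
        finally show "iter_deriv f ((a # vs)[i := v + w]) x =
          iter_deriv f ((a # vs)[i := v]) x + iter_deriv f ((a # vs)[i := w]) x" by (simp add: Suc)
      next
        fix c v
        have "dir_deriv (iter_deriv f (vs[j := c *\<^sub>R v])) a x
          = dir_deriv (\<lambda>x. c *\<^sub>R iter_deriv f (vs[j := v]) x) a x"
          by (rule dir_deriv_cong[OF S Cons.prems(1)]) (rule linear_scale[OF l])
        also have "\<dots> = c *\<^sub>R dir_deriv (iter_deriv f (vs[j := v])) a x"
          by (rule dir_deriv_eq[OF has_derivative_scaleR_right[OF hd]])
        finally show "iter_deriv f ((a # vs)[i := c *\<^sub>R v]) x = c *\<^sub>R iter_deriv f ((a # vs)[i := v]) x"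
          by (simp add: Suc)
      qed
    qed
  qed simp
  have "\<exists>C. \<forall>vs. length vs = k \<longrightarrow> norm (iter_deriv f vs x) \<le> C * prod_list (map norm vs)" if x: "x \<in> S" for x k
  proof -
    obtain C where C: "C > 0" "\<And>g. g \<in> K k \<Longrightarrow> norm (g x) \<le> C"
      using pointwise_boundedE[OF equi_C_bounded[OF K] x] by blast
    have "norm (iter_deriv f vs x) \<le> C * prod_list (map norm vs)" if "length vs = k" for vs
      using mult_left_mono[OF C(2)[of "iter_deriv f (u vs)"] prod_list_norm_nonneg[of vs]] uK[of vs] that
        hom[OF x, of vs] prod_list_norm_nonneg[of vs] by (simp add: mult.commute)
    then show ?thesis by blast
  qed
  then have ml: "bounded_multilinear k (\<lambda>vs. iter_deriv f vs x)" if "x \<in> S" for x k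
    using slot that unfolding bounded_multilinear_def by blast
  have rem: "\<exists>d>0. \<forall>y\<in>S. norm (y - x) < d \<longrightarrow> (\<forall>vs. length vs = k \<longrightarrow>
      norm (iter_deriv f vs y - iter_deriv f vs x - iter_deriv f ((y - x) # vs) x)
        \<le> e * norm (y - x) * prod_list (map norm vs))" if x: "x \<in> S" and e: "e > 0" for x k and e :: real
  proof -
    obtain d where d: "d > 0" "\<And>y f. norm (y - x) < d \<Longrightarrow> f \<in> K k \<Longrightarrow>
      norm (f y - f x - dir_deriv f (y - x) x) \<le> e * norm (y - x)"
      using equi_C_remainder[OF K x e] by blast
    have "norm (iter_deriv f vs y - iter_deriv f vs x - iter_deriv f ((y - x) # vs) x)
        \<le> e * norm (y - x) * prod_list (map norm vs)"
      if y: "y \<in> S" "norm (y - x) < d" "length vs = k" for y vs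
    proof -
      let ?g = "iter_deriv f (u vs)" and ?c = "prod_list (map norm vs)"
      have "iter_deriv f vs y - iter_deriv f vs x - iter_deriv f ((y - x) # vs) x
        = ?c *\<^sub>R (?g y - ?g x - dir_deriv ?g (y - x) x)"
        using hom[OF y(1), of vs] hom[OF x, of vs] dir_hom[OF x, of vs] by (simp add: scaleR_diff_right)
      also have "norm \<dots> = ?c * norm (?g y - ?g x - dir_deriv ?g (y - x) x)"
        using prod_list_norm_nonneg[of vs] by simp
      also have "\<dots> \<le> ?c * (e * norm (y - x))"
        using d(2)[OF y(2)] uK[of vs] y(3) prod_list_norm_nonneg[of vs] by (intro mult_left_mono) auto
      finally show ?thesis by (simp add: mult_ac)
    qed
    then show ?thesis using d(1) by blast
  qed
  show "smooth_on S f"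
    unfolding smooth_on_def
    by (intro conjI S exI[of _ "\<lambda>x vs. iter_deriv f vs x"] ballI allI impI ml rem) auto
qed

section \<open>Closure properties of smooth maps\<close>

lemma smooth_on_open: "smooth_on S f \<Longrightarrow> open S"
  by (simp add: smooth_on_def)

lemma smooth_on_cong:
  assumes "smooth_on S f" "\<And>x. x \<in> S \<Longrightarrow> f x = g x"
  shows "smooth_on S g"
  using assms by (auto simp: smooth_on_iff_equi_C intro: equi_C_cover)

lemma smooth_on_subset: "smooth_on S f \<Longrightarrow> open T \<Longrightarrow> T \<subseteq> S \<Longrightarrow> smooth_on T f"
  by (auto simp: smooth_on_iff_equi_C intro: equi_C_domain)

lemma smooth_on_local:
  assumes "\<And>x. x \<in> S \<Longrightarrow> \<exists>T. x \<in> T \<and> T \<subseteq> S \<and> smooth_on T f"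
  shows "smooth_on S f"
  unfolding smooth_on_iff_equi_C
proof (intro conjI allI)
  show "open S" using assms smooth_on_open by (subst open_subopen) blast
  show "equi_C n S {f}" for n
    using assms smooth_on_imp_equi_C by (intro equi_C_local) blast
qed

lemma smooth_on_compose:
  assumes "smooth_on S f" "smooth_on T h" "f ` S \<subseteq> T"
  shows "smooth_on S (\<lambda>x. h (f x))"
  using assms equi_C_compose[of S f T _ "{h}"] by (auto simp: smooth_on_iff_equi_C)

lemma smooth_on_has_derivative:
  assumes "smooth_on S f" "x \<in> S"
  shows "(f has_derivative (\<lambda>v. dir_deriv f v x)) (at x)"
proof -
  have "equi_C (Suc 0) S {f}" using assms(1) by (rule smooth_on_imp_equi_C)
  then show ?thesis
    using equi_differentiable_has_derivative[of S "{f}" x f] assms(2) by simp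
qed

lemma smooth_on_continuous_on: "smooth_on S f \<Longrightarrow> continuous_on S f"
  by (meson continuous_at_imp_continuous_on has_derivative_continuous smooth_on_has_derivative)

lemma smooth_on_open_vimage:
  assumes "smooth_on S f" "open T"
  shows "open (S \<inter> f -` T)"
  by (rule continuous_open_preimage[OF smooth_on_continuous_on[OF assms(1)] smooth_on_open[OF assms(1)] assms(2)])

lemma smooth_on_compose_vimage:
  assumes "smooth_on S f" "smooth_on T h"
  shows "smooth_on (S \<inter> f -` T) (\<lambda>x. h (f x))"
proof (rule smooth_on_compose[OF _ assms(2)])
  show "smooth_on (S \<inter> f -` T) f"
    using smooth_on_open_vimage[OF assms(1) smooth_on_open[OF assms(2)]]
    by (intro smooth_on_subset[OF assms(1)]) auto
qed auto

lemma equi_C_const: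
  assumes "open S" "\<And>c. c \<in> A \<Longrightarrow> norm c \<le> C"
  shows "equi_C n S ((\<lambda>c x. c) ` A)"
  using assms(2)
proof (induction n arbitrary: A C)
  case 0
  then show ?case by (auto simp: pointwise_bounded_def)
next
  case (Suc n)
  show ?case
  proof (rule equi_C_SucI(1)[where D="\<lambda>_ _ _. 0"])
    show "pointwise_bounded S ((\<lambda>c x. c) ` A)" using Suc.prems by (auto simp: pointwise_bounded_def)
    show "equi_C n S {\<lambda>x. 0 :: 'b | (i :: 'b) v. i \<in> A \<and> norm (v :: 'a) \<le> 1}"
      by (rule equi_C_subset[OF assms(1) Suc.IH[of "{0}" 0]]) auto
    show "\<exists>K. \<forall>e. 0 < e \<and> e \<le> 1 \<longrightarrow> (\<exists>d>0. \<forall>y\<in>S. norm (y - x) < d \<longrightarrow>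
      (\<forall>i\<in>A. norm (i - i - (0 :: 'b)) \<le> K * e * norm (y - x)))" for x :: 'a
      by (intro exI[of _ 1]) (auto intro: exI[of _ 1])
  qed (auto intro: assms(1) module_hom_zero exI[of _ 0])
qed

lemma equi_C_linear:
  fixes A :: "('a::real_normed_vector \<Rightarrow> 'b::real_normed_vector) set"
  assumes "open S" "\<And>L. L \<in> A \<Longrightarrow> linear L" "\<And>L v. L \<in> A \<Longrightarrow> norm (L v) \<le> C * norm v"
  shows "equi_C n S A"
proof (cases n)
  case 0
  then show ?thesis using assms(3) by (auto simp: pointwise_bounded_def)
next
  case (Suc m)
  have "equi_C (Suc m) S ((\<lambda>L. L) ` A)"
  proof (rule equi_C_SucI(1)[where D="\<lambda>L _ v. L v"])
    show "pointwise_bounded S ((\<lambda>L. L) ` A)" using assms(3) by (auto simp: pointwise_bounded_def)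
    show "equi_C m S {\<lambda>x::'a. L v | L v. L \<in> A \<and> norm v \<le> 1}"
    proof (rule equi_C_subset[OF assms(1) equi_C_const[OF assms(1)]])
      fix c assume "c \<in> {L v | L v. L \<in> A \<and> norm v \<le> 1}"
      then obtain L v where c: "c = L v" "L \<in> A" "norm v \<le> 1" by blast
      have "norm (L v) \<le> \<bar>C\<bar> * norm v"
        using assms(3)[OF c(2), of v] mult_right_mono[OF abs_ge_self[of C], of "norm v"] by simp
      also have "\<dots> \<le> \<bar>C\<bar> * 1" using c(3) by (intro mult_left_mono) auto
      finally show "norm c \<le> \<bar>C\<bar>" by (simp add: c)
    qed blast
  next
    fix x :: 'a
    show "\<exists>K. \<forall>e. 0 < e \<and> e \<le> 1 \<longrightarrow> (\<exists>d>0. \<forall>y\<in>S. norm (y - x) < d \<longrightarrow>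
      (\<forall>L\<in>A. norm (L y - L x - L (y - x)) \<le> K * e * norm (y - x)))"
      by (intro exI[of _ 1]) (auto simp: linear_diff[OF assms(2)] intro: exI[of _ 1])
  qed (use assms in auto)
  then show ?thesis by (simp add: Suc)
qed

lemma smooth_on_linear:
  assumes "bounded_linear L" "open S"
  shows "smooth_on S L"
proof -
  obtain C where "\<And>v. norm (L v) \<le> C * norm v"
    using bounded_linear.bounded[OF assms(1)] by (metis mult.commute)
  then show ?thesis
    using assms by (auto simp: smooth_on_iff_equi_C intro!: equi_C_linear bounded_linear.linear)
qed

lemma smooth_on_const: "open S \<Longrightarrow> smooth_on S (\<lambda>x. c)"
  using equi_C_const[of S "{c}" "norm c"] by (simp add: smooth_on_iff_equi_C)

lemma smooth_on_ident: "open S \<Longrightarrow> smooth_on S (\<lambda>x. x)"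
  by (rule smooth_on_linear) (rule bounded_linear_ident)

lemma smooth_on_bounded_linear:
  assumes "bounded_linear L" "smooth_on S f"
  shows "smooth_on S (\<lambda>x. L (f x))"
  by (rule smooth_on_compose[OF assms(2) smooth_on_linear[OF assms(1) open_UNIV]]) simp

lemma smooth_on_add:
  assumes "smooth_on S f" "smooth_on S g"
  shows "smooth_on S (\<lambda>x. f x + g x)"
  using assms equi_C_add[of S _ "{f}" "{g}"] by (auto simp: smooth_on_iff_equi_C)

lemma smooth_on_Pair:
  assumes "smooth_on S f" "smooth_on S g"
  shows "smooth_on S (\<lambda>x. (f x, g x))"
proof -
  have "smooth_on S (\<lambda>x. (f x, 0) + (0, g x))"
    by (intro smooth_on_add smooth_on_bounded_linear[OF _ assms(1)] smooth_on_bounded_linear[OF _ assms(2)]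
        bounded_linear_Pair bounded_linear_ident bounded_linear_zero)
  then show ?thesis by simp
qed

text \<open>Read as the evaluation of the operator \<open>B (f x)\<close> at g x. For unit w the
  functions \<open>\<lambda>a. B a w\<close> are linear with one common bound, so the chain rule
  covers their compositions with f.\<close>

lemma smooth_on_bounded_bilinear:
  fixes B :: "'b::real_normed_vector \<Rightarrow> 'c::real_normed_vector \<Rightarrow> 'd::real_normed_vector"
  assumes "bounded_bilinear B" "smooth_on S f" "smooth_on S g"
  shows "smooth_on S (\<lambda>x. B (f x) (g x))"
  unfolding smooth_on_iff_equi_C
proof (intro conjI allI)
  interpret bounded_bilinear B by fact
  show S: "open S" by (rule smooth_on_open[OF assms(2)])
  obtain K where K: "K > 0" "\<And>a b. norm (B a b) \<le> norm a * norm b * K"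
    using pos_bounded by metis
  fix n
  let ?H = "{\<lambda>a. B a w | w. norm w \<le> 1}" and ?\<W> = "{\<lambda>w x. B (f x) w}"
  have "equi_C n UNIV ?H"
  proof (rule equi_C_linear[OF open_UNIV])
    fix L assume "L \<in> ?H"
    then obtain w where L: "L = (\<lambda>a. B a w)" "norm w \<le> 1" by blast
    show "linear L" unfolding L(1) by (rule bounded_linear.linear[OF bounded_linear_left])
    show "norm (L a) \<le> K * norm a" for a
      using order_trans[OF K(2)[of a w]] mult_left_mono[OF L(2), of "norm a * K"] K(1)
      by (simp add: L(1) mult_ac)
  qed
  then have "equi_C n S ((\<lambda>h x. h (f x)) ` ?H)"
    using equi_C_compose[OF S _ smooth_on_imp_equi_C[OF assms(2)]] by blast
  then have "equi_C n S (unit_values ?\<W>)"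
    by (rule equi_C_subset[OF S]) (auto simp: unit_values_def)
  then have "equi_C n S ((\<lambda>(W, p) x. W (p x) x) ` (?\<W> \<times> {g}))"
    by (rule equi_C_eval[OF S _ smooth_on_imp_equi_C[OF assms(3)]])
      (auto intro: bounded_linear.linear[OF bounded_linear_right])
  then show "equi_C n S {\<lambda>x. B (f x) (g x)}" by simp
qed

lemmas smooth_on_blinfun_apply = smooth_on_bounded_bilinear[OF bounded_bilinear_blinfun_apply]
lemmas smooth_on_scaleR = smooth_on_bounded_bilinear[OF bounded_bilinear_scaleR]

lemma smooth_on_diff:
  assumes "smooth_on S f" "smooth_on S g"
  shows "smooth_on S (\<lambda>x. f x - g x)"
  using smooth_on_add[OF assms(1) smooth_on_bounded_linear[OF bounded_linear_minus[OF bounded_linear_ident] assms(2)]]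
  by simp

lemma smooth_on_sum:
  assumes "open S" "\<And>i. i \<in> I \<Longrightarrow> smooth_on S (f i)"
  shows "smooth_on S (\<lambda>x. \<Sum>i\<in>I. f i x)"
  using assms(2)
  by (induction I rule: infinite_finite_induct) (auto intro: smooth_on_const[OF assms(1)] smooth_on_add)

section \<open>The differential as a smooth map\<close>

definition fderiv :: "('a::real_normed_vector \<Rightarrow> 'b::real_normed_vector) \<Rightarrow> 'a \<Rightarrow> 'a \<Rightarrow>\<^sub>L 'b" where
  "fderiv f x = Blinfun (\<lambda>v. dir_deriv f v x)"

lemma fderiv_eq:
  assumes "(f has_derivative f') (at x)"
  shows "blinfun_apply (fderiv f x) = f'"
proof -
  have "(\<lambda>v. dir_deriv f v x) = f'" using dir_deriv_eq[OF assms] by blast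
  then show ?thesis
    unfolding fderiv_def by (simp add: bounded_linear_Blinfun_apply has_derivative_bounded_linear[OF assms])
qed

lemma smooth_on_has_fderiv:
  assumes "smooth_on S f" "x \<in> S"
  shows "(f has_derivative blinfun_apply (fderiv f x)) (at x)"
  using smooth_on_has_derivative[OF assms] fderiv_eq[OF smooth_on_has_derivative[OF assms]] by simp

text \<open>On unit vectors \<open>fderiv f\<close> consists of the unit derivatives of f, so order
  n for it is part of order n + 1 for f.\<close>

lemma smooth_on_fderiv:
  assumes "smooth_on S f"
  shows "smooth_on S (fderiv f)"
  unfolding smooth_on_iff_equi_C
proof (intro conjI allI)
  show S: "open S" by (rule smooth_on_open[OF assms])
  fix n
  show "equi_C n S {fderiv f}"
  proof (rule equi_C_blinfun[OF S], rule equi_C_cover[OF S equi_C_unit_derivs[OF smooth_on_imp_equi_C[OF assms]]])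
    fix g assume "g \<in> {\<lambda>x. blinfun_apply (F x) w | F w. F \<in> {fderiv f} \<and> norm w \<le> 1}"
    then obtain w where g: "g = (\<lambda>x. fderiv f x w)" "norm w \<le> 1" by blast
    show "\<exists>h\<in>unit_derivs {f}. \<forall>x\<in>S. g x = h x"
      using fderiv_eq[OF smooth_on_has_derivative[OF assms]] g unit_derivsI[of f "{f}" w] by fastforce
  qed
qed

lemma smooth_on_fderiv_apply:
  assumes "smooth_on T h" "smooth_on S f" "smooth_on S v" "f ` S \<subseteq> T"
  shows "smooth_on S (\<lambda>x. fderiv h (f x) (v x))"
  by (intro smooth_on_blinfun_apply smooth_on_compose[OF assms(2) smooth_on_fderiv[OF assms(1)] assms(4)] assms(3))

text \<open>The differential is continuous, hence on some ball bounded by its norm at x plus 1; a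
  ball is convex, so the mean value inequality applies.\<close>

lemma smooth_on_locally_lipschitz:
  assumes "smooth_on S f" "x \<in> S"
  obtains r L where "r > 0" "ball x r \<subseteq> S" "\<And>y z. y \<in> ball x r \<Longrightarrow> z \<in> ball x r \<Longrightarrow> norm (f y - f z) \<le> L * norm (y - z)"
proof -
  have "continuous_on S (fderiv f)" using smooth_on_continuous_on[OF smooth_on_fderiv[OF assms(1)]] .
  then have "\<forall>\<^sub>F y in at x. dist (fderiv f y) (fderiv f x) < 1"
    using assms smooth_on_open[OF assms(1)]
    by (auto simp: continuous_on_eq_continuous_at isCont_def intro: tendstoD)
  then obtain d where d: "d > 0" "\<And>y. y \<noteq> x \<Longrightarrow> dist y x < d \<Longrightarrow> dist (fderiv f y) (fderiv f x) < 1"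
    unfolding eventually_at by blast
  obtain e where e: "e > 0" "ball x e \<subseteq> S" using openE[OF smooth_on_open[OF assms(1)] assms(2)] .
  define r where "r = min d e"
  have r: "r > 0" "ball x r \<subseteq> S" using d e by (auto simp: r_def)
  have "norm (fderiv f y) \<le> norm (fderiv f x) + 1" if "y \<in> ball x r" for y
  proof (cases "y = x")
    case False
    then have "norm (fderiv f y - fderiv f x) < 1"
      using d(2)[of y] that by (simp add: r_def dist_norm norm_minus_commute)
    then show ?thesis by (smt (verit) norm_triangle_sub)
  qed simp
  then have "norm (f y - f z) \<le> (norm (fderiv f x) + 1) * norm (y - z)" if "y \<in> ball x r" "z \<in> ball x r" for y z
    using that subsetD[OF r(2)] has_derivative_at_withinI[OF smooth_on_has_fderiv[OF assms(1)]]
    by (intro differentiable_bound[where S="ball x r" and f'="\<lambda>y. blinfun_apply (fderiv f y)"])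
      (auto simp: norm_blinfun.rep_eq[symmetric])
  then show ?thesis using that r by blast
qed

section \<open>Curves and their derivatives at the origin\<close>

lemma nth_vderiv_0 [simp]: "nth_vderiv 0 f = f"
  by (simp add: nth_vderiv_def)

lemma nth_vderiv_Suc: "nth_vderiv (Suc k) f t = vector_derivative (nth_vderiv k f) (at t)"
  by (simp add: nth_vderiv_def)

lemma nth_vderiv_Suc': "nth_vderiv (Suc k) f = nth_vderiv k (\<lambda>t. vector_derivative f (at t))"
  unfolding nth_vderiv_def by (subst funpow_Suc_right) simp

lemma vector_derivative_cong_open:
  assumes "open S" "t \<in> S" "\<And>s. s \<in> S \<Longrightarrow> f s = g s"
  shows "vector_derivative f (at t) = vector_derivative g (at t)"
proof -
  have "(f has_vector_derivative D) (at t) = (g has_vector_derivative D) (at t)" for D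
    using assms by (metis (mono_tags) has_vector_derivative_transform_within_open)
  then show ?thesis by (simp add: vector_derivative_def)
qed

lemma nth_vderiv_cong:
  assumes "open S" "\<And>s. s \<in> S \<Longrightarrow> f s = g s" "t \<in> S"
  shows "nth_vderiv k f t = nth_vderiv k g t"
  using assms(3)
proof (induction k arbitrary: t)
  case (Suc k)
  then show ?case
    unfolding nth_vderiv_Suc by (intro vector_derivative_cong_open[OF assms(1)])
qed (use assms in simp)

lemma smooth_on_has_vector_derivative:
  assumes "smooth_on S f" "t \<in> S"
  shows "(f has_vector_derivative vector_derivative f (at t)) (at t)"
  using smooth_on_has_derivative[OF assms]
  by (metis differentiableI differentiableI_vector differentiable_def vector_derivative_works
      has_vector_derivative_def differentiable_on_def differentiable_at_imp_differentiable_on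
      vector_derivative_unique_at)

lemma smooth_on_vector_derivative:
  assumes "smooth_on S f"
  shows "smooth_on S (\<lambda>t. vector_derivative f (at t))"
proof (rule smooth_on_cong)
  show "smooth_on S (\<lambda>t. fderiv f t 1)"
    by (rule smooth_on_blinfun_apply[OF smooth_on_fderiv[OF assms] smooth_on_const[OF smooth_on_open[OF assms]]])
  fix t assume t: "t \<in> S"
  have "blinfun_apply (fderiv f t) = (\<lambda>x. x *\<^sub>R vector_derivative f (at t))"
    using smooth_on_has_vector_derivative[OF assms t]
    by (intro fderiv_eq) (simp add: has_vector_derivative_def)
  then show "fderiv f t 1 = vector_derivative f (at t)" by simp
qed

lemma smooth_on_nth_vderiv: "smooth_on S f \<Longrightarrow> smooth_on S (nth_vderiv k f)"
proof (induction k)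
  case (Suc k)
  have "nth_vderiv (Suc k) f = (\<lambda>t. vector_derivative (nth_vderiv k f) (at t))"
    by (rule ext) (rule nth_vderiv_Suc)
  then show ?case using smooth_on_vector_derivative[OF Suc.IH[OF Suc.prems]] by simp
qed simp

lemma nth_vderiv_has_vector_derivative:
  "smooth_on S f \<Longrightarrow> t \<in> S \<Longrightarrow> (nth_vderiv k f has_vector_derivative nth_vderiv (Suc k) f t) (at t)"
  unfolding nth_vderiv_Suc by (rule smooth_on_has_vector_derivative[OF smooth_on_nth_vderiv])

lemma nth_vderiv_bounded_linear:
  assumes "bounded_linear L" "smooth_on S f" "t \<in> S"
  shows "nth_vderiv k (\<lambda>t. L (f t)) t = L (nth_vderiv k f t)"
  using assms(3)
proof (induction k arbitrary: t)
  case (Suc k)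
  have "nth_vderiv (Suc k) (\<lambda>t. L (f t)) t = vector_derivative (\<lambda>t. L (nth_vderiv k f t)) (at t)"
    unfolding nth_vderiv_Suc
    by (rule vector_derivative_cong_open[OF smooth_on_open[OF assms(2)] Suc.prems Suc.IH])
  also have "\<dots> = L (nth_vderiv (Suc k) f t)"
    by (intro vector_derivative_at bounded_linear.has_vector_derivative[OF assms(1)]
        nth_vderiv_has_vector_derivative[OF assms(2) Suc.prems])
  finally show ?case .
qed simp

lemma nth_vderiv_add:
  assumes "smooth_on S f" "smooth_on S g" "t \<in> S"
  shows "nth_vderiv k (\<lambda>t. f t + g t) t = nth_vderiv k f t + nth_vderiv k g t"
  using assms(3)
proof (induction k arbitrary: t)
  case (Suc k)
  have "nth_vderiv (Suc k) (\<lambda>t. f t + g t) t = vector_derivative (\<lambda>t. nth_vderiv k f t + nth_vderiv k g t) (at t)"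
    unfolding nth_vderiv_Suc
    by (rule vector_derivative_cong_open[OF smooth_on_open[OF assms(1)] Suc.prems Suc.IH])
  also have "\<dots> = nth_vderiv (Suc k) f t + nth_vderiv (Suc k) g t"
    by (intro vector_derivative_at has_vector_derivative_add nth_vderiv_has_vector_derivative[OF _ Suc.prems] assms)
  finally show ?case .
qed simp

lemma nth_vderiv_diff:
  assumes "smooth_on S f" "smooth_on S g" "t \<in> S"
  shows "nth_vderiv k (\<lambda>t. f t - g t) t = nth_vderiv k f t - nth_vderiv k g t"
  using nth_vderiv_add[OF assms(1) smooth_on_bounded_linear[OF bounded_linear_minus[OF bounded_linear_ident] assms(2)] assms(3)]
    nth_vderiv_bounded_linear[OF bounded_linear_minus[OF bounded_linear_ident] assms(2,3)] by simp

lemma smooth_on_power: "open S \<Longrightarrow> smooth_on S (\<lambda>t::real. t ^ n)"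
  by (induction n) (auto intro: smooth_on_const smooth_on_ident smooth_on_bounded_bilinear[OF bounded_bilinear_mult])

section \<open>Prescribed derivatives and order of contact at 0\<close>

lemma nth_vderiv_monomial:
  "nth_vderiv j (\<lambda>t. (t ^ i / fact i) *\<^sub>R c) =
    (\<lambda>t. if j \<le> i then (t ^ (i - j) / fact (i - j)) *\<^sub>R c else 0)"
proof (induction j)
  case (Suc j)
  show ?case
  proof
    fix t :: real
    have "nth_vderiv (Suc j) (\<lambda>t. (t ^ i / fact i) *\<^sub>R c) t =
      vector_derivative (\<lambda>t. if j \<le> i then (t ^ (i - j) / fact (i - j)) *\<^sub>R c else 0) (at t)"
      by (simp add: nth_vderiv_Suc Suc.IH)
    also have "\<dots> = (if Suc j \<le> i then (t ^ (i - Suc j) / fact (i - Suc j)) *\<^sub>R c else 0)"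
    proof (cases "Suc j \<le> i")
      case True
      then obtain m where m: "i - j = Suc m" "i - Suc j = m" by (metis Suc_diff_le diff_Suc_Suc)
      have "((\<lambda>t. t ^ Suc m / fact (Suc m)) has_real_derivative (t ^ m / fact m)) (at t)"
      proof -
        have "((\<lambda>t. t ^ Suc m / fact (Suc m)) has_real_derivative (real (Suc m) * t ^ m / fact (Suc m))) (at t)"
          by (rule DERIV_cdivide) (use DERIV_pow[of "Suc m" t] in simp)
        moreover have "real (Suc m) * t ^ m / fact (Suc m) = t ^ m / fact m"
          by (simp add: divide_simps del: of_nat_Suc)
        ultimately show ?thesis by (simp only:)
      qed
      then have "((\<lambda>t. (t ^ Suc m / fact (Suc m)) *\<^sub>R c) has_vector_derivative ((t ^ m / fact m) *\<^sub>R c)) (at t)"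
        by (auto intro: derivative_eq_intros simp: has_real_derivative_iff_has_vector_derivative)
      from vector_derivative_at[OF this] show ?thesis
        using True m by (simp del: power_Suc fact_Suc)
    next
      case False
      then show ?thesis by (cases "j \<le> i") auto
    qed
    finally show "nth_vderiv (Suc j) (\<lambda>t. (t ^ i / fact i) *\<^sub>R c) t =
      (if Suc j \<le> i then (t ^ (i - Suc j) / fact (i - Suc j)) *\<^sub>R c else 0)" .
  qed
qed simp

lemma smooth_on_monomial: "open S \<Longrightarrow> smooth_on S (\<lambda>t::real. (t ^ i / fact i) *\<^sub>R c)"
  using smooth_on_scaleR[OF smooth_on_bounded_linear[OF bounded_linear_divide smooth_on_power] smooth_on_const] .

text \<open>The factorials make \<open>a i\<close> the derivative of order i at 0, so that any
  finite list of derivatives is realized.\<close>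

definition poly_curve :: "(nat \<Rightarrow> 'a::real_normed_vector) \<Rightarrow> nat \<Rightarrow> real \<Rightarrow> 'a" where
  "poly_curve a n t = (\<Sum>i\<le>n. (t ^ i / fact i) *\<^sub>R a i)"

lemma smooth_on_poly_curve: "open S \<Longrightarrow> smooth_on S (poly_curve a n)"
  unfolding poly_curve_def[abs_def] by (intro smooth_on_sum smooth_on_monomial)

lemma nth_vderiv_poly_curve: "nth_vderiv l (poly_curve a n) 0 = (if l \<le> n then a l else 0)"
proof (induction n)
  case 0
  have "poly_curve a 0 = (\<lambda>t. (t ^ 0 / fact 0) *\<^sub>R a 0)" by (rule ext) (simp add: poly_curve_def)
  then show ?case by (simp only: nth_vderiv_monomial) simp
next
  case (Suc n)
  have "poly_curve a (Suc n) = (\<lambda>t. poly_curve a n t + (t ^ Suc n / fact (Suc n)) *\<^sub>R a (Suc n))"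
    by (rule ext) (simp add: poly_curve_def)
  then have "nth_vderiv l (poly_curve a (Suc n)) 0 =
    nth_vderiv l (poly_curve a n) 0 + nth_vderiv l (\<lambda>t. (t ^ Suc n / fact (Suc n)) *\<^sub>R a (Suc n)) 0"
    by (simp only: nth_vderiv_add[OF smooth_on_poly_curve smooth_on_monomial UNIV_I] open_UNIV)
  moreover have "nth_vderiv l (\<lambda>t. (t ^ Suc n / fact (Suc n)) *\<^sub>R a (Suc n)) 0 = (if l = Suc n then a l else 0)"
    by (auto simp only: nth_vderiv_monomial) (auto simp: power_0_left)
  ultimately show ?case using Suc.IH by simp
qed

text \<open>The condition u(t) = o(t^k). The time t = 0 is included, with 0 ^ 0 = 1, so it forces u
  0 = 0 for every k.\<close>

definition flat_at_0 :: "nat \<Rightarrow> (real \<Rightarrow> 'a::real_normed_vector) \<Rightarrow> bool" where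
  "flat_at_0 k u \<longleftrightarrow> (\<forall>e>0. \<exists>d>0. \<forall>t. \<bar>t\<bar> < d \<longrightarrow> norm (u t) \<le> e * \<bar>t\<bar> ^ k)"

text \<open>Taylor's formula without integrals: by induction the derivative of u is o(t^k), and the
  mean value inequality on the interval of radius |t| gains one more factor t.\<close>

lemma flat_at_0_derivs:
  assumes "smooth_on S u" "0 \<in> S" "\<And>i. i \<le> k \<Longrightarrow> nth_vderiv i u 0 = 0"
  shows "flat_at_0 k u"
  using assms(1,3)
proof (induction k arbitrary: u)
  case 0
  have "isCont u 0"
    using smooth_on_has_derivative[OF 0(1) assms(2)] by (rule has_derivative_continuous)
  then have "\<exists>d>0. \<forall>t. \<bar>t\<bar> < d \<longrightarrow> norm (u t) \<le> e" if "e > 0" for e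
    using that 0(2)[of 0] unfolding continuous_at_eps_delta by (fastforce simp: dist_norm intro: less_imp_le)
  then show ?case by (simp add: flat_at_0_def)
next
  case (Suc k)
  have u': "flat_at_0 k (\<lambda>t. vector_derivative u (at t))"
    using Suc.prems(2) by (intro Suc.IH smooth_on_vector_derivative[OF Suc.prems(1)]) (simp flip: nth_vderiv_Suc')
  show ?case
    unfolding flat_at_0_def
  proof (intro allI impI)
    fix e :: real assume "e > 0"
    then obtain d where d: "d > 0" "\<And>t. \<bar>t\<bar> < d \<Longrightarrow> norm (vector_derivative u (at t)) \<le> e * \<bar>t\<bar> ^ k"
      using u' unfolding flat_at_0_def by blast
    obtain r where r: "r > 0" "ball 0 r \<subseteq> S" using openE[OF smooth_on_open[OF Suc.prems(1)] assms(2)] .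
    have "norm (u t) \<le> e * \<bar>t\<bar> ^ Suc k" if t: "\<bar>t\<bar> < min d r" for t
    proof -
      have "norm (u t - u 0) \<le> e * \<bar>t\<bar> ^ k * norm (t - 0)"
      proof (rule differentiable_bound[where S="cball (0::real) \<bar>t\<bar>" and f'="\<lambda>s v. v *\<^sub>R vector_derivative u (at s)"])
        fix s :: real assume "s \<in> cball 0 \<bar>t\<bar>"
        then have s: "\<bar>s\<bar> \<le> \<bar>t\<bar>" by simp
        then have "s \<in> S" using r t by (auto simp: subset_eq)
        then show "(u has_derivative (\<lambda>v. v *\<^sub>R vector_derivative u (at s))) (at s within cball 0 \<bar>t\<bar>)"
          using smooth_on_has_vector_derivative[OF Suc.prems(1)]
          by (auto simp: has_vector_derivative_def intro: has_derivative_at_withinI)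
        have "norm (vector_derivative u (at s)) \<le> e * \<bar>s\<bar> ^ k" using d(2) s t by simp
        also have "\<dots> \<le> e * \<bar>t\<bar> ^ k" using s \<open>e > 0\<close> by (intro mult_left_mono power_mono) auto
        finally show "onorm (\<lambda>v. v *\<^sub>R vector_derivative u (at s)) \<le> e * \<bar>t\<bar> ^ k"
          by (intro onorm_le) (simp add: mult.commute mult_left_mono)
      qed auto
      then show ?thesis using Suc.prems(2)[of 0] by (simp add: mult_ac)
    qed
    then show "\<exists>d>0. \<forall>t. \<bar>t\<bar> < d \<longrightarrow> norm (u t) \<le> e * \<bar>t\<bar> ^ Suc k"
      using d r by (intro exI[of _ "min d r"]) auto
  qed
qed

text \<open>Once the lower derivatives vanish, u differs from t^i / i! times its i-th derivative by
  o(t^i). For i \<le> k, flatness of order k then forces that derivative to be 0.\<close>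

lemma derivs_flat_at_0:
  assumes "smooth_on S u" "0 \<in> S" "flat_at_0 k u" "i \<le> k"
  shows "nth_vderiv i u 0 = 0"
  using assms(4)
proof (induction i rule: less_induct)
  case (less i)
  define c where "c = nth_vderiv i u 0"
  define w where "w = (\<lambda>t. u t - (t ^ i / fact i) *\<^sub>R c)"
  have S: "open S" by (rule smooth_on_open[OF assms(1)])
  have w: "smooth_on S w" unfolding w_def by (intro smooth_on_diff assms smooth_on_monomial S)
  have "nth_vderiv j w 0 = 0" if "j \<le> i" for j
  proof -
    have "nth_vderiv j w 0 = nth_vderiv j u 0 - (0 ^ (i - j) / fact (i - j)) *\<^sub>R c"
      unfolding w_def nth_vderiv_diff[OF assms(1) smooth_on_monomial[OF S] assms(2)] nth_vderiv_monomial
      using that by simp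
    then show ?thesis using less that by (cases "j = i") (auto simp: c_def power_0_left)
  qed
  then have fw: "flat_at_0 i w" by (rule flat_at_0_derivs[OF w assms(2)])
  have "norm c \<le> e" if "e > 0" for e
  proof -
    \<comment> \<open>Two errors of size e' * t ^ i have to add up to e * t ^ i / fact i.\<close>
    define e' where "e' = e / (2 * fact i)"
    have e': "e' > 0" using that by (simp add: e'_def)
    obtain d1 where d1: "d1 > 0" "\<And>t. \<bar>t\<bar> < d1 \<Longrightarrow> norm (u t) \<le> e' * \<bar>t\<bar> ^ k"
      using assms(3) e' unfolding flat_at_0_def by blast
    obtain d2 where d2: "d2 > 0" "\<And>t. \<bar>t\<bar> < d2 \<Longrightarrow> norm (w t) \<le> e' * \<bar>t\<bar> ^ i"
      using fw e' unfolding flat_at_0_def by blast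
    \<comment> \<open>Small enough for both estimates; t \<le> 1 gives t ^ k \<le> t ^ i.\<close>
    define t where "t = min (min d1 d2) 1 / 2"
    have t: "0 < t" "t < d1" "t < d2" "t \<le> 1" using d1 d2 by (auto simp: t_def)
    have "(t ^ i / fact i) *\<^sub>R c = u t - w t" by (simp add: w_def)
    then have "(t ^ i / fact i) * norm c = norm (u t - w t)" using t by (metis abs_of_pos divide_pos_pos fact_gt_zero norm_scaleR zero_less_power)
    also have "\<dots> \<le> norm (u t) + norm (w t)" by (rule norm_triangle_ineq4)
    also have "\<dots> \<le> e' * t ^ i + e' * t ^ i"
    proof (rule add_mono)
      have "norm (u t) \<le> e' * t ^ k" using d1(2)[of t] t by simp
      also have "\<dots> \<le> e' * t ^ i" using e' t less.prems by (intro mult_left_mono power_decreasing) auto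
      finally show "norm (u t) \<le> e' * t ^ i" .
    qed (use d2(2)[of t] t in simp)
    also have "\<dots> = (t ^ i / fact i) * e" by (simp add: e'_def)
    finally have "(t ^ i / fact i) * norm c \<le> (t ^ i / fact i) * e" .
    moreover have "0 < t ^ i / fact i" using t by simp
    ultimately show ?thesis by (simp only: mult_le_cancel_left_pos)
  qed
  then have "norm c \<le> 0" by (rule field_le_epsilon) auto
  then show ?case by (simp add: c_def)
qed

text \<open>Having equal derivatives up to order \<open>k\<close> means that the difference is \<open>o(t\<^sup>k)\<close>, a
  property that is preserved by locally Lipschitz maps.\<close>

lemma nth_vderiv_compose_cong:
  assumes "smooth_on S f" "smooth_on S g" "0 \<in> S" "smooth_on T h" "f 0 \<in> T"
    and "\<And>i. i \<le> k \<Longrightarrow> nth_vderiv i f 0 = nth_vderiv i g 0" and "i \<le> k"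
  shows "nth_vderiv i (\<lambda>t. h (f t)) 0 = nth_vderiv i (\<lambda>t. h (g t)) 0"
proof -
  have fg0: "g 0 = f 0" using assms(6)[of 0] by simp
  obtain r L where r: "r > 0" "ball (f 0) r \<subseteq> T"
    "\<And>y z. y \<in> ball (f 0) r \<Longrightarrow> z \<in> ball (f 0) r \<Longrightarrow> norm (h y - h z) \<le> L * norm (y - z)"
    using smooth_on_locally_lipschitz[OF assms(4,5)] by blast
  \<comment> \<open>The times at which both curves lie in the ball on which h is Lipschitz.\<close>
  define R where "R = (S \<inter> f -` ball (f 0) r) \<inter> (S \<inter> g -` ball (f 0) r)"
  have R: "open R" "0 \<in> R"
    using smooth_on_open_vimage[OF assms(1) open_ball] smooth_on_open_vimage[OF assms(2) open_ball] r(1) assms(3) fg0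
    by (auto simp: R_def)
  have fR: "smooth_on R f" "smooth_on R g"
    using assms(1,2) R by (auto simp: R_def intro: smooth_on_subset)
  have hR: "smooth_on R (\<lambda>t. h (f t))" "smooth_on R (\<lambda>t. h (g t))"
    using r(2) fR by (auto intro!: smooth_on_compose[OF _ assms(4)] simp: R_def)
  have flat: "flat_at_0 k (\<lambda>t. f t - g t)"
    by (rule flat_at_0_derivs[OF smooth_on_diff[OF fR] R(2)])
      (simp add: nth_vderiv_diff[OF fR R(2)] assms(6))
  obtain d0 where d0: "d0 > 0" "ball 0 d0 \<subseteq> R" using openE[OF R] .
  have "flat_at_0 k (\<lambda>t. h (f t) - h (g t))"
    unfolding flat_at_0_def
  proof (intro allI impI)
    fix e :: real assume e: "e > 0"
    have L: "\<bar>L\<bar> + 1 > 0" by simp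
    then obtain d where d: "d > 0" "\<And>t. \<bar>t\<bar> < d \<Longrightarrow> norm (f t - g t) \<le> e / (\<bar>L\<bar> + 1) * \<bar>t\<bar> ^ k"
      using flat e unfolding flat_at_0_def by (metis divide_pos_pos)
    have "norm (h (f t) - h (g t)) \<le> e * \<bar>t\<bar> ^ k" if t: "\<bar>t\<bar> < min d d0" for t
    proof -
      have "t \<in> R" using d0 t by (auto simp: subset_eq)
      then have "norm (h (f t) - h (g t)) \<le> L * norm (f t - g t)" by (intro r(3)) (auto simp: R_def)
      also have "\<dots> \<le> (\<bar>L\<bar> + 1) * norm (f t - g t)" by (intro mult_right_mono) auto
      also have "\<dots> \<le> (\<bar>L\<bar> + 1) * (e / (\<bar>L\<bar> + 1) * \<bar>t\<bar> ^ k)" using d(2) t by (intro mult_left_mono) auto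
      also have "\<dots> = e * \<bar>t\<bar> ^ k" using L by simp
      finally show ?thesis .
    qed
    then show "\<exists>d>0. \<forall>t. \<bar>t\<bar> < d \<longrightarrow> norm (h (f t) - h (g t)) \<le> e * \<bar>t\<bar> ^ k"
      using d d0 by (intro exI[of _ "min d d0"]) auto
  qed
  then have "nth_vderiv i (\<lambda>t. h (f t) - h (g t)) 0 = 0"
    by (rule derivs_flat_at_0[OF smooth_on_diff[OF hR] R(2) _ assms(7)])
  then show ?thesis by (simp add: nth_vderiv_diff[OF hR R(2)])
qed

section \<open>Charts and smooth maps\<close>

lemma chartsD:
  assumes "(U, \<phi>) \<in> charts A"
  shows "U \<subseteq> carrier A" "inj_on \<phi> U" "open (\<phi> ` U)"
  using assms by (auto simp: charts_def)

lemma atlas_chart_at: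
  assumes "smooth_atlas A" "x \<in> carrier A"
  obtains U \<phi> where "(U, \<phi>) \<in> charts A" "(U, \<phi>) \<in> A" "x \<in> U"
  using assms unfolding carrier_def smooth_atlas_def by fastforce

lemma charts_compatible_atlas:
  assumes "(U, \<phi>) \<in> charts A" "(V, \<psi>) \<in> A"
  shows "smooth_on (\<phi> ` (U \<inter> V)) (\<psi> \<circ> inv_into U \<phi>)" "smooth_on (\<psi> ` (U \<inter> V)) (\<phi> \<circ> inv_into V \<psi>)"
  using assms by (auto simp: charts_def compatible_def)

text \<open>By definition members of \<open>charts A\<close> are compatible with A only. Near each
  point the transition factors through a chart of A, and both factors are smooth.\<close>

lemma smooth_transition:
  assumes "smooth_atlas A" "(U, \<phi>) \<in> charts A" "(V, \<psi>) \<in> charts A"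
  shows "smooth_on (\<phi> ` (U \<inter> V)) (\<psi> \<circ> inv_into U \<phi>)"
proof (rule smooth_on_local)
  note U = chartsD[OF assms(2)] and V = chartsD[OF assms(3)]
  fix p assume "p \<in> \<phi> ` (U \<inter> V)"
  then obtain x where x: "x \<in> U" "x \<in> V" "p = \<phi> x" by blast
  then obtain W \<kappa> where W: "(W, \<kappa>) \<in> charts A" "(W, \<kappa>) \<in> A" "x \<in> W"
    using atlas_chart_at[OF assms(1)] U(1) by blast
  define f where "f = \<kappa> \<circ> inv_into U \<phi>"
  \<comment> \<open>The triple intersection in the coordinates of U, as \<open>TV\<close> shows.
    Written with a preimage it is a domain of the form that \<open>smooth_on_compose_vimage\<close>
    produces.\<close>
  define T where "T = \<phi> ` (U \<inter> W) \<inter> f -` (\<kappa> ` (V \<inter> W))"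
  have f: "f (\<phi> y) = \<kappa> y" if "y \<in> U" for y using that U(2) by (simp add: f_def)
  have "smooth_on T (\<lambda>q. (\<psi> \<circ> inv_into W \<kappa>) (f q))"
    unfolding T_def f_def
    by (intro smooth_on_compose_vimage charts_compatible_atlas[OF assms(2) W(2)]
        charts_compatible_atlas[OF assms(3) W(2)])
  moreover have TV: "\<exists>y\<in>U \<inter> V \<inter> W. q = \<phi> y" if q: "q \<in> T" for q
  proof -
    obtain y where y: "y \<in> U" "y \<in> W" "q = \<phi> y" using q by (auto simp: T_def)
    then obtain z where z: "z \<in> V" "z \<in> W" "\<kappa> y = \<kappa> z" using q f by (auto simp: T_def)
    then have "y = z" using chartsD(2)[OF W(1)] y by (meson inj_onD)
    then show ?thesis using y z by blast
  qed
  have "(\<psi> \<circ> inv_into W \<kappa>) (f q) = (\<psi> \<circ> inv_into U \<phi>) q" if q: "q \<in> T" for q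
    using TV[OF q] U(2) chartsD(2)[OF W(1)] by (auto simp: f)
  ultimately have "smooth_on T (\<psi> \<circ> inv_into U \<phi>)" by (auto intro: smooth_on_cong)
  moreover have "p \<in> T" "T \<subseteq> \<phi> ` (U \<inter> V)" using x W(3) f TV by (auto simp: T_def)
  ultimately show "\<exists>T. p \<in> T \<and> T \<subseteq> \<phi> ` (U \<inter> V) \<and> smooth_on T (\<psi> \<circ> inv_into U \<phi>)" by blast
qed

lemma restrict_chart:
  assumes "smooth_atlas A" "(U, \<phi>) \<in> charts A" "U' \<subseteq> U" "open (\<phi> ` U')"
  shows "(U', \<phi>) \<in> charts A"
proof -
  note U = chartsD[OF assms(2)]
  have "compatible (U', \<phi>) (V, \<psi>)" if V: "(V, \<psi>) \<in> A" for V \<psi>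
  proof -
    note c = charts_compatible_atlas[OF assms(2) V]
    have inj: "inj_on \<psi> V" using V assms(1) chartsD(2) unfolding smooth_atlas_def by blast
    have 1: "\<phi> ` (U' \<inter> V) = \<phi> ` (U \<inter> V) \<inter> \<phi> ` U'"
      using assms(3) inj_onD[OF U(2)] by blast
    have "smooth_on (\<phi> ` (U' \<inter> V)) (\<psi> \<circ> inv_into U \<phi>)"
      using assms(4) smooth_on_open[OF c(1)] by (intro smooth_on_subset[OF c(1)]) (auto simp: 1)
    then have "smooth_on (\<phi> ` (U' \<inter> V)) (\<psi> \<circ> inv_into U' \<phi>)"
    proof (rule smooth_on_cong)
      fix q assume "q \<in> \<phi> ` (U' \<inter> V)"
      then obtain y where "y \<in> U'" "q = \<phi> y" by blast
      then show "(\<psi> \<circ> inv_into U \<phi>) q = (\<psi> \<circ> inv_into U' \<phi>) q"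
        using assms(3) U(2) inj_on_subset[OF U(2) assms(3)] by (auto simp: inv_into_f_f subset_eq)
    qed
    moreover have 2: "\<psi> ` (U' \<inter> V) = \<psi> ` (U \<inter> V) \<inter> (\<phi> \<circ> inv_into V \<psi>) -` (\<phi> ` U')"
      using assms(3) inj_onD[OF U(2)] inj by (auto simp: subset_eq inj_on_eq_iff) blast+
    have "smooth_on (\<psi> ` (U' \<inter> V)) (\<phi> \<circ> inv_into V \<psi>)"
      using smooth_on_open_vimage[OF c(2) assms(4)] by (intro smooth_on_subset[OF c(2)]) (auto simp: 2)
    with calculation show ?thesis by (simp add: compatible_def)
  qed
  then show ?thesis using U(1) inj_on_subset[OF U(2) assms(3)] assms(3,4) by (auto simp: charts_def)
qed

section \<open>Smooth maps\<close>

lemma smooth_mapE: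
  assumes "smooth_map A B g" "x \<in> carrier A"
  obtains U \<phi> V \<psi> where "(U, \<phi>) \<in> charts A" "(V, \<psi>) \<in> charts B" "x \<in> U" "g ` U \<subseteq> V"
    "smooth_on (\<phi> ` U) (\<psi> \<circ> g \<circ> inv_into U \<phi>)"
proof -
  have "\<exists>(U, \<phi>)\<in>charts A. \<exists>(V, \<psi>)\<in>charts B.
      x \<in> U \<and> g ` U \<subseteq> V \<and> smooth_on (\<phi> ` U) (\<psi> \<circ> g \<circ> inv_into U \<phi>)"
    using assms by (simp add: smooth_map_def)
  then show ?thesis using that by (elim bexE case_prodE conjE) metis
qed

text \<open>The definition supplies one good pair of charts at each point; any other pair differs
  from it by transition maps on both sides. Openness of the domain, that is, continuity of g, is
  part of the conclusion.\<close>

lemma smooth_map_local_rep: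
  assumes "smooth_atlas A" "smooth_atlas B" "smooth_map A B g" "(U, \<phi>) \<in> charts A" "(V, \<psi>) \<in> charts B"
  shows "smooth_on (\<phi> ` (U \<inter> g -` V)) (\<psi> \<circ> g \<circ> inv_into U \<phi>)"
proof (rule smooth_on_local)
  note U = chartsD[OF assms(4)] and V = chartsD[OF assms(5)]
  fix p assume "p \<in> \<phi> ` (U \<inter> g -` V)"
  then obtain x where x: "x \<in> U" "g x \<in> V" "p = \<phi> x" by blast
  then obtain U1 \<phi>1 V1 \<psi>1 where c1: "(U1, \<phi>1) \<in> charts A" "(V1, \<psi>1) \<in> charts B" "x \<in> U1" "g ` U1 \<subseteq> V1"
    and sm: "smooth_on (\<phi>1 ` U1) (\<psi>1 \<circ> g \<circ> inv_into U1 \<phi>1)"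
    using smooth_mapE[OF assms(3)] U(1) by blast
  note U1 = chartsD[OF c1(1)] and V1 = chartsD[OF c1(2)]
  define f where "f = \<phi>1 \<circ> inv_into U \<phi>"
  define h where "h = \<psi>1 \<circ> g \<circ> inv_into U1 \<phi>1"
  define R where "R = \<phi>1 ` U1 \<inter> h -` (\<psi>1 ` (V1 \<inter> V))"
  define T where "T = \<phi> ` (U \<inter> U1) \<inter> f -` R"
  have f: "f (\<phi> y) = \<phi>1 y" if "y \<in> U" for y using that U(2) by (simp add: f_def)
  have h: "h (\<phi>1 y) = \<psi>1 (g y)" if "y \<in> U1" for y using that U1(2) by (simp add: h_def)
  have "smooth_on R (\<lambda>q. (\<psi> \<circ> inv_into V1 \<psi>1) (h q))"
    unfolding R_def h_def
    by (intro smooth_on_compose_vimage sm smooth_transition[OF assms(2) c1(2) assms(5)])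
  then have "smooth_on T (\<lambda>q. (\<psi> \<circ> inv_into V1 \<psi>1) (h (f q)))"
    unfolding T_def f_def by (intro smooth_on_compose_vimage smooth_transition[OF assms(1,4) c1(1)])
  moreover have TV: "\<exists>y\<in>U \<inter> U1. g y \<in> V \<and> q = \<phi> y" if q: "q \<in> T" for q
  proof -
    obtain y where y: "y \<in> U" "y \<in> U1" "q = \<phi> y" using q by (auto simp: T_def)
    then obtain z where z: "z \<in> V1" "z \<in> V" "\<psi>1 (g y) = \<psi>1 z" using q f h by (auto simp: T_def R_def)
    then have "g y = z" using V1(2) y c1(4) by (meson image_subset_iff inj_onD)
    then show ?thesis using y z by blast
  qed
  have "(\<psi> \<circ> inv_into V1 \<psi>1) (h (f q)) = (\<psi> \<circ> g \<circ> inv_into U \<phi>) q" if q: "q \<in> T" for q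
  proof -
    obtain y where y: "y \<in> U" "y \<in> U1" "q = \<phi> y" using TV[OF q] by blast
    then have "g y \<in> V1" using c1(4) by blast
    then show ?thesis using y U(2) V1(2) by (simp add: f h)
  qed
  ultimately have "smooth_on T (\<psi> \<circ> g \<circ> inv_into U \<phi>)" by (auto intro: smooth_on_cong)
  moreover have "p \<in> T"
    using x c1 f h unfolding T_def R_def by auto
  moreover have "T \<subseteq> \<phi> ` (U \<inter> g -` V)" using TV by blast
  ultimately show "\<exists>T. p \<in> T \<and> T \<subseteq> \<phi> ` (U \<inter> g -` V) \<and> smooth_on T (\<psi> \<circ> g \<circ> inv_into U \<phi>)" by blast
qed

lemma smooth_map_carrier: "smooth_map A B g \<Longrightarrow> x \<in> carrier A \<Longrightarrow> g x \<in> carrier B"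
  by (auto simp: smooth_map_def)

text \<open>Spares the user the search for adapted charts: shrinking U to the points over S gives a
  chart whose domain g maps into V.\<close>

lemma smooth_mapI:
  assumes "smooth_atlas A" "g \<in> carrier A \<rightarrow> carrier B"
    and "\<And>x. x \<in> carrier A \<Longrightarrow> \<exists>U \<phi> V \<psi> S. (U, \<phi>) \<in> charts A \<and> (V, \<psi>) \<in> charts B \<and> x \<in> U \<and>
      \<phi> x \<in> S \<and> S \<subseteq> \<phi> ` (U \<inter> g -` V) \<and> smooth_on S (\<psi> \<circ> g \<circ> inv_into U \<phi>)"
  shows "smooth_map A B g"
  unfolding smooth_map_def
proof (intro conjI assms(2) ballI)
  fix x assume "x \<in> carrier A"
  from assms(3)[OF this] obtain U \<phi> V \<psi> S where c: "(U, \<phi>) \<in> charts A" "(V, \<psi>) \<in> charts B" "x \<in> U"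
      "\<phi> x \<in> S" "S \<subseteq> \<phi> ` (U \<inter> g -` V)" "smooth_on S (\<psi> \<circ> g \<circ> inv_into U \<phi>)" by blast
  note U = chartsD[OF c(1)]
  define U' where "U' = U \<inter> \<phi> -` S"
  have im: "\<phi> ` U' = S" using c(5) by (auto simp: U'_def)
  have "(U', \<phi>) \<in> charts A"
    by (rule restrict_chart[OF assms(1) c(1)]) (use smooth_on_open[OF c(6)] in \<open>auto simp: im, auto simp: U'_def\<close>)
  moreover have "smooth_on (\<phi> ` U') (\<psi> \<circ> g \<circ> inv_into U' \<phi>)"
    unfolding im
  proof (rule smooth_on_cong[OF c(6)])
    fix q assume "q \<in> S"
    then obtain y where "y \<in> U'" "q = \<phi> y" using im by blast
    moreover have "inj_on \<phi> U'" "y \<in> U" using U(2) \<open>y \<in> U'\<close> by (auto simp: U'_def inj_on_def)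
    ultimately show "(\<psi> \<circ> g \<circ> inv_into U \<phi>) q = (\<psi> \<circ> g \<circ> inv_into U' \<phi>) q" using U(2) by simp
  qed
  moreover have "g ` U' \<subseteq> V" using c(5) inj_onD[OF U(2)] by (force simp: U'_def)
  moreover have "x \<in> U'" using c by (simp add: U'_def)
  ultimately show "\<exists>(U, \<phi>)\<in>charts A. \<exists>(V, \<psi>)\<in>charts B. x \<in> U \<and> g ` U \<subseteq> V \<and>
      smooth_on (\<phi> ` U) (\<psi> \<circ> g \<circ> inv_into U \<phi>)"
    using c(2) by blast
qed

lemma smooth_map_compose:
  assumes "smooth_atlas A" "smooth_atlas B" "smooth_atlas C" "smooth_map A B g" "smooth_map B C h"
  shows "smooth_map A C (h \<circ> g)"
proof (rule smooth_mapI[OF assms(1)])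
  show "h \<circ> g \<in> carrier A \<rightarrow> carrier C" using assms(4,5) by (auto simp: smooth_map_def)
  fix x assume x: "x \<in> carrier A"
  obtain U \<phi> where U: "(U, \<phi>) \<in> charts A" "x \<in> U" using atlas_chart_at[OF assms(1) x] by blast
  obtain V \<psi> where V: "(V, \<psi>) \<in> charts B" "g x \<in> V"
    using atlas_chart_at[OF assms(2) smooth_map_carrier[OF assms(4) x]] by blast
  obtain W \<kappa> where W: "(W, \<kappa>) \<in> charts C" "h (g x) \<in> W"
    using atlas_chart_at[OF assms(3) smooth_map_carrier[OF assms(5) smooth_map_carrier[OF assms(4) x]]] by blast
  define f where "f = \<psi> \<circ> g \<circ> inv_into U \<phi>"
  define S where "S = \<phi> ` (U \<inter> g -` V) \<inter> f -` (\<psi> ` (V \<inter> h -` W))"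
  note injs = chartsD(2)[OF U(1)] chartsD(2)[OF V(1)]
  have f: "f (\<phi> y) = \<psi> (g y)" if "y \<in> U" for y using that injs by (simp add: f_def)
  have SV: "\<exists>y\<in>U. g y \<in> V \<and> h (g y) \<in> W \<and> q = \<phi> y" if q: "q \<in> S" for q
  proof -
    obtain y where y: "y \<in> U" "g y \<in> V" "q = \<phi> y" using q by (auto simp: S_def)
    then obtain z where "z \<in> V" "h z \<in> W" "\<psi> (g y) = \<psi> z" using q f by (auto simp: S_def)
    then show ?thesis using y injs(2) by (metis inj_onD)
  qed
  have "smooth_on S (\<lambda>q. (\<kappa> \<circ> h \<circ> inv_into V \<psi>) (f q))"
    unfolding S_def f_def
    by (intro smooth_on_compose_vimage smooth_map_local_rep[OF assms(1,2,4) U(1) V(1)]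
        smooth_map_local_rep[OF assms(2,3,5) V(1) W(1)])
  then have "smooth_on S (\<kappa> \<circ> (h \<circ> g) \<circ> inv_into U \<phi>)"
    by (rule smooth_on_cong) (use SV injs f in fastforce)
  moreover have "\<phi> x \<in> S" using U V W f by (auto simp: S_def)
  moreover have "S \<subseteq> \<phi> ` (U \<inter> (h \<circ> g) -` W)" using SV by fastforce
  ultimately show "\<exists>U \<phi> V \<psi> S. (U, \<phi>) \<in> charts A \<and> (V, \<psi>) \<in> charts C \<and> x \<in> U \<and>
      \<phi> x \<in> S \<and> S \<subseteq> \<phi> ` (U \<inter> (h \<circ> g) -` V) \<and> smooth_on S (\<psi> \<circ> (h \<circ> g) \<circ> inv_into U \<phi>)"
    using U W by blast
qed

section \<open>Intervals and curves\<close>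

lemma inv_into_ident: "t \<in> S \<Longrightarrow> inv_into S (\<lambda>t. t) t = t"
  by (simp add: inv_into_f_f)

lemma interval_chart:
  "({-\<epsilon><..<\<epsilon>}, \<lambda>t::real. t) \<in> charts {({-\<epsilon><..<\<epsilon>}, \<lambda>t::real. t)}"
proof -
  have "smooth_on {-\<epsilon><..<\<epsilon>} ((\<lambda>t. t) \<circ> inv_into {-\<epsilon><..<\<epsilon>} (\<lambda>t::real. t))"
    by (rule smooth_on_cong[OF smooth_on_ident]) (simp_all add: inv_into_ident)
  then show ?thesis by (simp add: charts_def compatible_def carrier_def)
qed

lemma interval_smooth_atlas: "smooth_atlas {({-\<epsilon><..<\<epsilon>}, \<lambda>t::real. t)}"
  using interval_chart by (simp add: smooth_atlas_def)

lemma smooth_curve_in_chart: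
  assumes "smooth_atlas A" "smooth_curve A \<gamma>" "(U, \<phi>) \<in> charts A" "\<gamma> 0 \<in> U"
  obtains S where "0 \<in> S" "smooth_on S (\<phi> \<circ> \<gamma>)" "\<gamma> ` S \<subseteq> U"
proof -
  obtain \<epsilon> where e: "\<epsilon> > 0" "smooth_map {({-\<epsilon><..<\<epsilon>}, \<lambda>t::real. t)} A \<gamma>"
    using assms(2) unfolding smooth_curve_def by blast
  define S where "S = {-\<epsilon><..<\<epsilon>} \<inter> \<gamma> -` U"
  have "smooth_on S (\<phi> \<circ> \<gamma> \<circ> inv_into {-\<epsilon><..<\<epsilon>} (\<lambda>t. t))"
    using smooth_map_local_rep[OF interval_smooth_atlas assms(1) e(2) interval_chart assms(3)]
    by (simp add: S_def)
  then have "smooth_on S (\<phi> \<circ> \<gamma>)"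
    by (rule smooth_on_cong) (auto simp: S_def inv_into_ident)
  then show ?thesis using that[of S] e(1) assms(4) by (auto simp: S_def)
qed

lemma smooth_curveI:
  assumes "(U, \<phi>) \<in> charts A" "smooth_on S f" "0 \<in> S" "f ` S \<subseteq> \<phi> ` U"
  shows "smooth_curve A (inv_into U \<phi> \<circ> f)"
proof -
  obtain \<epsilon> where e: "\<epsilon> > 0" "ball 0 \<epsilon> \<subseteq> S" using openE[OF smooth_on_open[OF assms(2)] assms(3)] .
  define I where "I = {-\<epsilon><..<\<epsilon>}"
  have I: "I \<subseteq> S" using e by (auto simp: I_def subset_eq)
  have inv: "inv_into U \<phi> (f t) \<in> U" "\<phi> (inv_into U \<phi> (f t)) = f t" if "t \<in> I" for t
    using that I assms(4) by (auto simp: image_subset_iff subset_eq inv_into_into f_inv_into_f)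
  have "smooth_map {(I, \<lambda>t. t)} A (inv_into U \<phi> \<circ> f)"
    unfolding smooth_map_def
  proof (intro conjI ballI)
    show "inv_into U \<phi> \<circ> f \<in> carrier {(I, \<lambda>t. t)} \<rightarrow> carrier A"
      using inv(1) chartsD(1)[OF assms(1)] by (auto simp: carrier_def)
    fix t assume "t \<in> carrier {(I, \<lambda>t. t)}"
    then have t: "t \<in> I" by (simp add: carrier_def)
    have "smooth_on I f" using smooth_on_subset[OF assms(2) _ I] by (simp add: I_def)
    then have sm: "smooth_on I (\<phi> \<circ> (inv_into U \<phi> \<circ> f) \<circ> inv_into I (\<lambda>t. t))"
      by (rule smooth_on_cong) (simp add: inv_into_ident inv)
    have "(I, \<lambda>t. t) \<in> charts {(I, \<lambda>t. t)}" unfolding I_def by (rule interval_chart)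
    then show "\<exists>(J, \<iota>)\<in>charts {(I, \<lambda>t. t)}. \<exists>(V, \<psi>)\<in>charts A. t \<in> J \<and> (inv_into U \<phi> \<circ> f) ` J \<subseteq> V \<and>
       smooth_on (\<iota> ` J) (\<psi> \<circ> (inv_into U \<phi> \<circ> f) \<circ> inv_into J \<iota>)"      by (rule rev_bexI, intro case_prodI rev_bexI[OF assms(1)]) (use t inv(1) sm in auto)
  qed
  then show ?thesis unfolding smooth_curve_def I_def using e(1) by blast
qed

lemma smooth_curve_compose:
  assumes "smooth_atlas A" "smooth_atlas B" "smooth_map A B g" "smooth_curve A \<gamma>"
  shows "smooth_curve B (g \<circ> \<gamma>)"
  using assms smooth_map_compose[OF interval_smooth_atlas assms(1,2)] unfolding smooth_curve_def by blast

lemma smooth_curve_carrier: "smooth_curve A \<gamma> \<Longrightarrow> \<gamma> 0 \<in> carrier A"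
  unfolding smooth_curve_def smooth_map_def by (auto simp: carrier_def)

section \<open>Jets\<close>

lemma k_equivalent_alt: "k_equivalent A k \<gamma> \<delta> \<longleftrightarrow> \<gamma> 0 = \<delta> 0 \<and>
    (\<exists>U \<phi>. (U, \<phi>) \<in> charts A \<and> \<gamma> 0 \<in> U \<and>
      (\<forall>i\<in>{1..k}. nth_vderiv i (\<phi> \<circ> \<gamma>) 0 = nth_vderiv i (\<phi> \<circ> \<delta>) 0))"
  unfolding k_equivalent_def Bex_def split_paired_Ex prod.case ..

lemma k_equivalent_sym: "k_equivalent A k \<gamma> \<delta> \<Longrightarrow> k_equivalent A k \<delta> \<gamma>"
  unfolding k_equivalent_alt by (elim conjE exE) (intro conjI exI, auto)

lemma k_equivalent_mono: "k_equivalent A j \<gamma> \<delta> \<Longrightarrow> i \<le> j \<Longrightarrow> k_equivalent A i \<gamma> \<delta>"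
  unfolding k_equivalent_alt by (elim conjE exE) (intro conjI exI, auto)

text \<open>Serves twice: with a second chart as F it gives independence of the chart, with a chart
  of the target composed with g it gives the invariance needed for T^k g. Near 0 both curves stay in
  V, so F matters on V only.\<close>

lemma nth_vderiv_chart_cong:
  assumes "smooth_atlas A" "smooth_curve A \<gamma>" "smooth_curve A \<delta>" "(V, \<psi>) \<in> charts A" "\<gamma> 0 \<in> V" "\<delta> 0 = \<gamma> 0"
    and "\<And>i. i \<le> k \<Longrightarrow> nth_vderiv i (\<psi> \<circ> \<gamma>) 0 = nth_vderiv i (\<psi> \<circ> \<delta>) 0"
    and "smooth_on T h" "\<psi> (\<gamma> 0) \<in> T" "\<And>x. x \<in> V \<Longrightarrow> F x = h (\<psi> x)" "i \<le> k"
  shows "nth_vderiv i (F \<circ> \<gamma>) 0 = nth_vderiv i (F \<circ> \<delta>) 0"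
proof -
  obtain S where S: "0 \<in> S" "smooth_on S (\<psi> \<circ> \<gamma>)" "\<gamma> ` S \<subseteq> V"
    using smooth_curve_in_chart[OF assms(1,2,4,5)] by blast
  obtain R where R: "0 \<in> R" "smooth_on R (\<psi> \<circ> \<delta>)" "\<delta> ` R \<subseteq> V"
    using smooth_curve_in_chart[OF assms(1,3,4)] assms(5,6) by metis
  have o: "open S" "open R" "open (S \<inter> R)" using S(2) R(2) smooth_on_open by auto
  have sm: "smooth_on (S \<inter> R) (\<psi> \<circ> \<gamma>)" "smooth_on (S \<inter> R) (\<psi> \<circ> \<delta>)"
    using smooth_on_subset[OF S(2) o(3)] smooth_on_subset[OF R(2) o(3)] by auto
  have "nth_vderiv i (F \<circ> \<gamma>) 0 = nth_vderiv i (\<lambda>t. h ((\<psi> \<circ> \<gamma>) t)) 0"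
    using S assms(10) by (intro nth_vderiv_cong[OF o(1)]) auto
  also have "\<dots> = nth_vderiv i (\<lambda>t. h ((\<psi> \<circ> \<delta>) t)) 0"
    by (rule nth_vderiv_compose_cong[OF sm _ assms(8) _ assms(7,11)]) (use S R assms(9) in auto)
  also have "\<dots> = nth_vderiv i (F \<circ> \<delta>) 0"
    using R assms(10) by (intro nth_vderiv_cong[OF o(2)]) auto
  finally show ?thesis .
qed

text \<open>The definition asks for agreement in one chart at the point, the criterion for agreement
  in a given one; a smooth transition map links the two.\<close>

lemma k_equivalent_iff:
  assumes "smooth_atlas A" "smooth_curve A \<gamma>" "smooth_curve A \<delta>" "(U, \<phi>) \<in> charts A" "\<gamma> 0 \<in> U"
  shows "k_equivalent A k \<gamma> \<delta> \<longleftrightarrow> \<delta> 0 = \<gamma> 0 \<and>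
    (\<forall>i\<le>k. nth_vderiv i (\<phi> \<circ> \<gamma>) 0 = nth_vderiv i (\<phi> \<circ> \<delta>) 0)"
proof
  assume k: "k_equivalent A k \<gamma> \<delta>"
  then obtain V \<psi> where V: "(V, \<psi>) \<in> charts A" "\<gamma> 0 \<in> V"
    and eq: "\<forall>i\<in>{1..k}. nth_vderiv i (\<psi> \<circ> \<gamma>) 0 = nth_vderiv i (\<psi> \<circ> \<delta>) 0" and 0: "\<delta> 0 = \<gamma> 0"
    unfolding k_equivalent_alt by metis
  have eq': "nth_vderiv i (\<psi> \<circ> \<gamma>) 0 = nth_vderiv i (\<psi> \<circ> \<delta>) 0" if "i \<le> k" for i
    using eq that 0 by (cases "i = 0") auto
  have "nth_vderiv i (\<phi> \<circ> \<gamma>) 0 = nth_vderiv i (\<phi> \<circ> \<delta>) 0" if i: "i \<le> k" for i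
  proof -
    have V': "(V \<inter> U, \<psi>) \<in> charts A"
      using smooth_on_open[OF smooth_transition[OF assms(1) V(1) assms(4)]]
      by (intro restrict_chart[OF assms(1) V(1)]) auto
    show ?thesis
      by (rule nth_vderiv_chart_cong[OF assms(1-3) V' _ 0 eq' smooth_transition[OF assms(1) V(1) assms(4)] _ _ i])
        (use V assms(5) chartsD(2)[OF V(1)] in auto)
  qed
  then show "\<delta> 0 = \<gamma> 0 \<and> (\<forall>i\<le>k. nth_vderiv i (\<phi> \<circ> \<gamma>) 0 = nth_vderiv i (\<phi> \<circ> \<delta>) 0)" using 0 by blast
next
  assume "\<delta> 0 = \<gamma> 0 \<and> (\<forall>i\<le>k. nth_vderiv i (\<phi> \<circ> \<gamma>) 0 = nth_vderiv i (\<phi> \<circ> \<delta>) 0)"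
  then show "k_equivalent A k \<gamma> \<delta>"
    unfolding k_equivalent_alt using assms(4,5) by (intro conjI exI[of _ U] exI[of _ \<phi>]) auto
qed

lemma k_equivalent_refl:
  assumes "smooth_atlas A" "smooth_curve A \<gamma>"
  shows "k_equivalent A k \<gamma> \<gamma>"
  using atlas_chart_at[OF assms(1) smooth_curve_carrier[OF assms(2)]] k_equivalent_iff[OF assms assms(2)] by blast

lemma k_equivalent_trans:
  assumes "smooth_atlas A" "smooth_curve A \<gamma>" "smooth_curve A \<delta>" "smooth_curve A \<eta>"
    and "k_equivalent A k \<gamma> \<delta>" "k_equivalent A k \<delta> \<eta>"
  shows "k_equivalent A k \<gamma> \<eta>"
proof -
  obtain U \<phi> where U: "(U, \<phi>) \<in> charts A" "\<gamma> 0 \<in> U"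
    using atlas_chart_at[OF assms(1) smooth_curve_carrier[OF assms(2)]] by blast
  have 1: "\<delta> 0 = \<gamma> 0 \<and> (\<forall>i\<le>k. nth_vderiv i (\<phi> \<circ> \<gamma>) 0 = nth_vderiv i (\<phi> \<circ> \<delta>) 0)"
    using k_equivalent_iff[OF assms(1-3) U] assms(5) by blast
  then have "\<eta> 0 = \<delta> 0 \<and> (\<forall>i\<le>k. nth_vderiv i (\<phi> \<circ> \<delta>) 0 = nth_vderiv i (\<phi> \<circ> \<eta>) 0)"
    using k_equivalent_iff[OF assms(1,3,4) U(1)] U(2) assms(6) by auto
  with 1 show ?thesis using k_equivalent_iff[OF assms(1,2,4) U] by auto
qed

lemma jet_of_self: "smooth_atlas A \<Longrightarrow> smooth_curve A \<gamma> \<Longrightarrow> \<gamma> \<in> jet_of A k \<gamma>"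
  by (simp add: jet_of_def k_equivalent_refl)

lemma jet_of_eq:
  assumes "smooth_atlas A" "smooth_curve A \<gamma>" "smooth_curve A \<delta>" "k_equivalent A k \<gamma> \<delta>"
  shows "jet_of A k \<gamma> = jet_of A k \<delta>"
  using k_equivalent_trans[OF assms(1)] k_equivalent_sym assms(2-4) unfolding jet_of_def by blast

lemma in_jet_of: "\<delta> \<in> jet_of A k \<gamma> \<longleftrightarrow> smooth_curve A \<delta> \<and> k_equivalent A k \<gamma> \<delta>"
  by (simp add: jet_of_def)

lemma TkE:
  assumes "u \<in> Tk k A"
  obtains \<gamma> where "smooth_curve A \<gamma>" "u = jet_of A k \<gamma>"
  using assms unfolding Tk_def by blast

lemma jet_of_in_Tk: "smooth_curve A \<gamma> \<Longrightarrow> jet_of A k \<gamma> \<in> Tk k A"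
  unfolding Tk_def by blast

text \<open>Maps on classes are defined by \<open>the_elem\<close> or by a union. Once an expression
  is constant on the class, both return its value at any representative; the union is treated in
  \<open>Union_jet\<close>.\<close>

lemma the_elem_jet:
  assumes "smooth_atlas A" "smooth_curve A \<gamma>"
    and "\<And>\<delta>. smooth_curve A \<delta> \<Longrightarrow> k_equivalent A k \<gamma> \<delta> \<Longrightarrow> F \<delta> = F \<gamma>"
  shows "the_elem (F ` jet_of A k \<gamma>) = F \<gamma>"
proof -
  have "F ` jet_of A k \<gamma> \<subseteq> {F \<gamma>}" using assms(3) by (auto simp: in_jet_of)
  moreover have "F \<gamma> \<in> F ` jet_of A k \<gamma>" by (rule imageI[OF jet_of_self[OF assms(1,2)]])
  ultimately have "F ` jet_of A k \<gamma> = {F \<gamma>}" by blast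
  then show ?thesis by simp
qed

lemma base_point_jet_of:
  assumes "smooth_atlas A" "smooth_curve A \<gamma>"
  shows "base_point (jet_of A k \<gamma>) = \<gamma> 0"
  unfolding base_point_def by (rule the_elem_jet[OF assms]) (simp add: k_equivalent_def)

lemma Union_jet:
  assumes "smooth_atlas A" "smooth_curve A \<gamma>"
    and "\<And>\<delta>. smooth_curve A \<delta> \<Longrightarrow> k_equivalent A k \<gamma> \<delta> \<Longrightarrow> F \<delta> = F \<gamma>"
  shows "(\<Union>\<delta>\<in>jet_of A k \<gamma>. F \<delta>) = F \<gamma>"
proof -
  have "F \<delta> = F \<gamma>" if "\<delta> \<in> jet_of A k \<gamma>" for \<delta> using that assms(3) by (simp add: in_jet_of)
  then show ?thesis using jet_of_self[OF assms(1,2), of k] by blast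
qed

lemma jet_proj_jet_of:
  assumes "smooth_atlas A" "smooth_curve A \<gamma>" "i \<le> j"
  shows "jet_proj A i (jet_of A j \<gamma>) = jet_of A i \<gamma>"
  unfolding jet_proj_def
  by (rule Union_jet[OF assms(1,2)])
    (rule jet_of_eq[OF assms(1) _ assms(2)], assumption, rule k_equivalent_sym, rule k_equivalent_mono[OF _ assms(3)])

lemma k_equivalent_compose:
  assumes "smooth_atlas A" "smooth_atlas B" "smooth_map A B g" "smooth_curve A \<gamma>" "smooth_curve A \<delta>"
    and "k_equivalent A k \<gamma> \<delta>"
  shows "k_equivalent B k (g \<circ> \<gamma>) (g \<circ> \<delta>)"
proof -
  obtain U \<phi> V \<psi> where U: "(U, \<phi>) \<in> charts A" "\<gamma> 0 \<in> U" and V: "(V, \<psi>) \<in> charts B" and gU: "g ` U \<subseteq> V"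
    and sm: "smooth_on (\<phi> ` U) (\<psi> \<circ> g \<circ> inv_into U \<phi>)"
    using smooth_mapE[OF assms(3) smooth_curve_carrier[OF assms(4)]] by metis
  have eq: "\<delta> 0 = \<gamma> 0" "\<And>i. i \<le> k \<Longrightarrow> nth_vderiv i (\<phi> \<circ> \<gamma>) 0 = nth_vderiv i (\<phi> \<circ> \<delta>) 0"
    using k_equivalent_iff[OF assms(1,4,5) U] assms(6) by auto
  have "nth_vderiv i ((\<psi> \<circ> g) \<circ> \<gamma>) 0 = nth_vderiv i ((\<psi> \<circ> g) \<circ> \<delta>) 0" if "i \<le> k" for i
    by (rule nth_vderiv_chart_cong[OF assms(1,4,5) U eq sm _ _ that])
      (use U chartsD(2)[OF U(1)] in auto)
  then show ?thesis
    unfolding k_equivalent_alt using eq(1) V gU U(2)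
    by (intro conjI exI[of _ V] exI[of _ \<psi>]) (auto simp: o_assoc)
qed

lemma Tk_map_jet_of:
  assumes "smooth_atlas A" "smooth_atlas B" "smooth_map A B g" "smooth_curve A \<gamma>"
  shows "Tk_map k B g (jet_of A k \<gamma>) = jet_of B k (g \<circ> \<gamma>)"
  unfolding Tk_map_def
proof (rule Union_jet[OF assms(1,4)])
  fix \<delta> assume d: "smooth_curve A \<delta>" "k_equivalent A k \<gamma> \<delta>"
  then show "jet_of B k (g \<circ> \<delta>) = jet_of B k (g \<circ> \<gamma>)"
    by (intro jet_of_eq[symmetric] k_equivalent_compose[OF assms] smooth_curve_compose[OF assms(1-3)] assms d)
qed

lemma Tk_map_in_Tk:
  assumes "smooth_atlas A" "smooth_atlas B" "smooth_map A B g" "u \<in> Tk k A"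
  shows "Tk_map k B g u \<in> Tk k B"
  using assms(4) Tk_map_jet_of[OF assms(1-3)] smooth_curve_compose[OF assms(1-3)] jet_of_in_Tk
  by (metis TkE)

lemma k_equivalent_local:
  assumes "smooth_atlas A" "smooth_curve A \<gamma>" "open S" "0 \<in> S" "\<And>t. t \<in> S \<Longrightarrow> \<gamma> t = \<delta> t"
  shows "k_equivalent A k \<gamma> \<delta>"
proof -
  obtain U \<phi> where U: "(U, \<phi>) \<in> charts A" "\<gamma> 0 \<in> U"
    using atlas_chart_at[OF assms(1) smooth_curve_carrier[OF assms(2)]] by blast
  have "nth_vderiv i (\<phi> \<circ> \<gamma>) 0 = nth_vderiv i (\<phi> \<circ> \<delta>) 0" for i
    using assms(5) by (intro nth_vderiv_cong[OF assms(3) _ assms(4)]) simp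
  then show ?thesis
    unfolding k_equivalent_alt using U assms(4,5) by (intro conjI exI[of _ U] exI[of _ \<phi>]) auto
qed

text \<open>A representing curve is controlled near 0 only, so h composed with g and the curve
  equals the curve on an interval, not everywhere; a jet does not see the difference.\<close>

lemma Tk_map_inverse:
  assumes "smooth_atlas A" "smooth_atlas B" "smooth_map A B g" "smooth_map B A h"
    and "\<And>x. x \<in> carrier A \<Longrightarrow> h (g x) = x" "u \<in> Tk k A"
  shows "Tk_map k A h (Tk_map k B g u) = u"
proof -
  obtain \<gamma> where g: "smooth_curve A \<gamma>" "u = jet_of A k \<gamma>" using TkE[OF assms(6)] .
  obtain \<epsilon> where e: "\<epsilon> > 0" "smooth_map {({-\<epsilon><..<\<epsilon>}, \<lambda>t::real. t)} A \<gamma>"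
    using g(1) unfolding smooth_curve_def by blast
  have "\<gamma> t \<in> carrier A" if "t \<in> {-\<epsilon><..<\<epsilon>}" for t
    using smooth_map_carrier[OF e(2)] that by (simp add: carrier_def)
  then have "k_equivalent A k \<gamma> (h \<circ> (g \<circ> \<gamma>))"
    by (intro k_equivalent_local[OF assms(1) g(1), of "{-\<epsilon><..<\<epsilon>}"]) (use e assms(5) in auto)
  then have "jet_of A k (h \<circ> (g \<circ> \<gamma>)) = jet_of A k \<gamma>"
    using g(1) assms by (intro jet_of_eq[symmetric] smooth_curve_compose) auto
  then show ?thesis
    using Tk_map_jet_of[OF assms(1-3) g(1)] Tk_map_jet_of[OF assms(2,1,4) smooth_curve_compose[OF assms(1-3) g(1)]]
    by (simp add: g(2))
qed

text \<open>A polynomial curve in the model space, pulled back by the chart; it remains in the image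
  of the chart for small times.\<close>

lemma curve_with_derivs:
  assumes "smooth_atlas A" "(U, \<phi>) \<in> charts A" "a 0 \<in> \<phi> ` U"
  obtains \<gamma> where "smooth_curve A \<gamma>" "\<gamma> 0 \<in> U" "\<phi> (\<gamma> 0) = a 0" "\<And>i. i \<le> k \<Longrightarrow> nth_vderiv i (\<phi> \<circ> \<gamma>) 0 = a i"
proof -
  let ?f = "poly_curve a k"
  define S where "S = UNIV \<inter> ?f -` (\<phi> ` U)"
  have f0: "?f 0 = a 0" using nth_vderiv_poly_curve[of 0 a k] by simp
  have S: "open S" "0 \<in> S"
    using smooth_on_open_vimage[OF smooth_on_poly_curve[OF open_UNIV] chartsD(3)[OF assms(2)]] assms(3)
    by (auto simp: S_def f0)
  define \<gamma> where "\<gamma> = inv_into U \<phi> \<circ> ?f"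
  have "smooth_curve A \<gamma>"
    unfolding \<gamma>_def by (rule smooth_curveI[OF assms(2) smooth_on_poly_curve[OF S(1)] S(2)]) (auto simp: S_def)
  moreover have \<gamma>: "\<gamma> t \<in> U" "\<phi> (\<gamma> t) = ?f t" if "t \<in> S" for t
    using that by (auto simp: S_def \<gamma>_def inv_into_into f_inv_into_f)
  moreover have "nth_vderiv i (\<phi> \<circ> \<gamma>) 0 = a i" if "i \<le> k" for i
    using nth_vderiv_cong[OF S(1) _ S(2), of "\<phi> \<circ> \<gamma>" ?f i] \<gamma>(2) that
    by (simp add: nth_vderiv_poly_curve)
  ultimately show ?thesis using that[of \<gamma>] S(2) f0 by simp
qed

section \<open>Tangent bundles\<close>

lemma vector_derivative_compose:
  assumes "smooth_on S f" "t \<in> S" "smooth_on T h" "f t \<in> T"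
  shows "vector_derivative (\<lambda>t. h (f t)) (at t) = fderiv h (f t) (vector_derivative f (at t))"
proof -
  have "(f has_derivative (\<lambda>x. x *\<^sub>R vector_derivative f (at t))) (at t)"
    using smooth_on_has_vector_derivative[OF assms(1,2)] by (simp add: has_vector_derivative_def)
  from has_derivative_compose[OF this smooth_on_has_fderiv[OF assms(3,4)]]
  show ?thesis
    by (intro vector_derivative_at) (simp add: has_vector_derivative_def blinfun.scaleR_right)
qed

text \<open>Together with \<open>tcoord\<close> this names the two components of
  \<open>tangent_chart\<close>. The second depends on the coordinate map alone, so it can be kept
  when the domain shrinks.\<close>

definition tdom :: "('m, 'e::banach) atlas \<Rightarrow> 'm set \<Rightarrow> 'm jet set" where
  "tdom A U = {u \<in> Tk 1 A. base_point u \<in> U}"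

definition tcoord :: "('m \<Rightarrow> 'e::banach) \<Rightarrow> 'm jet \<Rightarrow> 'e \<times> 'e" where
  "tcoord \<phi> u = the_elem ((\<lambda>\<gamma>. (\<phi> (\<gamma> 0), nth_vderiv 1 (\<phi> \<circ> \<gamma>) 0)) ` u)"

lemma tangent_chart_eq: "tangent_chart A (U, \<phi>) = (tdom A U, tcoord \<phi>)"
  by (simp add: tangent_chart_def tdom_def tcoord_def[abs_def])

lemma tcoord_jet_of:
  assumes "smooth_atlas A" "smooth_curve A \<gamma>" "(U, \<phi>) \<in> charts A" "\<gamma> 0 \<in> U"
  shows "tcoord \<phi> (jet_of A 1 \<gamma>) = (\<phi> (\<gamma> 0), nth_vderiv 1 (\<phi> \<circ> \<gamma>) 0)"
  unfolding tcoord_def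
  by (rule the_elem_jet[OF assms(1,2)]) (use k_equivalent_iff[OF assms(1,2) _ assms(3,4)] in auto)

lemma tdomE:
  assumes "smooth_atlas A" "u \<in> tdom A U"
  obtains \<gamma> where "smooth_curve A \<gamma>" "\<gamma> 0 \<in> U" "u = jet_of A 1 \<gamma>"
  using assms base_point_jet_of[OF assms(1)] unfolding tdom_def by (auto elim!: TkE)

lemma jet_of_in_tdom:
  assumes "smooth_atlas A" "smooth_curve A \<gamma>" "\<gamma> 0 \<in> U"
  shows "jet_of A 1 \<gamma> \<in> tdom A U"
  using assms by (simp add: tdom_def base_point_jet_of jet_of_in_Tk)

lemma inj_on_tcoord:
  assumes "smooth_atlas A" "(U, \<phi>) \<in> charts A"
  shows "inj_on (tcoord \<phi>) (tdom A U)"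
proof (rule inj_onI)
  fix u v assume uv: "u \<in> tdom A U" "v \<in> tdom A U" "tcoord \<phi> u = tcoord \<phi> v"
  obtain \<gamma> where g: "smooth_curve A \<gamma>" "\<gamma> 0 \<in> U" "u = jet_of A 1 \<gamma>" using tdomE[OF assms(1) uv(1)] .
  obtain \<delta> where d: "smooth_curve A \<delta>" "\<delta> 0 \<in> U" "v = jet_of A 1 \<delta>" using tdomE[OF assms(1) uv(2)] .
  have eq: "\<phi> (\<gamma> 0) = \<phi> (\<delta> 0)" "nth_vderiv 1 (\<phi> \<circ> \<gamma>) 0 = nth_vderiv 1 (\<phi> \<circ> \<delta>) 0"
    using uv(3) tcoord_jet_of[OF assms(1) g(1) assms(2) g(2)] tcoord_jet_of[OF assms(1) d(1) assms(2) d(2)]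
    by (simp_all add: g(3) d(3))
  have "\<delta> 0 = \<gamma> 0" using inj_onD[OF chartsD(2)[OF assms(2)] eq(1)] g d by simp
  moreover have "nth_vderiv i (\<phi> \<circ> \<gamma>) 0 = nth_vderiv i (\<phi> \<circ> \<delta>) 0" if "i \<le> 1" for i
    using that eq by (cases "i = 0") (auto simp: le_Suc_eq)
  ultimately have "k_equivalent A 1 \<gamma> \<delta>" using k_equivalent_iff[OF assms(1) g(1) d(1) assms(2) g(2)] by blast
  then show "u = v" using jet_of_eq[OF assms(1) g(1) d(1)] g(3) d(3) by simp
qed

lemma tangent_vector_with_coords:
  assumes "smooth_atlas A" "(U, \<phi>) \<in> charts A" "x \<in> \<phi> ` U"
  obtains \<gamma> where "smooth_curve A \<gamma>" "\<gamma> 0 \<in> U" "\<phi> (\<gamma> 0) = x" "nth_vderiv 1 (\<phi> \<circ> \<gamma>) 0 = \<xi>"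
    "tcoord \<phi> (jet_of A 1 \<gamma>) = (x, \<xi>)"
proof -
  obtain \<gamma> where g: "smooth_curve A \<gamma>" "\<gamma> 0 \<in> U" "\<phi> (\<gamma> 0) = x"
    "\<And>i. i \<le> 1 \<Longrightarrow> nth_vderiv i (\<phi> \<circ> \<gamma>) 0 = (if i = 0 then x else \<xi>)"
    using curve_with_derivs[OF assms(1,2), of "\<lambda>i. if i = 0 then x else \<xi>" 1] assms(3) by auto
  then show ?thesis
    using that[of \<gamma>] tcoord_jet_of[OF assms(1) g(1) assms(2) g(2)] g(4)[of 1] by simp
qed

lemma tcoord_image:
  assumes "smooth_atlas A" "(U, \<phi>) \<in> charts A"
  shows "tcoord \<phi> ` tdom A U = \<phi> ` U \<times> UNIV"
proof (intro subset_antisym subsetI)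
  fix p assume "p \<in> tcoord \<phi> ` tdom A U"
  then obtain u where u: "u \<in> tdom A U" "p = tcoord \<phi> u" by blast
  obtain \<gamma> where g: "smooth_curve A \<gamma>" "\<gamma> 0 \<in> U" "u = jet_of A 1 \<gamma>" using tdomE[OF assms(1) u(1)] .
  show "p \<in> \<phi> ` U \<times> UNIV"
    using tcoord_jet_of[OF assms(1) g(1) assms(2) g(2)] g(2,3) u(2) by simp
next
  fix p assume "p \<in> \<phi> ` U \<times> (UNIV :: 'b set)"
  then obtain x \<xi> where p: "p = (x, \<xi>)" "x \<in> \<phi> ` U" by auto
  obtain \<gamma> where "smooth_curve A \<gamma>" "\<gamma> 0 \<in> U" "tcoord \<phi> (jet_of A 1 \<gamma>) = (x, \<xi>)"
    using tangent_vector_with_coords[OF assms p(2)] by blast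
  then show "p \<in> tcoord \<phi> ` tdom A U"
    using jet_of_in_tdom[OF assms(1)] p(1) by (intro image_eqI[of _ _ "jet_of A 1 \<gamma>"]) auto
qed

text \<open>Tg acts on a representing curve by composition, so the chain rule applies the
  differential of the local representative to its velocity.\<close>

lemma tcoord_Tk_map:
  assumes "smooth_atlas A" "smooth_atlas B" "smooth_map A B g" "(U, \<phi>) \<in> charts A" "(V, \<psi>) \<in> charts B"
    and "u \<in> tdom A (U \<inter> g -` V)" "tcoord \<phi> u = (x, \<xi>)"
  shows "Tk_map 1 B g u \<in> tdom B V"
    and "tcoord \<psi> (Tk_map 1 B g u) = ((\<psi> \<circ> g \<circ> inv_into U \<phi>) x, fderiv (\<psi> \<circ> g \<circ> inv_into U \<phi>) x \<xi>)"
    and "x \<in> \<phi> ` (U \<inter> g -` V)"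
proof -
  obtain \<gamma> where g: "smooth_curve A \<gamma>" "\<gamma> 0 \<in> U" "g (\<gamma> 0) \<in> V" "u = jet_of A 1 \<gamma>"
    using tdomE[OF assms(1,6)] by auto
  have gc: "smooth_curve B (g \<circ> \<gamma>)" "(g \<circ> \<gamma>) 0 \<in> V"
    using smooth_curve_compose[OF assms(1-3) g(1)] g(3) by auto
  have x: "x = \<phi> (\<gamma> 0)" "\<xi> = nth_vderiv 1 (\<phi> \<circ> \<gamma>) 0"
    using assms(7) tcoord_jet_of[OF assms(1) g(1) assms(4) g(2)] by (simp_all add: g(4))
  then show "x \<in> \<phi> ` (U \<inter> g -` V)" using g by blast
  have Tu: "Tk_map 1 B g u = jet_of B 1 (g \<circ> \<gamma>)" using Tk_map_jet_of[OF assms(1-3) g(1)] g(4) by simp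
  then show "Tk_map 1 B g u \<in> tdom B V" using jet_of_in_tdom[OF assms(2) gc] by (simp only:)
  let ?h = "\<psi> \<circ> g \<circ> inv_into U \<phi>"
  obtain S where S: "0 \<in> S" "smooth_on S (\<phi> \<circ> \<gamma>)" "\<gamma> ` S \<subseteq> U"
    using smooth_curve_in_chart[OF assms(1) g(1) assms(4) g(2)] .
  have h: "?h (\<phi> y) = \<psi> (g y)" if "y \<in> U" for y using that chartsD(2)[OF assms(4)] by simp
  have "vector_derivative (\<psi> \<circ> (g \<circ> \<gamma>)) (at 0) = vector_derivative (\<lambda>t. ?h ((\<phi> \<circ> \<gamma>) t)) (at 0)"
    using S chartsD(2)[OF assms(4)] by (intro vector_derivative_cong_open[OF smooth_on_open[OF S(2)] S(1)]) auto
  also have "\<dots> = fderiv ?h ((\<phi> \<circ> \<gamma>) 0) (vector_derivative (\<phi> \<circ> \<gamma>) (at 0))"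
    by (rule vector_derivative_compose[OF S(2,1) smooth_map_local_rep[OF assms(1-5)]]) (use g in auto)
  finally have nv: "nth_vderiv 1 (\<psi> \<circ> (g \<circ> \<gamma>)) 0 = fderiv ?h x \<xi>"
    using x by (simp add: nth_vderiv_Suc)
  show "tcoord \<psi> (Tk_map 1 B g u) = (?h x, fderiv ?h x \<xi>)"
    unfolding Tu tcoord_jet_of[OF assms(2) gc(1) assms(5) gc(2)] nv using h[OF g(2)] by (simp add: x(1))
qed

section \<open>The atlas of the tangent bundle\<close>

lemma smooth_map_id:
  assumes "smooth_atlas A"
  shows "smooth_map A A id"
proof (rule smooth_mapI[OF assms])
  fix x assume "x \<in> carrier A"
  then obtain U \<phi> where U: "(U, \<phi>) \<in> charts A" "x \<in> U" using atlas_chart_at[OF assms] by blast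
  have "smooth_on (\<phi> ` U) (\<phi> \<circ> id \<circ> inv_into U \<phi>)"
    by (rule smooth_on_cong[OF smooth_on_ident[OF chartsD(3)[OF U(1)]]]) (auto simp: f_inv_into_f)
  then show "\<exists>U \<phi> V \<psi> S. (U, \<phi>) \<in> charts A \<and> (V, \<psi>) \<in> charts A \<and> x \<in> U \<and>
      \<phi> x \<in> S \<and> S \<subseteq> \<phi> ` (U \<inter> id -` V) \<and> smooth_on S (\<psi> \<circ> id \<circ> inv_into U \<phi>)"
    using U by (intro exI[of _ U] exI[of _ \<phi>] exI[of _ "\<phi> ` U"]) auto
qed simp

text \<open>For g = id the local representative of Tg is the transition between two tangent charts,
  whose smoothness is thereby a special case of that of tangent maps.\<close>

lemma Tk_map_id:
  assumes "smooth_atlas A" "u \<in> Tk k A"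
  shows "Tk_map k A id u = u"
  using TkE[OF assms(2)] Tk_map_jet_of[OF assms(1,1) smooth_map_id[OF assms(1)]] by (metis id_comp)

lemma tdom_mono: "U \<subseteq> V \<Longrightarrow> tdom A U \<subseteq> tdom A V"
  by (auto simp: tdom_def)

lemma tdom_Int: "tdom A U \<inter> tdom A V = tdom A (U \<inter> V)"
  by (auto simp: tdom_def)

lemma tdom_subset: "tdom A U \<subseteq> Tk 1 A"
  by (auto simp: tdom_def)

lemma tdom_restrict:
  assumes "smooth_atlas A" "(U, \<phi>) \<in> charts A" "u \<in> tdom A U" "tcoord \<phi> u = (x, \<xi>)" "x \<in> \<phi> ` W" "W \<subseteq> U"
  shows "u \<in> tdom A W"
proof -
  obtain \<gamma> where g: "smooth_curve A \<gamma>" "\<gamma> 0 \<in> U" "u = jet_of A 1 \<gamma>" using tdomE[OF assms(1,3)] .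
  have "\<phi> (\<gamma> 0) = x" using tcoord_jet_of[OF assms(1) g(1) assms(2) g(2)] assms(4) g(3) by simp
  then have "\<gamma> 0 \<in> W" using assms(5,6) g(2) inj_onD[OF chartsD(2)[OF assms(2)]] by blast
  then show ?thesis using jet_of_in_tdom[OF assms(1) g(1)] g(3) by simp
qed

lemma smooth_on_tangent_map:
  assumes "smooth_on T h"
  shows "smooth_on (T \<times> UNIV) (\<lambda>p. (h (fst p), fderiv h (fst p) (snd p)))"
proof -
  have o: "open (T \<times> (UNIV :: 'a set))" using smooth_on_open[OF assms] by (rule open_Times) simp
  note f = smooth_on_linear[OF bounded_linear_fst o] and s = smooth_on_linear[OF bounded_linear_snd o]
  show ?thesis
    by (intro smooth_on_Pair smooth_on_compose[OF f assms] smooth_on_fderiv_apply[OF assms f s]) auto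
qed

lemma restrict_chart_vimage:
  assumes "smooth_atlas A" "smooth_atlas B" "smooth_map A B g" "(U, \<phi>) \<in> charts A" "(V, \<psi>) \<in> charts B"
  shows "(U \<inter> g -` V, \<phi>) \<in> charts A"
  using smooth_on_open[OF smooth_map_local_rep[OF assms]] by (intro restrict_chart[OF assms(1,4)]) auto

lemma tangent_map_local_rep:
  assumes "smooth_atlas A" "smooth_atlas B" "smooth_map A B g" "(U, \<phi>) \<in> charts A" "(V, \<psi>) \<in> charts B"
    and "p \<in> \<phi> ` (U \<inter> g -` V) \<times> UNIV"
  shows "(tcoord \<psi> \<circ> Tk_map 1 B g \<circ> inv_into (tdom A U) (tcoord \<phi>)) p =
    ((\<psi> \<circ> g \<circ> inv_into U \<phi>) (fst p), fderiv (\<psi> \<circ> g \<circ> inv_into U \<phi>) (fst p) (snd p))"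
proof -
  have "p \<in> tcoord \<phi> ` tdom A (U \<inter> g -` V)"
    unfolding tcoord_image[OF assms(1) restrict_chart_vimage[OF assms(1-5)]] by (rule assms(6))
  then obtain u where u: "u \<in> tdom A (U \<inter> g -` V)" "tcoord \<phi> u = p" by blast
  then have "inv_into (tdom A U) (tcoord \<phi>) p = u"
    using inj_on_tcoord[OF assms(1,4)] tdom_mono[of "U \<inter> g -` V" U A] by (auto intro: inv_into_f_eq)
  then show ?thesis using tcoord_Tk_map(2)[OF assms(1-5) u(1), of "fst p" "snd p"] u(2) by simp
qed

lemma smooth_tangent_map_local_rep:
  assumes "smooth_atlas A" "smooth_atlas B" "smooth_map A B g" "(U, \<phi>) \<in> charts A" "(V, \<psi>) \<in> charts B"
  shows "smooth_on (\<phi> ` (U \<inter> g -` V) \<times> UNIV) (tcoord \<psi> \<circ> Tk_map 1 B g \<circ> inv_into (tdom A U) (tcoord \<phi>))"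
  by (rule smooth_on_cong[OF smooth_on_tangent_map[OF smooth_map_local_rep[OF assms]]])
    (rule tangent_map_local_rep[OF assms, symmetric])

lemma carrier_tangent_atlas:
  assumes "smooth_atlas A"
  shows "carrier (tangent_atlas A) = Tk 1 A"
proof (intro subset_antisym subsetI)
  fix u assume "u \<in> carrier (tangent_atlas A)"
  then obtain U \<phi> where "u \<in> fst (tangent_chart A (U, \<phi>))"
    unfolding carrier_def tangent_atlas_def by auto
  then show "u \<in> Tk 1 A" by (simp add: tangent_chart_eq tdom_def)
next
  fix u assume u: "u \<in> Tk 1 A"
  then obtain \<gamma> where g: "smooth_curve A \<gamma>" "u = jet_of A 1 \<gamma>" by (rule TkE)
  obtain U \<phi> where U: "(U, \<phi>) \<in> charts A" "\<gamma> 0 \<in> U" using atlas_chart_at[OF assms smooth_curve_carrier[OF g(1)]] by blast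
  have "u \<in> tdom A U" using jet_of_in_tdom[OF assms g(1) U(2)] g(2) by simp
  then have "u \<in> fst (tangent_chart A (U, \<phi>))" by (simp add: tangent_chart_eq)
  then show "u \<in> carrier (tangent_atlas A)" using U(1) unfolding carrier_def tangent_atlas_def by blast
qed

lemma tangent_charts:
  assumes A: "smooth_atlas A" and U: "(U, \<phi>) \<in> charts A"
  shows "(tdom A U, tcoord \<phi>) \<in> charts (tangent_atlas A)"
proof -
  have tr: "smooth_on (tcoord \<phi> ` (tdom A U \<inter> tdom A V)) (tcoord \<psi> \<circ> inv_into (tdom A U) (tcoord \<phi>))"
    if U: "(U, \<phi>) \<in> charts A" and V: "(V, \<psi>) \<in> charts A" for U \<phi> V \<psi>
  proof -
    note id = smooth_map_id[OF A]
    have im: "tcoord \<phi> ` (tdom A U \<inter> tdom A V) = \<phi> ` (U \<inter> id -` V) \<times> UNIV"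
      using tcoord_image[OF A restrict_chart_vimage[OF A A id U V]] by (simp add: tdom_Int)
    have "(tcoord \<psi> \<circ> Tk_map 1 A id \<circ> inv_into (tdom A U) (tcoord \<phi>)) p = (tcoord \<psi> \<circ> inv_into (tdom A U) (tcoord \<phi>)) p"
      if "p \<in> \<phi> ` (U \<inter> id -` V) \<times> UNIV" for p
    proof -
      have "p \<in> tcoord \<phi> ` tdom A U" using that tcoord_image[OF A U] by auto
      then have "inv_into (tdom A U) (tcoord \<phi>) p \<in> Tk 1 A" by (rule subsetD[OF tdom_subset inv_into_into])
      then show ?thesis using Tk_map_id[OF A] by simp
    qed
    then show ?thesis
      unfolding im using smooth_on_cong[OF smooth_tangent_map_local_rep[OF A A id U V]] by blast
  qed
  have "compatible (tdom A U, tcoord \<phi>) d" if d: "d \<in> tangent_atlas A" for d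
  proof -
    obtain V \<psi> where V: "(V, \<psi>) \<in> charts A" "d = (tdom A V, tcoord \<psi>)"
      using d by (auto simp: tangent_atlas_def tangent_chart_eq)
    show ?thesis using tr[OF U V(1)] tr[OF V(1) U] by (simp add: compatible_def V(2) Int_commute)
  qed
  moreover have "tdom A U \<subseteq> carrier (tangent_atlas A)"
    using tdom_subset[of A U] carrier_tangent_atlas[OF A] by simp
  moreover have "open (tcoord \<phi> ` tdom A U)"
    unfolding tcoord_image[OF A U] by (intro open_Times chartsD(3)[OF U] open_UNIV)
  ultimately show ?thesis using inj_on_tcoord[OF A U] by (simp add: charts_def)
qed

lemma smooth_atlas_tangent: "smooth_atlas A \<Longrightarrow> smooth_atlas (tangent_atlas A)"
  unfolding smooth_atlas_def using tangent_charts
  by (auto simp: tangent_atlas_def tangent_chart_eq smooth_atlas_def)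

lemma smooth_map_tangent:
  assumes "smooth_atlas A" "smooth_atlas B" "smooth_map A B g"
  shows "smooth_map (tangent_atlas A) (tangent_atlas B) (Tk_map 1 B g)"
proof (rule smooth_mapI[OF smooth_atlas_tangent[OF assms(1)]])
  show "Tk_map 1 B g \<in> carrier (tangent_atlas A) \<rightarrow> carrier (tangent_atlas B)"
    using Tk_map_in_Tk[OF assms] by (auto simp: carrier_tangent_atlas assms)
  fix u assume "u \<in> carrier (tangent_atlas A)"
  then have "u \<in> Tk 1 A" by (simp add: carrier_tangent_atlas[OF assms(1)])
  then obtain \<gamma> where g: "smooth_curve A \<gamma>" "u = jet_of A 1 \<gamma>" by (rule TkE)
  obtain U \<phi> where U: "(U, \<phi>) \<in> charts A" "\<gamma> 0 \<in> U"
    using atlas_chart_at[OF assms(1) smooth_curve_carrier[OF g(1)]] by blast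
  obtain V \<psi> where V: "(V, \<psi>) \<in> charts B" "g (\<gamma> 0) \<in> V"
    using atlas_chart_at[OF assms(2) smooth_map_carrier[OF assms(3) smooth_curve_carrier[OF g(1)]]] by blast
  let ?W = "U \<inter> g -` V"
  have u: "u \<in> tdom A ?W" using jet_of_in_tdom[OF assms(1) g(1), of ?W] U V g(2) by simp
  have im: "tcoord \<phi> ` tdom A ?W = \<phi> ` ?W \<times> UNIV"
    by (rule tcoord_image[OF assms(1) restrict_chart_vimage[OF assms U(1) V(1)]])
  have "tdom A ?W \<subseteq> tdom A U \<inter> Tk_map 1 B g -` tdom B V"
    using tdom_mono[of ?W U A] tcoord_Tk_map(1)[OF assms U(1) V(1)] by (auto simp: prod_eq_iff)
  then have "\<phi> ` ?W \<times> UNIV \<subseteq> tcoord \<phi> ` (tdom A U \<inter> Tk_map 1 B g -` tdom B V)" using im by blast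
  then show "\<exists>U \<phi> V \<psi> S. (U, \<phi>) \<in> charts (tangent_atlas A) \<and> (V, \<psi>) \<in> charts (tangent_atlas B) \<and> u \<in> U \<and>
      \<phi> u \<in> S \<and> S \<subseteq> \<phi> ` (U \<inter> Tk_map 1 B g -` V) \<and> smooth_on S (\<psi> \<circ> Tk_map 1 B g \<circ> inv_into U \<phi>)"
    using tangent_charts[OF assms(1) U(1)] tangent_charts[OF assms(2) V(1)] u im
      smooth_tangent_map_local_rep[OF assms U(1) V(1)] tdom_mono[of ?W U A]
    by (intro exI[of _ "tdom A U"] exI[of _ "tcoord \<phi>"] exI[of _ "tdom B V"] exI[of _ "tcoord \<psi>"]
        exI[of _ "\<phi> ` ?W \<times> UNIV"]) blast
qed

section \<open>The local form of relatedness\<close>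

text \<open>The second difference is the increment over [0, 1] of a function whose derivative
  compares Dh at two parallel points. Differentiability of Dh at x controls that derivative, with
  one remainder for each point; hence the factor 2.\<close>

lemma second_difference_estimate:
  assumes "smooth_on S h" "x \<in> S" "e > 0"
  obtains d where "d > 0" "\<And>s. 0 < s \<Longrightarrow> s < d \<Longrightarrow>
    norm (h (x + s *\<^sub>R u + s *\<^sub>R v) - h (x + s *\<^sub>R u) - (h (x + s *\<^sub>R v) - h x)
      - s\<^sup>2 *\<^sub>R fderiv (fderiv h) x u v) \<le> 2 * e * s\<^sup>2 * (norm u + norm v)\<^sup>2"
proof -
  let ?D = "fderiv h" and ?A = "fderiv (fderiv h) x"
  have "(?D has_derivative blinfun_apply ?A) (at x)"
    by (rule smooth_on_has_fderiv[OF smooth_on_fderiv[OF assms(1)] assms(2)])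
  then obtain d1 where d1: "d1 > 0" "\<And>z. norm (z - x) < d1 \<Longrightarrow> norm (?D z - ?D x - ?A (z - x)) \<le> e * norm (z - x)"
    using assms(3) unfolding has_derivative_at_alt by blast
  obtain d2 where d2: "d2 > 0" "ball x d2 \<subseteq> S" using openE[OF smooth_on_open[OF assms(1)] assms(2)] .
  define N where "N = norm u + norm v"
  \<comment> \<open>Makes s * N smaller than d1 and d2, so the whole parallelogram spanned by s u
    and s v at x lies where both estimates hold.\<close>
  define d where "d = min d1 d2 / (N + 1)"
  have N: "N \<ge> 0" by (simp add: N_def)
  have "norm (h (x + s *\<^sub>R u + s *\<^sub>R v) - h (x + s *\<^sub>R u) - (h (x + s *\<^sub>R v) - h x)
      - s\<^sup>2 *\<^sub>R ?A u v) \<le> 2 * e * s\<^sup>2 * N\<^sup>2"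
    if s: "0 < s" "s < d" for s
  proof -
    have sN: "s * N < min d1 d2"
    proof -
      have "s * N \<le> s * (N + 1)" using s by simp
      also have "\<dots> < min d1 d2" using s N by (simp add: d_def pos_less_divide_eq)
      finally show ?thesis .
    qed
    have near: "norm (a *\<^sub>R s *\<^sub>R u + t *\<^sub>R s *\<^sub>R v) \<le> s * N" if "0 \<le> a" "a \<le> 1" "0 \<le> t" "t \<le> 1" for a t
    proof -
      have "norm (a *\<^sub>R s *\<^sub>R u + t *\<^sub>R s *\<^sub>R v) \<le> a * (s * norm u) + t * (s * norm v)"
        using norm_triangle_ineq[of "a *\<^sub>R s *\<^sub>R u" "t *\<^sub>R s *\<^sub>R v"] s that by simp
      also have "\<dots> \<le> 1 * (s * norm u) + 1 * (s * norm v)"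
        using s that by (intro add_mono mult_right_mono) auto
      finally show ?thesis by (simp add: N_def distrib_left)
    qed
    define z where "z = (\<lambda>a t. x + (a *\<^sub>R s *\<^sub>R u + t *\<^sub>R s *\<^sub>R v))"
    have zS: "z a t \<in> S" and zD: "norm (?D (z a t) - ?D x - ?A (z a t - x)) \<le> e * (s * N)"
      if "0 \<le> a" "a \<le> 1" "0 \<le> t" "t \<le> 1" for a t
    proof -
      have n: "norm (z a t - x) \<le> s * N" using near[OF that] by (simp add: z_def)
      then have "dist x (z a t) < d2" using sN by (simp add: dist_norm norm_minus_commute)
      then show "z a t \<in> S" using d2(2) by auto
      have "norm (?D (z a t) - ?D x - ?A (z a t - x)) \<le> e * norm (z a t - x)" using n sN by (intro d1(2)) simp
      also have "\<dots> \<le> e * (s * N)" using n assms(3) by (intro mult_left_mono) auto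
      finally show "norm (?D (z a t) - ?D x - ?A (z a t - x)) \<le> e * (s * N)" .
    qed
    let ?q = "\<lambda>t. ?D (z 1 t) (s *\<^sub>R v) - ?D (z 0 t) (s *\<^sub>R v) - s\<^sup>2 *\<^sub>R ?A u v"
    \<comment> \<open>The increment p 1 - p 0 is the second difference minus the claimed quadratic
      term.\<close>
    define p where "p = (\<lambda>t. h (z 1 t) - h (z 0 t) - t *\<^sub>R (s\<^sup>2 *\<^sub>R ?A u v))"
    have "norm (p 1 - p 0) \<le> 2 * e * s\<^sup>2 * N\<^sup>2 * norm (1 - 0 :: real)"
    proof (rule differentiable_bound[where S="{0..1}" and f'="\<lambda>t a. a *\<^sub>R ?q t"])
      fix t :: real assume "t \<in> {0..1}"
      then have t: "0 \<le> t" "t \<le> 1" by auto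
      have dz: "(z a has_derivative (\<lambda>r. r *\<^sub>R s *\<^sub>R v)) (at t)" for a
        unfolding z_def by (auto intro!: derivative_eq_intros)
      have dh: "((\<lambda>t. h (z a t)) has_derivative (\<lambda>r. r *\<^sub>R ?D (z a t) (s *\<^sub>R v))) (at t)"
        if "0 \<le> a" "a \<le> 1" for a
        using has_derivative_compose[OF dz smooth_on_has_fderiv[OF assms(1) zS[OF that t]]]
        by (simp add: blinfun.scaleR_right)
      show "(p has_derivative (\<lambda>a. a *\<^sub>R ?q t)) (at t within {0..1})"
        unfolding p_def
        by (rule has_derivative_at_withinI, rule derivative_eq_intros dh | simp add: scaleR_diff_right)+
      let ?G = "?D (z 1 t) - ?D (z 0 t) - ?A (s *\<^sub>R u)"
      have "?A (z 1 t - x) - ?A (z 0 t - x) = ?A (s *\<^sub>R u)"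
        by (simp add: z_def blinfun.add_right)
      then have "?G = (?D (z 1 t) - ?D x - ?A (z 1 t - x)) - (?D (z 0 t) - ?D x - ?A (z 0 t - x))"
        by (simp add: algebra_simps)
      also have "norm \<dots> \<le> e * (s * N) + e * (s * N)"
        using t by (intro order_trans[OF norm_triangle_ineq4] add_mono zD) auto
      also have "\<dots> = 2 * e * s * N" by (simp add: algebra_simps)
      finally have G: "norm ?G \<le> 2 * e * s * N" .
      have "?q t = blinfun_apply ?G (s *\<^sub>R v)"
        by (simp add: blinfun.diff_left blinfun.scaleR_right blinfun.scaleR_left power2_eq_square scaleR_diff_right)
      then have "norm (?q t) \<le> norm ?G * norm (s *\<^sub>R v)"
        by (simp only: norm_blinfun)
      also have "\<dots> \<le> (2 * e * s * N) * (s * N)"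
      proof (rule mult_mono[OF G])
        have "norm v \<le> N" by (simp add: N_def)
        then show "norm (s *\<^sub>R v) \<le> s * N" using s by simp
      qed (use assms(3) s N in auto)
      finally have B: "norm (?q t) \<le> 2 * e * s\<^sup>2 * N\<^sup>2"
        by (simp add: power2_eq_square mult_ac)
      then show "onorm (\<lambda>a. a *\<^sub>R ?q t) \<le> 2 * e * s\<^sup>2 * N\<^sup>2"
        by (intro onorm_le) (simp add: mult.commute mult_left_mono)
    qed auto
    then show ?thesis by (simp add: p_def z_def algebra_simps)
  qed
  moreover have "d > 0" using d1(1) d2(1) N by (simp add: d_def)
  ultimately show ?thesis using that[of d] unfolding N_def by blast
qed

text \<open>The second difference is symmetric in u and v, and both values of the second derivative
  approximate it, after division by s^2, as s tends to 0.\<close>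

lemma fderiv_fderiv_symmetric:
  assumes "smooth_on S h" "x \<in> S"
  shows "fderiv (fderiv h) x u v = fderiv (fderiv h) x v u"
proof -
  let ?A = "fderiv (fderiv h) x"
  let ?c = "norm (?A u v - ?A v u)"
  define N where "N = norm u + norm v"
  have "?c \<le> e" if "e > 0" for e
  proof -
    \<comment> \<open>The two estimates contribute 4 * e' * N^2 in total, which is then at most e,
      also when N = 0.\<close>
    define e' where "e' = e / (N\<^sup>2 + 1) / 4"
    have N1: "N\<^sup>2 + 1 > 0" by (simp add: add_nonneg_pos)
    have e': "e' > 0" using that N1 by (simp add: e'_def)
    obtain d1 where d1: "d1 > 0" "\<And>s. 0 < s \<Longrightarrow> s < d1 \<Longrightarrow>
      norm (h (x + s *\<^sub>R u + s *\<^sub>R v) - h (x + s *\<^sub>R u) - (h (x + s *\<^sub>R v) - h x)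
      - s\<^sup>2 *\<^sub>R ?A u v) \<le> 2 * e' * s\<^sup>2 * (norm u + norm v)\<^sup>2"
      using second_difference_estimate[OF assms e'] by blast
    obtain d2 where d2: "d2 > 0" "\<And>s. 0 < s \<Longrightarrow> s < d2 \<Longrightarrow>
      norm (h (x + s *\<^sub>R v + s *\<^sub>R u) - h (x + s *\<^sub>R v) - (h (x + s *\<^sub>R u) - h x)
      - s\<^sup>2 *\<^sub>R ?A v u) \<le> 2 * e' * s\<^sup>2 * (norm v + norm u)\<^sup>2"
      using second_difference_estimate[OF assms e'] by blast
    define s where "s = min d1 d2 / 2"
    have s: "0 < s" "s < d1" "s < d2" using d1(1) d2(1) by (auto simp: s_def)
    let ?X = "h (x + s *\<^sub>R u + s *\<^sub>R v) - h (x + s *\<^sub>R u) - (h (x + s *\<^sub>R v) - h x)"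
    have 1: "norm (?X - s\<^sup>2 *\<^sub>R ?A u v) \<le> 2 * e' * s\<^sup>2 * N\<^sup>2"
      using d1(2)[OF s(1,2)] by (simp add: N_def)
    have X: "h (x + s *\<^sub>R v + s *\<^sub>R u) - h (x + s *\<^sub>R v) - (h (x + s *\<^sub>R u) - h x) = ?X"
      by (simp add: algebra_simps)
    have 2: "norm (?X - s\<^sup>2 *\<^sub>R ?A v u) \<le> 2 * e' * s\<^sup>2 * N\<^sup>2"
      using d2(2)[OF s(1,3)] unfolding X by (simp only: N_def add.commute[of "norm v"])
    have "s\<^sup>2 *\<^sub>R (?A u v - ?A v u)
      = (?X - s\<^sup>2 *\<^sub>R ?A v u) - (?X - s\<^sup>2 *\<^sub>R ?A u v)"
      by (simp add: scaleR_diff_right)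
    then have "s\<^sup>2 * ?c \<le> 2 * e' * s\<^sup>2 * N\<^sup>2 + 2 * e' * s\<^sup>2 * N\<^sup>2"
      using order_trans[OF norm_triangle_ineq4 add_mono[OF 2 1]] by (metis abs_power2 norm_scaleR)
    also have "\<dots> = s\<^sup>2 * (4 * e' * N\<^sup>2)" by simp
    also have "4 * e' = e / (N\<^sup>2 + 1)"
    proof -
      have "4 * (q / 4) = q" for q :: real by simp
      then show ?thesis unfolding e'_def .
    qed
    also have "s\<^sup>2 * (e / (N\<^sup>2 + 1) * N\<^sup>2) = s\<^sup>2 * (e * (N\<^sup>2 / (N\<^sup>2 + 1)))" by simp
    also have "\<dots> \<le> s\<^sup>2 * (e * 1)" using that N1 by (intro mult_left_mono) (auto simp: divide_simps)
    finally show ?thesis using s(1) by simp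
  qed
  then have "?c \<le> 0" by (rule field_le_epsilon) auto
  then show ?thesis by simp
qed

text \<open>Both sides of K_N o TTg = Tg o K_M are evaluated at the vector with coordinates (x,
  \<xi>; y, 0) and compared in a tangent chart. The general vector (x, \<xi>; y, \<eta>) would add
  dh \<eta> to either side, so \<eta> = 0 loses nothing.\<close>

lemma g_related_local:
  assumes M: "smooth_atlas M" and N: "smooth_atlas N" and g: "smooth_map M N g"
    and "linear_connection M \<Gamma>M KM" and "linear_connection N \<Gamma>N KN" and "g_related M N g KM KN"
    and U: "(U, \<phi>) \<in> charts M" and V: "(V, \<psi>) \<in> charts N" and x: "x \<in> \<phi> ` (U \<inter> g -` V)"
    and h_def: "h = \<psi> \<circ> g \<circ> inv_into U \<phi>"
  shows "fderiv h x (\<Gamma>M (U, \<phi>) x \<xi> y) =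
    fderiv (fderiv h) x \<xi> y
    + \<Gamma>N (V, \<psi>) (h x) (fderiv h x \<xi>) (fderiv h x y)"
proof -
  let ?TM = "tangent_atlas M" and ?TN = "tangent_atlas N" and ?Tg = "Tk_map 1 N g" and ?W = "U \<inter> g -` V"
  note TM = smooth_atlas_tangent[OF M] and TN = smooth_atlas_tangent[OF N]
    and Tg = smooth_map_tangent[OF M N g] and TU = tangent_charts[OF M U] and TV = tangent_charts[OF N V]
  note sh = smooth_map_local_rep[OF M N g U V, folded h_def]
  have "(x, \<xi>) \<in> tcoord \<phi> ` tdom M U" using x tcoord_image[OF M U] by auto
  \<comment> \<open>A curve in TM through (x, \<xi>) with velocity (y, 0); its 1-jet is the double
    tangent vector.\<close>
  then obtain \<Delta> where D: "smooth_curve ?TM \<Delta>" "\<Delta> 0 \<in> tdom M U" "tcoord \<phi> (\<Delta> 0) = (x, \<xi>)"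
    "tcoord (tcoord \<phi>) (jet_of ?TM 1 \<Delta>) = ((x, \<xi>), (y, 0))"
    using tangent_vector_with_coords[OF TM TU, of "(x, \<xi>)" "(y, 0)"] by metis
  define \<theta> where "\<theta> = jet_of ?TM 1 \<Delta>"
  have th: "\<theta> \<in> tdom ?TM (tdom M U)" unfolding \<theta>_def by (rule jet_of_in_tdom[OF TM D(1,2)])
  have KM: "KM \<theta> \<in> tdom M U" "tcoord \<phi> (KM \<theta>) = (x, \<Gamma>M (U, \<phi>) x \<xi> y)"
    using assms(4) U th D(4) unfolding linear_connection_def double_tangent_chart_def
    by (auto simp: tangent_chart_eq \<theta>_def dest!: bspec)
  have "KM \<theta> \<in> tdom M ?W" by (rule tdom_restrict[OF M U KM x]) auto
  from tcoord_Tk_map(2)[OF M N g U V this KM(2)]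
  have 1: "tcoord \<psi> (?Tg (KM \<theta>)) = (h x, fderiv h x (\<Gamma>M (U, \<phi>) x \<xi> y))"
    by (simp only: h_def)
  have D0: "\<Delta> 0 \<in> tdom M ?W" by (rule tdom_restrict[OF M U D(2,3) x]) auto
  then have "?Tg (\<Delta> 0) \<in> tdom N V" by (rule tcoord_Tk_map(1)[OF M N g U V _ D(3)])
  then have th': "\<theta> \<in> tdom ?TM (tdom M U \<inter> ?Tg -` tdom N V)"
    unfolding \<theta>_def using D(2) by (intro jet_of_in_tdom[OF TM D(1)]) simp
  \<comment> \<open>The tangent map in charts, (x, \<xi>) to (h x, dh(x) \<xi>). Its derivative at
    (x, \<xi>) in the direction (y, 0) supplies the second derivative of h.\<close>
  let ?H = "tcoord \<psi> \<circ> ?Tg \<circ> inv_into (tdom M U) (tcoord \<phi>)"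
  note T2 = tcoord_Tk_map[OF TM TN Tg TU TV th' D(4)[folded \<theta>_def]]
  have xW: "(x, \<xi>) \<in> \<phi> ` ?W \<times> UNIV" using x by simp
  have oW: "open (\<phi> ` ?W \<times> (UNIV :: 'b set))" using smooth_on_open[OF sh] by (rule open_Times) simp
  have fst': "(fst has_derivative fst) (at (x, \<xi>))" and snd': "(snd has_derivative snd) (at (x, \<xi>))"
    by (auto intro: bounded_linear_imp_has_derivative bounded_linear_fst bounded_linear_snd)
  have dh: "(h has_derivative blinfun_apply (fderiv h x)) (at (fst (x, \<xi>)))"
    and ddh: "(fderiv h has_derivative blinfun_apply (fderiv (fderiv h) x)) (at (fst (x, \<xi>)))"
    using smooth_on_has_fderiv[OF sh x] smooth_on_has_fderiv[OF smooth_on_fderiv[OF sh] x] by auto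
  have "((\<lambda>p. (h (fst p), fderiv h (fst p) (snd p))) has_derivative
      (\<lambda>q. (fderiv h x (fst q),
        fderiv h (fst (x, \<xi>)) (snd q)
         + fderiv (fderiv h) x (fst q) (snd (x, \<xi>))))) (at (x, \<xi>))"
    by (intro has_derivative_Pair has_derivative_compose[OF fst' dh]
        bounded_bilinear.FDERIV[OF bounded_bilinear_blinfun_apply] has_derivative_compose[OF fst' ddh] snd')
  then have "(?H has_derivative (\<lambda>q. (fderiv h x (fst q),
        fderiv h (fst (x, \<xi>)) (snd q)
         + fderiv (fderiv h) x (fst q) (snd (x, \<xi>))))) (at (x, \<xi>))"
    by (rule has_derivative_transform_within_open[OF _ oW xW])
      (rule tangent_map_local_rep[OF M N g U V, folded h_def, symmetric])
  from fderiv_eq[OF this] have dH: "fderiv ?H (x, \<xi>) (y, 0) =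
      (fderiv h x y, fderiv (fderiv h) x y \<xi>)"
    by (simp add: blinfun.zero_right)
  have H: "?H (x, \<xi>) = (h x, fderiv h x \<xi>)"
    using tangent_map_local_rep[OF M N g U V xW, folded h_def] by simp
  let ?\<theta>' = "Tk_map 1 ?TN ?Tg \<theta>"
  have c2: "tcoord (tcoord \<psi>) ?\<theta>' = ((h x, fderiv h x \<xi>),
      (fderiv h x y, fderiv (fderiv h) x y \<xi>))"
    using T2(2) unfolding dH H .
  have 2: "tcoord \<psi> (KN ?\<theta>') = (h x, fderiv (fderiv h) x y \<xi>
      + \<Gamma>N (V, \<psi>) (h x) (fderiv h x \<xi>) (fderiv h x y))"
    using assms(5) V T2(1) c2 unfolding linear_connection_def double_tangent_chart_def
    by (auto simp: tangent_chart_eq dest!: bspec)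
  have "KN ?\<theta>' = ?Tg (KM \<theta>)"
    using assms(6) tdom_subset[of ?TM "tdom M U"] th unfolding g_related_def by blast
  \<comment> \<open>Here y is the direction of differentiation, so the second derivative comes out
    at (y, \<xi>) and has to be turned around.\<close>
  then show ?thesis
    using 1 2 fderiv_fderiv_symmetric[OF sh x, of y \<xi>] by simp
qed

section \<open>Finitely supported sequences\<close>

lemma apply_Bcontfun_finite:
  fixes f :: "nat \<Rightarrow> 'a::real_normed_vector"
  assumes "finite {i. f i \<noteq> 0}"
  shows "apply_bcontfun (Bcontfun f) = f"
proof (rule Bcontfun_inverse)
  have "range f \<subseteq> insert 0 (f ` {i. f i \<noteq> 0})" by auto
  then have "finite (range f)" using assms finite_subset by blast
  then show "f \<in> bcontfun" by (simp add: bcontfun_def finite_imp_bounded)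
qed

lemma apply_tuple: "apply_bcontfun (tuple k z) = (\<lambda>i. if i \<in> {1..k} then z i else 0)"
  unfolding tuple_def by (rule apply_Bcontfun_finite) (rule finite_subset[of _ "{1..k}"], auto)

lemma bounded_linear_apply_bcontfun:
  "bounded_linear (\<lambda>b :: 'a::real_normed_vector bseq. apply_bcontfun b i)"
  by (rule bounded_linear_intro[of _ 1]) (use norm_bounded in auto)

text \<open>Unlike \<open>tuple\<close> it reaches index 0, which carries the base point x.\<close>

definition single :: "nat \<Rightarrow> 'a::real_normed_vector \<Rightarrow> 'a bseq" where
  "single l v = Bcontfun (\<lambda>i. if i = l then v else 0)"

lemma apply_single: "apply_bcontfun (single l v) = (\<lambda>i. if i = l then v else 0)"
  unfolding single_def by (rule apply_Bcontfun_finite) (rule finite_subset[of _ "{l}"], auto)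

lemma bounded_linear_single: "bounded_linear (single l)"
proof (rule bounded_linear_intro[of _ 1])
  show "norm (single l v) \<le> norm v * 1" for v :: 'a
    by (rule norm_bound) (simp add: apply_single)
qed (auto intro!: bcontfun_eqI simp: apply_single)

section \<open>The local components of a connection\<close>

text \<open>Lets a family \<xi>, which as a function on nat carries no norm, be replaced by a
  bounded sequence.\<close>

lemma local_component_cong:
  "(\<And>l. l \<le> j \<Longrightarrow> \<xi> l = \<xi>' l) \<Longrightarrow> local_component G j \<xi> y = local_component G j \<xi>' y"
proof (induction G j \<xi> y arbitrary: \<xi>' rule: local_component.induct)
  case (3 G n \<xi> y)
  have "(\<lambda>u. local_component G (Suc n) (\<xi>(i - 1 := u)) y) = (\<lambda>u. local_component G (Suc n) (\<xi>'(i - 1 := u)) y)"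
    if "i \<in> {1..Suc (Suc n)}" for i
    using 3 that by (intro ext 3(1)) auto
  moreover have "local_component G (Suc n) \<xi> y = local_component G (Suc n) \<xi>' y"
    using 3 by (intro 3(2)) auto
  moreover have "\<xi> (i - 1) = \<xi>' (i - 1)" "\<xi> i = \<xi>' i" if "i \<in> {1..Suc (Suc n)}" for i
    using 3(3) that by auto
  ultimately show ?case using 3(3) by (auto intro!: sum.cong)
qed auto

text \<open>With \<open>comp_map\<close> this views M^j, for every j, as a map on an open subset of
  one Banach space: the variables x, \<xi>_1, \<xi>_2, ... are the entries of a bounded sequence,
  and y is a second argument. The calculus of smooth maps then applies to it.\<close>

definition comp_dom :: "'e set \<Rightarrow> ('e::real_normed_vector bseq \<times> 'e) set" where
  "comp_dom \<Omega> = {p. apply_bcontfun (fst p) 0 \<in> \<Omega>}"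

definition comp_map ::
  "('e::banach \<Rightarrow> 'e \<Rightarrow>\<^sub>L 'e \<Rightarrow>\<^sub>L 'e) \<Rightarrow> nat \<Rightarrow> 'e bseq \<times> 'e \<Rightarrow> 'e" where
  "comp_map G j p = local_component G j (apply_bcontfun (fst p)) (snd p)"

lemma bounded_linear_coordinate: "bounded_linear (\<lambda>p. apply_bcontfun (fst p :: 'a::real_normed_vector bseq) i)"
  by (rule bounded_linear_compose[OF bounded_linear_apply_bcontfun bounded_linear_fst])

lemma open_comp_dom:
  assumes "open \<Omega>"
  shows "open (comp_dom \<Omega>)"
  using smooth_on_open_vimage[OF smooth_on_linear[OF bounded_linear_coordinate[where i=0] open_UNIV] assms]
  by (simp add: comp_dom_def vimage_def)

text \<open>Varying variable l means moving along \<open>b + single l (u - \<xi> l)\<close>, so the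
  chain rule for an affine inner map applies. The sequence b has to match \<xi> up to entry j, the
  range seen by \<open>local_component_cong\<close>.\<close>

lemma partial_derivative_comp_map:
  assumes F: "smooth_on (comp_dom \<Omega>) (comp_map G j)" and \<xi>0: "\<xi> 0 \<in> \<Omega>"
    and b: "\<And>l. l \<le> j \<Longrightarrow> apply_bcontfun b l = \<xi> l" and l: "l \<le> j"
  shows "frechet_derivative (\<lambda>u. local_component G j (\<xi>(l := u)) y) (at (\<xi> l)) v
    = fderiv (comp_map G j) (b, y) (single l v, 0)"
proof -
  let ?i = "\<lambda>u. (b + single l (u - \<xi> l), y)"
  have p: "(b, y) \<in> comp_dom \<Omega>" using b[of 0] \<xi>0 by (simp add: comp_dom_def)
  have i0: "?i (\<xi> l) = (b, y)" using bounded_linear.linear[OF bounded_linear_single, THEN linear_0] by simp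
  have "(?i has_derivative (\<lambda>v. (single l v, 0))) (at (\<xi> l))"
    by (rule derivative_eq_intros bounded_linear.has_derivative[OF bounded_linear_single] refl | simp)+
  from has_derivative_compose[OF this, of "comp_map G j"]
  have "((\<lambda>u. comp_map G j (?i u)) has_derivative
      (\<lambda>v. fderiv (comp_map G j) (b, y) (single l v, 0))) (at (\<xi> l))"
    using smooth_on_has_fderiv[OF F p] by (simp only: i0)
  moreover have "(\<lambda>u. comp_map G j (?i u)) = (\<lambda>u. local_component G j (\<xi>(l := u)) y)"
    unfolding comp_map_def fst_conv snd_conv
    by (intro ext local_component_cong) (use b l in \<open>auto simp: apply_single\<close>)
  ultimately show ?thesis by (metis frechet_derivative_at)
qed

text \<open>The partial derivatives add up to one directional derivative, along the shift \<xi>_l to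
  (l + 1) \<xi>_(l+1). This is the form in which the recursion can be compared with a derivative in
  time.\<close>

lemma local_component_Suc:
  assumes F: "smooth_on (comp_dom \<Omega>) (comp_map G (Suc n))" and \<xi>0: "\<xi> 0 \<in> \<Omega>"
    and b: "\<And>l. l \<le> Suc n \<Longrightarrow> apply_bcontfun b l = \<xi> l"
  shows "local_component G (Suc (Suc n)) \<xi> y = (1 / real (Suc (Suc n))) *\<^sub>R
    (fderiv (comp_map G (Suc n)) (b, y) (\<Sum>l\<le>Suc n. single l (real (Suc l) *\<^sub>R \<xi> (Suc l)), 0)
      + G (\<xi> 0) (\<xi> 1) (local_component G (Suc n) \<xi> y))"
proof -
  let ?D = "blinfun_apply (fderiv (comp_map G (Suc n)) (b, y))"
  have "(\<Sum>i = 1..Suc (Suc n). frechet_derivative (\<lambda>u. local_component G (Suc n) (\<xi>(i - 1 := u)) y)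
           (at (\<xi> (i - 1))) (real i *\<^sub>R \<xi> i))
    = (\<Sum>l = 0..Suc n. frechet_derivative (\<lambda>u. local_component G (Suc n) (\<xi>(l := u)) y)
           (at (\<xi> l)) (real (Suc l) *\<^sub>R \<xi> (Suc l)))"
    \<comment> \<open>The i-th variable is entry i - 1, so its weighted increment i \<xi>_i becomes
      (l + 1) \<xi>_(l+1) at entry l.\<close>
    by (rule sum.reindex_bij_witness[of _ Suc "\<lambda>i. i - 1"]) auto
  also have "\<dots> = (\<Sum>l\<le>Suc n. ?D (single l (real (Suc l) *\<^sub>R \<xi> (Suc l)), 0))"
    unfolding atMost_atLeast0
    by (intro sum.cong refl partial_derivative_comp_map[OF F \<xi>0 b]) auto
  also have "\<dots> = ?D (\<Sum>l\<le>Suc n. (single l (real (Suc l) *\<^sub>R \<xi> (Suc l)), 0))"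
    by (rule blinfun.sum_right[symmetric])
  also have "(\<Sum>l\<le>Suc n. (single l (real (Suc l) *\<^sub>R \<xi> (Suc l)), 0 :: 'a))
    = (\<Sum>l\<le>Suc n. single l (real (Suc l) *\<^sub>R \<xi> (Suc l)), 0)"
    by (simp add: prod_eq_iff fst_sum snd_sum)
  finally have s: "(\<Sum>i = 1..Suc (Suc n). frechet_derivative (\<lambda>u. local_component G (Suc n) (\<xi>(i - 1 := u)) y)
           (at (\<xi> (i - 1))) (real i *\<^sub>R \<xi> i))
    = ?D (\<Sum>l\<le>Suc n. single l (real (Suc l) *\<^sub>R \<xi> (Suc l)), 0)" .
  show ?thesis unfolding local_component.simps(3) s ..
qed

text \<open>The recursion proper starts at j = 2, which is why the induction has the two base cases
  0 and 1; its step needs the preceding component only.\<close>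

lemma smooth_on_comp_map:
  assumes G: "smooth_on \<Omega> G"
  shows "smooth_on (comp_dom \<Omega>) (comp_map G j)"
proof (induction j rule: induct_nat_012)
  note op = open_comp_dom[OF smooth_on_open[OF G]]
  note co = smooth_on_linear[OF bounded_linear_coordinate op]
  have G01: "smooth_on (comp_dom \<Omega>) (\<lambda>p. blinfun_apply (G (apply_bcontfun (fst p) 0)) (apply_bcontfun (fst p) 1))"
    by (intro smooth_on_blinfun_apply smooth_on_compose[OF co G] co) (auto simp: comp_dom_def)
  case 0
  show ?case unfolding comp_map_def[abs_def] by (simp add: smooth_on_linear[OF bounded_linear_snd op])
  case 1
  show ?case unfolding comp_map_def[abs_def]
    using smooth_on_blinfun_apply[OF G01 smooth_on_linear[OF bounded_linear_snd op]] by simp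
  case (ge2 n)
  note F = ge2(2)
  let ?sh = "\<lambda>p :: 'a bseq \<times> 'a. (\<Sum>l\<le>Suc n. single l (real (Suc l) *\<^sub>R apply_bcontfun (fst p) (Suc l)), 0 :: 'a)"
  have "smooth_on (comp_dom \<Omega>) ?sh"
    by (intro smooth_on_Pair smooth_on_sum op smooth_on_const smooth_on_bounded_linear[OF bounded_linear_single]
        smooth_on_bounded_linear[OF bounded_linear_scaleR_right] co)
  then have "smooth_on (comp_dom \<Omega>) (\<lambda>p. (1 / real (Suc (Suc n))) *\<^sub>R
    (fderiv (comp_map G (Suc n)) p (?sh p)
      + blinfun_apply (blinfun_apply (G (apply_bcontfun (fst p) 0)) (apply_bcontfun (fst p) 1)) (comp_map G (Suc n) p)))"
    by (intro smooth_on_bounded_linear[OF bounded_linear_scaleR_right] smooth_on_add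
        smooth_on_blinfun_apply[OF smooth_on_fderiv[OF F]] smooth_on_blinfun_apply[OF G01 F])
  then show ?case
  proof (rule smooth_on_cong)
    fix p assume "p \<in> comp_dom \<Omega>"
    then have "apply_bcontfun (fst p) 0 \<in> \<Omega>" by (simp add: comp_dom_def)
    from local_component_Suc[where \<xi>="apply_bcontfun (fst p)" and b="fst p" and y="snd p", OF F this]
    show "(1 / real (Suc (Suc n))) *\<^sub>R (fderiv (comp_map G (Suc n)) p (?sh p)
      + blinfun_apply (blinfun_apply (G (apply_bcontfun (fst p) 0)) (apply_bcontfun (fst p) 1)) (comp_map G (Suc n) p))
      = comp_map G (Suc (Suc n)) p"
      unfolding comp_map_def[of G "Suc (Suc n)"] comp_map_def[of G "Suc n" p] by simp
  qed
qed

lemma dir_deriv_comp_map: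
  assumes F: "smooth_on (comp_dom \<Omega>) (comp_map G j)" and b: "apply_bcontfun b 0 \<in> \<Omega>"
  shows "((\<lambda>b. comp_map G j (b, y)) has_derivative (\<lambda>w. fderiv (comp_map G j) (b, y) (w, 0))) (at b)"
proof -
  have "((\<lambda>b. (b, y)) has_derivative (\<lambda>w. (w, 0))) (at b)"
    by (intro has_derivative_Pair has_derivative_ident has_derivative_const)
  then show ?thesis
    by (rule has_derivative_compose) (rule smooth_on_has_fderiv[OF F], use b in \<open>simp add: comp_dom_def\<close>)
qed

text \<open>In the recursion y is a mere parameter of the function that is differentiated. Linearity
  in y is an identity between functions of b on an open set, so it passes to their
  derivatives.\<close>

lemma linear_comp_map:
  assumes G: "smooth_on \<Omega> G"
  shows "apply_bcontfun b 0 \<in> \<Omega> \<Longrightarrow> linear (\<lambda>y. comp_map G j (b, y))"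
proof (induction j arbitrary: b rule: induct_nat_012)
  case 0
  show ?case by (simp add: comp_map_def linear_iff)
next
  case 1
  show ?case by (simp add: comp_map_def linear_blinfun_apply)
next
  case (ge2 n)
  note F = smooth_on_comp_map[OF G, of "Suc n"]
  have o: "open {b :: 'a bseq. apply_bcontfun b 0 \<in> \<Omega>}"
    using smooth_on_open_vimage[OF smooth_on_linear[OF bounded_linear_apply_bcontfun[where i=0] open_UNIV] smooth_on_open[OF G]]
    by (simp add: vimage_def)
  let ?S = "{b :: 'a bseq. apply_bcontfun b 0 \<in> \<Omega>}"
  have bS: "b \<in> ?S" using ge2.prems by simp
  note der = dir_deriv_comp_map[OF F ge2.prems]
  have eq: "dir_deriv (\<lambda>b. comp_map G (Suc n) (b, y)) w b = fderiv (comp_map G (Suc n)) (b, y) (w, 0)" for y w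
    by (rule dir_deriv_eq[OF der])
  have lin: "linear (\<lambda>y. fderiv (comp_map G (Suc n)) (b, y) (w, 0))" for w
  proof (rule linearI)
    fix y1 y2 c
    have "dir_deriv (\<lambda>b. comp_map G (Suc n) (b, y1 + y2)) w b
      = dir_deriv (\<lambda>b. comp_map G (Suc n) (b, y1) + comp_map G (Suc n) (b, y2)) w b"
      by (rule dir_deriv_cong[OF o bS]) (simp add: linear_add[OF ge2.IH(2)])
    then show "fderiv (comp_map G (Suc n)) (b, y1 + y2) (w, 0) =
      fderiv (comp_map G (Suc n)) (b, y1) (w, 0) + fderiv (comp_map G (Suc n)) (b, y2) (w, 0)"
      unfolding eq using dir_deriv_eq[OF has_derivative_add[OF der der]] by simp
    have "dir_deriv (\<lambda>b. comp_map G (Suc n) (b, c *\<^sub>R y1)) w b = dir_deriv (\<lambda>b. c *\<^sub>R comp_map G (Suc n) (b, y1)) w b"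
      by (rule dir_deriv_cong[OF o bS]) (simp add: linear_scale[OF ge2.IH(2)])
    then show "fderiv (comp_map G (Suc n)) (b, c *\<^sub>R y1) (w, 0) =
      c *\<^sub>R fderiv (comp_map G (Suc n)) (b, y1) (w, 0)"
      unfolding eq using dir_deriv_eq[OF has_derivative_scaleR_right[OF der]] by simp
  qed
  have "(\<lambda>y. comp_map G (Suc (Suc n)) (b, y)) = (\<lambda>y. (1 / real (Suc (Suc n))) *\<^sub>R
    (blinfun_apply (fderiv (comp_map G (Suc n)) (b, y))
        (\<Sum>l\<le>Suc n. single l (real (Suc l) *\<^sub>R apply_bcontfun b (Suc l)), 0)
      + G (apply_bcontfun b 0) (apply_bcontfun b 1) (comp_map G (Suc n) (b, y))))"
    unfolding comp_map_def[of G "Suc (Suc n)"] fst_conv snd_conv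
    by (rule ext, subst local_component_Suc[where \<xi>="apply_bcontfun b" and b=b, OF F ge2.prems])
      (simp_all add: comp_map_def)
  then show ?case
    using linear_compose_scale_right[OF linear_compose_add[OF lin linear_compose[OF ge2.IH(2)[OF ge2.prems] linear_blinfun_apply]]]
    by (simp add: o_def)
qed

section \<open>Covariant derivatives along a curve\<close>

text \<open>Divided by factorials, as in the arguments of M^j in z^i; the derivative in time of
  entry l is then l + 1 times entry l + 1, the shift of \<open>local_component_Suc\<close>.\<close>

definition taylor :: "(real \<Rightarrow> 'e::real_normed_vector) \<Rightarrow> real \<Rightarrow> nat \<Rightarrow> 'e" where
  "taylor f t l = (1 / fact l) *\<^sub>R nth_vderiv l f t"

lemma taylor_0: "taylor f t 0 = f t" and taylor_1: "taylor f t 1 = vector_derivative f (at t)"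
  by (simp_all add: taylor_def nth_vderiv_Suc)

text \<open>All Taylor coefficients together need not be a bounded sequence; a finite segment is
  one, and M^j reads no further.\<close>

definition initial_segment :: "nat \<Rightarrow> (nat \<Rightarrow> 'e::real_normed_vector) \<Rightarrow> 'e bseq" where
  "initial_segment j \<xi> = (\<Sum>l\<le>j. single l (\<xi> l))"

lemma apply_initial_segment: "l \<le> j \<Longrightarrow> apply_bcontfun (initial_segment j \<xi>) l = \<xi> l"
proof -
  assume "l \<le> j"
  have "apply_bcontfun (initial_segment j \<xi>) l = (\<Sum>i\<le>j. apply_bcontfun (single i (\<xi> i)) l)"
    unfolding initial_segment_def
    by (rule linear_sum[OF bounded_linear.linear[OF bounded_linear_apply_bcontfun]])
  also have "\<dots> = \<xi> l" using \<open>l \<le> j\<close> by (simp add: apply_single)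
  finally show ?thesis .
qed

lemma linear_local_component:
  assumes "smooth_on \<Omega> G" "\<xi> 0 \<in> \<Omega>"
  shows "linear (local_component G j \<xi>)"
proof -
  have "linear (\<lambda>y. comp_map G j (initial_segment j \<xi>, y))"
    by (rule linear_comp_map[OF assms(1)]) (simp add: apply_initial_segment assms(2))
  moreover have "(\<lambda>y. comp_map G j (initial_segment j \<xi>, y)) = local_component G j \<xi>"
    unfolding comp_map_def fst_conv snd_conv by (intro ext local_component_cong apply_initial_segment)
  ultimately show ?thesis by simp
qed

text \<open>On each line \<open>y + s w\<close> the map L is affine in s with slope L w, while the
  chain rule gives the slope L' w.\<close>

lemma has_derivative_linear_unique:
  assumes "linear L" "(L has_derivative L') (at y)"
  shows "L' = L"
proof
  fix w
  have "((\<lambda>s. y + s *\<^sub>R w) has_derivative (\<lambda>s. s *\<^sub>R w)) (at 0)"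
    by (auto intro!: derivative_eq_intros)
  then have "((\<lambda>s. L (y + s *\<^sub>R w)) has_derivative (\<lambda>s. L' (s *\<^sub>R w))) (at 0)"
    by (rule has_derivative_compose) (simp add: assms(2))
  moreover have "L' (s *\<^sub>R w) = s *\<^sub>R L' w" for s
    by (rule linear_scale[OF bounded_linear.linear[OF has_derivative_bounded_linear[OF assms(2)]]])
  moreover have "L (y + s *\<^sub>R w) = L y + s *\<^sub>R L w" for s
    by (simp add: linear_add[OF assms(1)] linear_scale[OF assms(1)])
  ultimately have "((\<lambda>s. L y + s *\<^sub>R L w) has_vector_derivative L' w) (at 0)"
    by (simp add: has_vector_derivative_def)
  moreover have "((\<lambda>s. L y + s *\<^sub>R L w) has_vector_derivative L w) (at 0)"
    by (auto simp: has_vector_derivative_def intro!: derivative_eq_intros)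
  ultimately show "L' w = L w" by (rule vector_derivative_unique_at)
qed

lemma fderiv_comp_map_snd:
  assumes G: "smooth_on \<Omega> G" and b: "apply_bcontfun b 0 \<in> \<Omega>"
  shows "fderiv (comp_map G j) (b, y) (0, w) = comp_map G j (b, w)"
proof -
  have "((\<lambda>y. (b, y)) has_derivative (\<lambda>w. (0, w))) (at y)"
    by (intro has_derivative_Pair has_derivative_ident has_derivative_const)
  then have "((\<lambda>y. comp_map G j (b, y)) has_derivative (\<lambda>w. fderiv (comp_map G j) (b, y) (0, w))) (at y)"
    by (rule has_derivative_compose)
      (rule smooth_on_has_fderiv[OF smooth_on_comp_map[OF G]], use b in \<open>simp add: comp_dom_def\<close>)
  from has_derivative_linear_unique[OF linear_comp_map[OF G b] this] show ?thesis by (rule fun_cong)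
qed

text \<open>The Taylor coefficients move along the shift, so the derivative in time contains the
  differential that occurs in \<open>local_component_Suc\<close>. Solving the recursion for it gives
  the first two terms; linearity in V gives the third.\<close>

lemma local_component_along_curve:
  assumes G: "smooth_on \<Omega> G" and f: "smooth_on S f" "f ` S \<subseteq> \<Omega>" "t \<in> S"
    and V: "(V has_vector_derivative V') (at t)"
  shows "((\<lambda>t. local_component G j (taylor f t) (V t)) has_vector_derivative
    (real (Suc j) *\<^sub>R local_component G (Suc j) (taylor f t) (V t)
      - G (f t) (vector_derivative f (at t)) (local_component G j (taylor f t) (V t))
      + local_component G j (taylor f t) V')) (at t)"
proof (cases j)
  case 0
  \<comment> \<open>At j = 0 the component is the identity and the next one is \<Gamma>, so the
    first two terms cancel.\<close>
  then show ?thesis using V by (simp add: taylor_0 taylor_1[simplified])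
next
  case (Suc n)
  let ?b = "\<lambda>t. initial_segment (Suc n) (taylor f t)"
  let ?X = "\<Sum>l\<le>Suc n. single l (real (Suc l) *\<^sub>R taylor f t (Suc l))"
  let ?F = "comp_map G (Suc n)"
  have ft: "f t \<in> \<Omega>" using f by blast
  have b0: "apply_bcontfun (?b t) 0 \<in> \<Omega>" using ft by (simp add: apply_initial_segment taylor_0)
  have "((\<lambda>t. taylor f t l) has_vector_derivative (real (Suc l) *\<^sub>R taylor f t (Suc l))) (at t)" for l
  proof -
    have "((\<lambda>t. taylor f t l) has_vector_derivative (1 / fact l) *\<^sub>R nth_vderiv (Suc l) f t) (at t)"
      unfolding taylor_def by (rule bounded_linear.has_vector_derivative[OF bounded_linear_scaleR_right nth_vderiv_has_vector_derivative[OF f(1,3)]])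
    moreover have "(1 / fact l) *\<^sub>R nth_vderiv (Suc l) f t = real (Suc l) *\<^sub>R taylor f t (Suc l)"
      by (simp add: taylor_def del: of_nat_Suc)
    ultimately show ?thesis by (simp only:)
  qed
  then have "(?b has_vector_derivative ?X) (at t)"
    unfolding initial_segment_def
    by (intro has_vector_derivative_sum bounded_linear.has_vector_derivative[OF bounded_linear_single])
  then have "((\<lambda>t. (?b t, V t)) has_derivative (\<lambda>s. s *\<^sub>R (?X, V'))) (at t)"
    using has_vector_derivative_Pair[OF _ V] by (simp add: has_vector_derivative_def)
  from has_derivative_compose[OF this smooth_on_has_fderiv[OF smooth_on_comp_map[OF G]]] b0
  have "((\<lambda>t. ?F (?b t, V t)) has_derivative (\<lambda>s. fderiv ?F (?b t, V t) (s *\<^sub>R (?X, V')))) (at t)"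
    by (simp add: comp_dom_def)
  then have "((\<lambda>t. ?F (?b t, V t)) has_vector_derivative fderiv ?F (?b t, V t) (?X, V')) (at t)"
    unfolding has_vector_derivative_def blinfun.scaleR_right .
  moreover have "(\<lambda>t. ?F (?b t, V t)) = (\<lambda>t. local_component G (Suc n) (taylor f t) (V t))"
    unfolding comp_map_def fst_conv snd_conv by (intro ext local_component_cong apply_initial_segment)
  moreover have "fderiv ?F (?b t, V t) (?X, V') =
    real (Suc (Suc n)) *\<^sub>R local_component G (Suc (Suc n)) (taylor f t) (V t)
      - G (f t) (vector_derivative f (at t)) (local_component G (Suc n) (taylor f t) (V t))
      + local_component G (Suc n) (taylor f t) V'"
  proof -
    have "fderiv ?F (?b t, V t) (?X, V') =
      fderiv ?F (?b t, V t) (?X, 0) + fderiv ?F (?b t, V t) (0, V')"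
      by (simp flip: blinfun.add_right)
    also have "fderiv ?F (?b t, V t) (0, V') = local_component G (Suc n) (taylor f t) V'"
      unfolding fderiv_comp_map_snd[OF G b0] comp_map_def fst_conv snd_conv
      by (intro local_component_cong apply_initial_segment)
    finally show ?thesis
      using local_component_Suc[where \<xi>="taylor f t" and b="?b t" and y="V t", OF smooth_on_comp_map[OF G], of n] ft
      by (simp add: taylor_0 taylor_1[simplified] apply_initial_segment del: of_nat_Suc local_component.simps)
  qed
  ultimately show ?thesis by (simp only: Suc)
qed

text \<open>\<open>iterated_nabla G f V k\<close> is \<open>1/k!\<close> times the \<open>k\<close>-th covariant derivative along \<open>f\<close> of the
  vector field \<open>V\<close>, see \<open>iterated_nabla_has_vector_derivative\<close>.\<close>

definition iterated_nabla ::
  "('e::banach \<Rightarrow> 'e \<Rightarrow>\<^sub>L 'e \<Rightarrow>\<^sub>L 'e) \<Rightarrow> (real \<Rightarrow> 'e) \<Rightarrow> (real \<Rightarrow> 'e) \<Rightarrow> nat \<Rightarrow> real \<Rightarrow> 'e" where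
  "iterated_nabla G f V k t =
    (\<Sum>j\<le>k. local_component G j (taylor f t) ((1 / fact (k - j)) *\<^sub>R nth_vderiv (k - j) V t))"

text \<open>The bookkeeping of Leibniz' rule: k + 1 = j + (k + 1 - j) splits each coefficient on the
  right into a part from the shifted sum and a part from the other sum. The vector
  \<open>A j\<close> will be M^j applied to the derivative of V of order k + 1 - j.\<close>

lemma iterated_nabla_coeffs:
  fixes A :: "nat \<Rightarrow> 'a::real_vector"
  shows "(\<Sum>j\<le>k. (real (Suc j) / fact (k - j)) *\<^sub>R A (Suc j)) + (\<Sum>j\<le>k. (1 / fact (k - j)) *\<^sub>R A j) =
    real (Suc k) *\<^sub>R (\<Sum>j\<le>Suc k. (1 / fact (Suc k - j)) *\<^sub>R A j)"
proof -
  have "(\<Sum>j\<le>k. (real (Suc j) / fact (k - j)) *\<^sub>R A (Suc j)) = (\<Sum>j\<le>Suc k. (real j / fact (Suc k - j)) *\<^sub>R A j)"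
    by (subst sum.atMost_Suc_shift) simp
  moreover have "(\<Sum>j\<le>k. (1 / fact (k - j)) *\<^sub>R A j) = (\<Sum>j\<le>Suc k. (real (Suc k - j) / fact (Suc k - j)) *\<^sub>R A j)"
  proof -
    have "1 / fact (k - j) = real (Suc k - j) / (fact (Suc k - j) :: real)" if "j \<le> k" for j
      using that by (simp add: Suc_diff_le del: of_nat_Suc)
    then show ?thesis by simp
  qed
  moreover have "(real j / fact (Suc k - j)) *\<^sub>R A j + (real (Suc k - j) / fact (Suc k - j)) *\<^sub>R A j
    = real (Suc k) *\<^sub>R ((1 / fact (Suc k - j)) *\<^sub>R A j)" if "j \<le> Suc k" for j
  proof -
    have "real j / fact (Suc k - j) + real (Suc k - j) / fact (Suc k - j) = real (Suc k) * (1 / fact (Suc k - j))"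
      using that by (simp add: of_nat_diff flip: add_divide_distrib)
    then show ?thesis by (metis scaleR_left_distrib scaleR_scaleR)
  qed
  ultimately show ?thesis
    unfolding scaleR_sum_right by (simp only: sum.distrib[symmetric]) (intro sum.cong, auto)
qed

text \<open>In other words \<open>\<nabla>W_k = (k + 1) W_(k+1)\<close> for the k-th field W_k.
  \<open>local_component_along_curve\<close> is applied to each summand; its terms in \<Gamma>
  reassemble to \<Gamma> applied to W_k.\<close>

lemma iterated_nabla_has_vector_derivative:
  assumes G: "smooth_on \<Omega> G" and f: "smooth_on S f" "f ` S \<subseteq> \<Omega>" "t \<in> S" and V: "smooth_on S V"
  shows "(iterated_nabla G f V k has_vector_derivative
    (real (Suc k) *\<^sub>R iterated_nabla G f V (Suc k) t
      - G (f t) (vector_derivative f (at t)) (iterated_nabla G f V k t))) (at t)"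
proof -
  let ?L = "\<lambda>j. local_component G j (taylor f t)"
  let ?V = "\<lambda>j t. (1 / fact (k - j)) *\<^sub>R nth_vderiv (k - j) V t"
  let ?V' = "\<lambda>j. (1 / fact (k - j)) *\<^sub>R nth_vderiv (Suc (k - j)) V t"
  define A where "A = (\<lambda>j. ?L j (nth_vderiv (Suc k - j) V t))"
  have L: "linear (?L j)" for j
    by (rule linear_local_component[OF G]) (use f in \<open>auto simp: taylor_0\<close>)
  have "((\<lambda>t. \<Sum>j\<le>k. local_component G j (taylor f t) (?V j t)) has_vector_derivative
    (\<Sum>j\<le>k. real (Suc j) *\<^sub>R ?L (Suc j) (?V j t) - G (f t) (vector_derivative f (at t)) (?L j (?V j t)) + ?L j (?V' j))) (at t)"
    by (intro has_vector_derivative_sum local_component_along_curve[OF G f]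
        bounded_linear.has_vector_derivative[OF bounded_linear_scaleR_right] nth_vderiv_has_vector_derivative[OF V f(3)])
  moreover have "(\<Sum>j\<le>k. real (Suc j) *\<^sub>R ?L (Suc j) (?V j t) - G (f t) (vector_derivative f (at t)) (?L j (?V j t)) + ?L j (?V' j))
    = ((\<Sum>j\<le>k. (real (Suc j) / fact (k - j)) *\<^sub>R A (Suc j)) + (\<Sum>j\<le>k. (1 / fact (k - j)) *\<^sub>R A j))
      - G (f t) (vector_derivative f (at t)) (iterated_nabla G f V k t)"
  proof -
    have "real (Suc j) *\<^sub>R ?L (Suc j) (?V j t) = (real (Suc j) / fact (k - j)) *\<^sub>R A (Suc j)" for j
      unfolding A_def by (simp add: linear_scale[OF L])
    moreover have "?L j (?V' j) = (1 / fact (k - j)) *\<^sub>R A j" if "j \<le> k" for j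
      unfolding A_def using that by (simp add: linear_scale[OF L] Suc_diff_le)
    ultimately show ?thesis
      unfolding iterated_nabla_def blinfun.sum_right by (simp add: sum.distrib sum_subtractf)
  qed
  moreover have "(\<Sum>j\<le>Suc k. (1 / fact (Suc k - j)) *\<^sub>R A j) = iterated_nabla G f V (Suc k) t"
    unfolding A_def iterated_nabla_def linear_scale[OF L] ..
  ultimately show ?thesis
    unfolding iterated_nabla_coeffs by (simp add: iterated_nabla_def[abs_def])
qed

text \<open>For k = 0 this is the chain rule for f'. In the step the identity for k is
  differentiated in time, and relatedness absorbs the derivative of dh along f.\<close>

lemma iterated_nabla_related:
  fixes GM :: "'e::banach \<Rightarrow> 'e \<Rightarrow>\<^sub>L 'e \<Rightarrow>\<^sub>L 'e" and GN :: "'f::banach \<Rightarrow> 'f \<Rightarrow>\<^sub>L 'f \<Rightarrow>\<^sub>L 'f"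
  assumes GM: "smooth_on \<Omega> GM" and GN: "smooth_on \<Omega>' GN"
    and h: "smooth_on T h" "T \<subseteq> \<Omega>" "h ` T \<subseteq> \<Omega>'"
    and rel: "\<And>x \<xi> y. x \<in> T \<Longrightarrow> fderiv h x (GM x \<xi> y) =
      fderiv (fderiv h) x \<xi> y
      + GN (h x) (fderiv h x \<xi>) (fderiv h x y)"
    and f: "smooth_on S f" "f ` S \<subseteq> T" and "t \<in> S"
  shows "iterated_nabla GN (\<lambda>t. h (f t)) (\<lambda>t. vector_derivative (\<lambda>t. h (f t)) (at t)) k t
    = fderiv h (f t) (iterated_nabla GM f (\<lambda>t. vector_derivative f (at t)) k t)"
  using \<open>t \<in> S\<close>
proof (induction k arbitrary: t)
  case 0
  then show ?case
    using vector_derivative_compose[OF f(1) 0 h(1)] f(2) by (auto simp: iterated_nabla_def)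
next
  case (Suc k)
  let ?hf = "\<lambda>t. h (f t)" and ?f' = "vector_derivative f (at t)"
  let ?W = "iterated_nabla GM f (\<lambda>t. vector_derivative f (at t))"
  let ?W' = "iterated_nabla GN ?hf (\<lambda>t. vector_derivative ?hf (at t))"
  have hf: "smooth_on S ?hf" by (rule smooth_on_compose[OF f(1) h(1) f(2)])
  have ft: "f t \<in> T" using f(2) Suc.prems by blast
  have W: "(?W k has_vector_derivative (real (Suc k) *\<^sub>R ?W (Suc k) t - GM (f t) ?f' (?W k t))) (at t)"
    by (rule iterated_nabla_has_vector_derivative[OF GM f(1) _ Suc.prems smooth_on_vector_derivative[OF f(1)]])
      (use f(2) h(2) in blast)
  have W': "(?W' k has_vector_derivative (real (Suc k) *\<^sub>R ?W' (Suc k) t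
      - GN (h (f t)) (vector_derivative ?hf (at t)) (?W' k t))) (at t)"
    by (rule iterated_nabla_has_vector_derivative[OF GN hf _ Suc.prems smooth_on_vector_derivative[OF hf]])
      (use f(2) h(3) in blast)
  have df: "(f has_derivative (\<lambda>s. s *\<^sub>R ?f')) (at t)"
    using smooth_on_has_vector_derivative[OF f(1) Suc.prems] by (simp add: has_vector_derivative_def)
  have "((\<lambda>t. fderiv h (f t)) has_vector_derivative fderiv (fderiv h) (f t) ?f') (at t)"
    using has_derivative_compose[OF df smooth_on_has_fderiv[OF smooth_on_fderiv[OF h(1)] ft]]
    by (simp add: has_vector_derivative_def blinfun.scaleR_right)
  from bounded_bilinear.has_vector_derivative[OF bounded_bilinear_blinfun_apply this W]
  have "((\<lambda>t. fderiv h (f t) (?W k t)) has_vector_derivative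
    (fderiv h (f t) (real (Suc k) *\<^sub>R ?W (Suc k) t - GM (f t) ?f' (?W k t))
      + fderiv (fderiv h) (f t) ?f' (?W k t))) (at t)" .
  \<comment> \<open>The induction hypothesis holds at all times in the open set S, so both sides
    have the same derivative at t.\<close>
  then have "(?W' k has_vector_derivative
    (fderiv h (f t) (real (Suc k) *\<^sub>R ?W (Suc k) t - GM (f t) ?f' (?W k t))
      + fderiv (fderiv h) (f t) ?f' (?W k t))) (at t)"
    by (rule has_vector_derivative_transform_within_open[OF _ smooth_on_open[OF f(1)] Suc.prems])
      (rule Suc.IH[symmetric])
  from vector_derivative_unique_at[OF W' this]
  have "real (Suc k) *\<^sub>R ?W' (Suc k) t - GN (h (f t)) (vector_derivative ?hf (at t)) (?W' k t) =
    fderiv h (f t) (real (Suc k) *\<^sub>R ?W (Suc k) t - GM (f t) ?f' (?W k t))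
      + fderiv (fderiv h) (f t) ?f' (?W k t)" .
  \<comment> \<open>Taking f' for \<xi> and the k-th field for y, \<open>rel\<close> trades the
    second derivative for the difference of the two connection terms, and these cancel.\<close>
  then have "real (Suc k) *\<^sub>R ?W' (Suc k) t = real (Suc k) *\<^sub>R fderiv h (f t) (?W (Suc k) t)"
    using rel[OF ft, of ?f' "?W k t"] Suc.IH[OF Suc.prems] vector_derivative_compose[OF f(1) Suc.prems h(1) ft]
    by (simp add: blinfun.diff_right blinfun.scaleR_right algebra_simps del: of_nat_Suc)
  then show ?case by (simp del: of_nat_Suc)
qed

section \<open>The fibre coordinates\<close>

text \<open>The separate first term of z^i is the summand j = 0, where the component is the
  identity; with f' as the field, all orders of differentiation drop by one.\<close>

lemma z_coord_eq_iterated_nabla: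
  assumes "i \<ge> 1"
  shows "z_coord G f i = (1 / real i) *\<^sub>R iterated_nabla G f (\<lambda>t. vector_derivative f (at t)) (i - 1) 0"
proof -
  obtain k where i: "i = Suc k" using assms by (cases i) auto
  have t: "(\<lambda>l. (1 / fact l) *\<^sub>R nth_vderiv l f 0) = taylor f 0" by (rule ext) (simp add: taylor_def)
  have "(\<Sum>j = 1..k. local_component G j (taylor f 0) ((1 / fact (Suc k - j - 1)) *\<^sub>R nth_vderiv (Suc k - j) f 0))
    = (\<Sum>j = Suc 0..k. local_component G j (taylor f 0)
        ((1 / fact (k - j)) *\<^sub>R nth_vderiv (k - j) (\<lambda>t. vector_derivative f (at t)) 0))"
    by (rule sum.cong) (auto simp: Suc_diff_le simp flip: nth_vderiv_Suc')
  then show ?thesis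
    unfolding z_coord_def t i iterated_nabla_def
    by (simp add: atMost_atLeast0 sum.atLeast_Suc_atMost nth_vderiv_Suc')
qed

lemma z_coord_related:
  fixes GM :: "'e::banach \<Rightarrow> 'e \<Rightarrow>\<^sub>L 'e \<Rightarrow>\<^sub>L 'e" and GN :: "'f::banach \<Rightarrow> 'f \<Rightarrow>\<^sub>L 'f \<Rightarrow>\<^sub>L 'f"
  assumes "smooth_on \<Omega> GM" "smooth_on \<Omega>' GN" "smooth_on T h" "T \<subseteq> \<Omega>" "h ` T \<subseteq> \<Omega>'"
    and "\<And>x \<xi> y. x \<in> T \<Longrightarrow> fderiv h x (GM x \<xi> y) =
      fderiv (fderiv h) x \<xi> y
      + GN (h x) (fderiv h x \<xi>) (fderiv h x y)"
    and "smooth_on S f" "f ` S \<subseteq> T" "0 \<in> S" "i \<ge> 1"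
  shows "z_coord GN (\<lambda>t. h (f t)) i = fderiv h (f 0) (z_coord GM f i)"
  unfolding z_coord_eq_iterated_nabla[OF assms(10)] blinfun.scaleR_right
  by (rule arg_cong[OF iterated_nabla_related[OF assms(1-9)]])

text \<open>The part of z^i that involves derivatives of order below i. Splitting it off exhibits
  z^i as triangular in the derivatives, with an invertible leading coefficient.\<close>

definition z_tail :: "('e::banach \<Rightarrow> 'e \<Rightarrow>\<^sub>L 'e \<Rightarrow>\<^sub>L 'e) \<Rightarrow> (nat \<Rightarrow> 'e) \<Rightarrow> nat \<Rightarrow> 'e" where
  "z_tail G d i = (\<Sum>j = 1..i - 1. local_component G j (\<lambda>l. (1 / fact l) *\<^sub>R d l)
         ((1 / fact (i - j - 1)) *\<^sub>R d (i - j)))"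

lemma z_coord_z_tail:
  "z_coord G f i = (1 / real i) *\<^sub>R
     ((1 / fact (i - 1)) *\<^sub>R nth_vderiv i f 0 + z_tail G (\<lambda>l. nth_vderiv l f 0) i)"
  by (simp add: z_coord_def z_tail_def)

lemma z_tail_cong:
  assumes "\<And>l. l < i \<Longrightarrow> d l = d' l"
  shows "z_tail G d i = z_tail G d' i"
proof -
  have "local_component G j (\<lambda>l. (1 / fact l) *\<^sub>R d l) y = local_component G j (\<lambda>l. (1 / fact l) *\<^sub>R d' l) y"
    if "j \<in> {1..i - 1}" for j y
    by (rule local_component_cong) (use that assms in auto)
  moreover have "d (i - j) = d' (i - j)" if "j \<in> {1..i - 1}" for j using that by (intro assms) auto
  ultimately show ?thesis unfolding z_tail_def by (intro sum.cong) auto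
qed

lemma z_coord_cong:
  assumes "\<And>l. l \<le> i \<Longrightarrow> nth_vderiv l f 0 = nth_vderiv l f' 0"
  shows "z_coord G f i = z_coord G f' i"
  unfolding z_coord_z_tail using assms z_tail_cong[of i "\<lambda>l. nth_vderiv l f 0" "\<lambda>l. nth_vderiv l f' 0"] by simp

text \<open>Solves the triangular system. Stage k holds the derivatives up to order k; the next
  stage leaves them alone and solves z^(k+1) = \<open>v (Suc k)\<close> for the derivative of order
  k + 1.\<close>

primrec derivs_of_coords ::
  "('e::banach \<Rightarrow> 'e \<Rightarrow>\<^sub>L 'e \<Rightarrow>\<^sub>L 'e) \<Rightarrow> 'e \<Rightarrow> (nat \<Rightarrow> 'e) \<Rightarrow> nat \<Rightarrow> nat \<Rightarrow> 'e" where
  "derivs_of_coords G x v 0 = (\<lambda>_. x)"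
| "derivs_of_coords G x v (Suc k) = (derivs_of_coords G x v k)
     (Suc k := fact k *\<^sub>R (real (Suc k) *\<^sub>R v (Suc k) - z_tail G (derivs_of_coords G x v k) (Suc k)))"

lemma derivs_with_coords:
  fixes G :: "'e::banach \<Rightarrow> 'e \<Rightarrow>\<^sub>L 'e \<Rightarrow>\<^sub>L 'e"
  obtains a where "a 0 = x"
    "\<And>i f. 1 \<le> i \<Longrightarrow> (\<And>l. l \<le> i \<Longrightarrow> nth_vderiv l f 0 = a l) \<Longrightarrow> z_coord G f i = v i"
proof -
  let ?A = "derivs_of_coords G x v"
  define a where "a = (\<lambda>i. ?A i i)"
  have stable: "?A k l = a l" if "l \<le> k" for k l
    using that by (induction k) (auto simp: a_def le_Suc_eq)
  have "z_coord G f i = v i" if i: "1 \<le> i" and f: "\<And>l. l \<le> i \<Longrightarrow> nth_vderiv l f 0 = a l" for i f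
  proof -
    obtain k where k: "i = Suc k" using i by (cases i) auto
    have "z_tail G (\<lambda>l. nth_vderiv l f 0) i = z_tail G (?A k) i"
      by (rule z_tail_cong) (use f stable k in auto)
    moreover have "nth_vderiv i f 0 = fact k *\<^sub>R (real (Suc k) *\<^sub>R v (Suc k) - z_tail G (?A k) (Suc k))"
      using f[of i] by (simp add: a_def k)
    ultimately show ?thesis unfolding z_coord_z_tail by (simp add: k del: of_nat_Suc)
  qed
  then show ?thesis using that[of a] by (simp add: a_def)
qed

section \<open>Operators on the model fibres\<close>

lemma tuple_cong: "(\<And>i. 1 \<le> i \<Longrightarrow> i \<le> k \<Longrightarrow> z i = z' i) \<Longrightarrow> tuple k z = tuple k z'"
  unfolding tuple_def by (intro arg_cong[where f=Bcontfun] ext) auto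

lemma apply_trunc: "apply_bcontfun (trunc i v) = (\<lambda>l. if l \<in> {1..i} then apply_bcontfun v l else 0)"
  by (simp add: trunc_def apply_tuple)

lemma norm_tuple_le:
  assumes "0 \<le> C" "\<And>i. 1 \<le> i \<Longrightarrow> i \<le> k \<Longrightarrow> norm (z i) \<le> C"
  shows "norm (tuple k z) \<le> C"
  by (rule norm_bound) (use assms in \<open>auto simp: apply_tuple\<close>)

text \<open>The operator A in each of the first k factors. Since \<open>tuple k\<close> discards the
  other entries, the precomposition with \<open>trunc k\<close> demanded by
  \<open>power_operators\<close> is built in.\<close>

definition diag :: "nat \<Rightarrow> ('e::banach \<Rightarrow>\<^sub>L 'f::banach) \<Rightarrow> 'e bseq \<Rightarrow>\<^sub>L 'f bseq" where
  "diag k A = Blinfun (\<lambda>v. tuple k (\<lambda>i. blinfun_apply A (apply_bcontfun v i)))"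

lemma norm_tuple_blinfun_le:
  "norm (tuple k (\<lambda>i. blinfun_apply A (apply_bcontfun v i))) \<le> norm A * norm v"
proof (rule norm_tuple_le)
  fix i
  have "norm (blinfun_apply A (apply_bcontfun v i)) \<le> norm A * norm (apply_bcontfun v i)" by (rule norm_blinfun)
  also have "\<dots> \<le> norm A * norm v" by (intro mult_left_mono norm_bounded) simp
  finally show "norm (blinfun_apply A (apply_bcontfun v i)) \<le> norm A * norm v" .
qed simp

lemma diag_apply:
  "diag k A v = tuple k (\<lambda>i. blinfun_apply A (apply_bcontfun v i))"
proof -
  have "bounded_linear (\<lambda>v. tuple k (\<lambda>i. blinfun_apply A (apply_bcontfun v i)))"
  proof (rule bounded_linear_intro[of _ "norm A"])
    show "norm (tuple k (\<lambda>i. blinfun_apply A (apply_bcontfun v i))) \<le> norm v * norm A" for v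
      using norm_tuple_blinfun_le by (metis mult.commute)
  qed (auto intro!: bcontfun_eqI simp: apply_tuple blinfun.add_right blinfun.scaleR_right)
  then show ?thesis by (simp add: diag_def bounded_linear_Blinfun_apply)
qed

lemma norm_diag_le: "norm (diag k A) \<le> norm A"
  by (rule norm_blinfun_bound) (simp_all add: diag_apply norm_tuple_blinfun_le)

text \<open>Reduces smoothness of each component into H^k to smoothness of the differential of the
  local representative.\<close>

lemma bounded_linear_tuple_diag: "bounded_linear (\<lambda>A. tuple k (\<lambda>i. diag i A))"
proof (rule bounded_linear_intro[of _ 1])
  show "norm (tuple k (\<lambda>i. diag i A)) \<le> norm A * 1" for A :: "'a \<Rightarrow>\<^sub>L 'b"
    using norm_diag_le by (intro norm_tuple_le) auto
qed (auto intro!: bcontfun_eqI blinfun_eqI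
    simp: apply_tuple diag_apply blinfun.add_left blinfun.scaleR_left)

lemma diag_H_space: "(\<lambda>k. diag k A) \<in> H_space"
  unfolding H_space_def power_operators_def power_space_def
  by (auto simp: diag_apply apply_tuple apply_trunc blinfun.zero_right intro!: bcontfun_eqI)

lemma model_fibre_apply:
  assumes "v \<in> model_fibre" "1 \<le> i" "i \<le> k"
  shows "apply_bcontfun (v k) i = apply_bcontfun (v i) i"
proof -
  have "trunc i (v k) = v i" using assms by (auto simp: model_fibre_def)
  then show ?thesis using assms apply_trunc[of i "v k"] by (metis atLeastAtMost_iff order_refl)
qed

text \<open>A thread amounts to one sequence of vectors, its diagonal entries. That sequence may be
  unbounded, so \<open>bseq\<close> holds its finite sections only.\<close>

lemma model_fibreE:
  assumes "v \<in> model_fibre"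
  shows "v k = tuple k (\<lambda>i. apply_bcontfun (v i) i)"
proof (rule bcontfun_eqI)
  fix i
  show "apply_bcontfun (v k) i = apply_bcontfun (tuple k (\<lambda>i. apply_bcontfun (v i) i)) i"
  proof (cases "i \<in> {1..k}")
    case True
    then show ?thesis using model_fibre_apply[OF assms, of i k] by (simp add: apply_tuple)
  next
    case False
    then have "apply_bcontfun (v k) i = 0" using assms by (auto simp: model_fibre_def power_space_def)
    then show ?thesis using False by (auto simp: apply_tuple)
  qed
qed

lemma model_fibreI: "(\<lambda>k. tuple k z) \<in> model_fibre"
  unfolding model_fibre_def power_space_def
  by (auto simp: apply_tuple apply_trunc intro!: bcontfun_eqI)

lemma H_limit_diag_tuple:
  "H_limit (\<lambda>k. diag k A) (\<lambda>k. tuple k z) = (\<lambda>k. tuple k (\<lambda>i. blinfun_apply A (z i)))"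
  unfolding H_limit_def diag_apply by (intro ext tuple_cong) (simp add: apply_tuple)

lemma trunc_add: "trunc i (v + w) = trunc i v + trunc i w"
  and trunc_scaleR: "trunc i (a *\<^sub>R v) = a *\<^sub>R trunc i v"
  by (auto intro!: bcontfun_eqI simp: apply_trunc)

lemma model_fibre_add: "v \<in> model_fibre \<Longrightarrow> w \<in> model_fibre \<Longrightarrow> (\<lambda>k. v k + w k) \<in> model_fibre"
  unfolding model_fibre_def power_space_def by (auto simp: trunc_add)

lemma model_fibre_scaleR: "v \<in> model_fibre \<Longrightarrow> (\<lambda>k. a *\<^sub>R v k) \<in> model_fibre"
  unfolding model_fibre_def power_space_def by (auto simp: trunc_scaleR)

lemma H_limit_diag_model_fibre:
  assumes "v \<in> model_fibre"
  shows "H_limit (\<lambda>k. diag k A) v \<in> model_fibre"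
proof -
  have "v = (\<lambda>k. tuple k (\<lambda>i. apply_bcontfun (v i) i))" by (rule ext) (rule model_fibreE[OF assms])
  then have "H_limit (\<lambda>k. diag k A) v = H_limit (\<lambda>k. diag k A) (\<lambda>k. tuple k (\<lambda>i. apply_bcontfun (v i) i))"
    by (rule arg_cong)
  then show ?thesis by (simp only: H_limit_diag_tuple model_fibreI)
qed

text \<open>T is compared with the diagonal operator on \<open>model_fibre\<close> only, because a
  local representative contains \<open>inv_into\<close> and is arbitrary elsewhere.\<close>

lemma continuous_linear_fibre_diag:
  assumes "\<And>v. v \<in> model_fibre \<Longrightarrow> T v = H_limit (\<lambda>k. diag k A) v"
  shows "continuous_linear_fibre T"
  unfolding continuous_linear_fibre_def
proof (intro conjI ballI allI)
  show "T \<in> model_fibre \<rightarrow> model_fibre" using assms H_limit_diag_model_fibre by auto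
  show "T (\<lambda>k. v k + w k) = (\<lambda>k. T v k + T w k)" if "v \<in> model_fibre" "w \<in> model_fibre" for v w
    using that by (simp add: assms model_fibre_add H_limit_def blinfun.add_right)
  show "T (\<lambda>k. a *\<^sub>R v k) = (\<lambda>k. a *\<^sub>R T v k)" if "v \<in> model_fibre" for a v
    using that by (simp add: assms model_fibre_scaleR H_limit_def blinfun.scaleR_right)
  have "continuous_on model_fibre (H_limit (\<lambda>k. diag k A))"
  proof (rule continuous_on_coordinatewise_then_product)
    fix k
    show "continuous_on model_fibre (\<lambda>v. H_limit (\<lambda>k. diag k A) v k)"
      unfolding H_limit_def
      by (intro blinfun.continuous_on continuous_on_const continuous_on_subset[OF continuous_on_product_coordinates]) simp
  qed
  then show "continuous_on model_fibre T" using assms by (simp cong: continuous_on_cong)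
qed

section \<open>The induced bundle\<close>

lemma Phi_jet_of:
  assumes "smooth_atlas A" "smooth_curve A \<gamma>" "(U, \<phi>) \<in> charts A" "\<gamma> 0 \<in> U"
  shows "snd (Phi \<Gamma> (U, \<phi>) k (jet_of A k \<gamma>)) = tuple k (z_coord (\<Gamma> (U, \<phi>)) (\<phi> \<circ> \<gamma>))"
proof -
  have "the_elem ((\<lambda>\<gamma>. (\<phi> (\<gamma> 0), tuple k (z_coord (\<Gamma> (U, \<phi>)) (\<phi> \<circ> \<gamma>)))) ` jet_of A k \<gamma>)
    = (\<phi> (\<gamma> 0), tuple k (z_coord (\<Gamma> (U, \<phi>)) (\<phi> \<circ> \<gamma>)))"
  proof (rule the_elem_jet[OF assms(1,2)])
    fix \<delta> assume d: "smooth_curve A \<delta>" "k_equivalent A k \<gamma> \<delta>"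
    have eq: "\<delta> 0 = \<gamma> 0" "\<And>i. i \<le> k \<Longrightarrow> nth_vderiv i (\<phi> \<circ> \<gamma>) 0 = nth_vderiv i (\<phi> \<circ> \<delta>) 0"
      using k_equivalent_iff[OF assms(1,2) d(1) assms(3,4)] d(2) by auto
    have "tuple k (z_coord (\<Gamma> (U, \<phi>)) (\<phi> \<circ> \<delta>)) = tuple k (z_coord (\<Gamma> (U, \<phi>)) (\<phi> \<circ> \<gamma>))"
      by (intro tuple_cong z_coord_cong) (use eq(2) in auto)
    then show "(\<phi> (\<delta> 0), tuple k (z_coord (\<Gamma> (U, \<phi>)) (\<phi> \<circ> \<delta>))) = (\<phi> (\<gamma> 0), tuple k (z_coord (\<Gamma> (U, \<phi>)) (\<phi> \<circ> \<gamma>)))"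
      using eq(1) by simp
  qed
  then show ?thesis by (simp add: Phi_def)
qed

text \<open>One representing curve for each order. They share the base point because every u k
  projects to u 0.\<close>

lemma TinfE:
  assumes A: "smooth_atlas A" and u: "u \<in> Tinf A"
  obtains \<gamma> where "\<And>k. smooth_curve A (\<gamma> k)" "\<And>k. u k = jet_of A k (\<gamma> k)" "\<And>k. \<gamma> k 0 = Tinf_proj u"
proof -
  have "\<forall>k. \<exists>\<gamma>. smooth_curve A \<gamma> \<and> u k = jet_of A k \<gamma>"
    using u unfolding Tinf_def Tk_def by blast
  then obtain \<gamma> where g: "\<And>k. smooth_curve A (\<gamma> k)" "\<And>k. u k = jet_of A k (\<gamma> k)" by metis
  have "\<gamma> k 0 = Tinf_proj u" for k
  proof -
    have "u 0 = jet_of A 0 (\<gamma> k)"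
      using u jet_proj_jet_of[OF A g(1), of 0 k k] by (auto simp: Tinf_def g(2)[of k, symmetric])
    then show ?thesis using base_point_jet_of[OF A g(1)] by (simp add: Tinf_proj_def)
  qed
  then show ?thesis using that g by blast
qed

lemma Tinf_map_in_Tinf:
  assumes "smooth_atlas A" "smooth_atlas B" "smooth_map A B g" "u \<in> Tinf A"
  shows "Tinf_map B g u \<in> Tinf B" and "Tinf_proj (Tinf_map B g u) = g (Tinf_proj u)"
proof -
  obtain \<gamma> where g: "\<And>k. smooth_curve A (\<gamma> k)" "\<And>k. u k = jet_of A k (\<gamma> k)" "\<And>k. \<gamma> k 0 = Tinf_proj u"
    using TinfE[OF assms(1,4)] by blast
  note Tk = Tk_map_jet_of[OF assms(1-3) g(1)] and sc = smooth_curve_compose[OF assms(1-3) g(1)]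
  have G: "Tinf_map B g u k = jet_of B k (g \<circ> \<gamma> k)" for k
    unfolding Tinf_map_def g(2) by (rule Tk)
  have "jet_proj B i (Tinf_map B g u j) = Tinf_map B g u i" if "i \<le> j" for i j
  proof -
    have "jet_of A i (\<gamma> j) = u i"
      using assms(4) that jet_proj_jet_of[OF assms(1) g(1) that, of j] by (auto simp: Tinf_def g(2)[of j, symmetric])
    then have "Tinf_map B g u i = jet_of B i (g \<circ> \<gamma> j)" using Tk by (metis Tinf_map_def)
    then show ?thesis using jet_proj_jet_of[OF assms(2) sc that] G by simp
  qed
  then show "Tinf_map B g u \<in> Tinf B" using G sc by (auto simp: Tinf_def jet_of_in_Tk)
  show "Tinf_proj (Tinf_map B g u) = g (Tinf_proj u)"
    unfolding Tinf_proj_def[of "Tinf_map B g u"] G base_point_jet_of[OF assms(2) sc] using g(3) by simp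
qed

lemma Tinf_map_inverse:
  assumes "smooth_atlas A" "smooth_atlas B" "smooth_map A B g" "smooth_map B A h"
    and "\<And>x. x \<in> carrier A \<Longrightarrow> h (g x) = x" "u \<in> Tinf A"
  shows "Tinf_map A h (Tinf_map B g u) = u"
  unfolding Tinf_map_def using Tk_map_inverse[OF assms(1-5)] assms(6) by (auto simp: Tinf_def)

lemma Tinf_bundle_simps:
  "total_space (Tinf_bundle A \<Gamma>) = Tinf A" "base_atlas (Tinf_bundle A \<Gamma>) = A"
  "projection (Tinf_bundle A \<Gamma>) = Tinf_proj"
  "fibre_triv (Tinf_bundle A \<Gamma>) c x u = (\<lambda>k. snd (Phi \<Gamma> c k (u k)))"
  by (simp_all add: Tinf_bundle_def)

text \<open>Makes \<open>inv_into\<close> in \<open>local_rep\<close> a right inverse. Given v, the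
  triangular system yields derivatives at 0, polynomial curves of growing degree realize them in the
  chart, and their jets form a thread because their lower derivatives coincide.\<close>

lemma fibre_triv_surj:
  assumes A: "smooth_atlas A" and U: "(U, \<phi>) \<in> charts A" "x \<in> U" and v: "v \<in> model_fibre"
  shows "v \<in> fibre_triv (Tinf_bundle A \<Gamma>) (U, \<phi>) x ` fibre (Tinf_bundle A \<Gamma>) x"
proof -
  obtain a where a: "a 0 = \<phi> x" "\<And>i f. 1 \<le> i \<Longrightarrow> (\<And>l. l \<le> i \<Longrightarrow> nth_vderiv l f 0 = a l) \<Longrightarrow>
      z_coord (\<Gamma> (U, \<phi>)) f i = apply_bcontfun (v i) i"
    using derivs_with_coords[where G="\<Gamma> (U, \<phi>)" and x="\<phi> x" and v="\<lambda>i. apply_bcontfun (v i) i"] by blast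
  have "\<exists>\<gamma>. smooth_curve A \<gamma> \<and> \<gamma> 0 \<in> U \<and> \<phi> (\<gamma> 0) = \<phi> x \<and> (\<forall>i\<le>k. nth_vderiv i (\<phi> \<circ> \<gamma>) 0 = a i)" for k
    using curve_with_derivs[OF A U(1), of a k] a(1) U(2) by (metis imageI)
  then obtain \<gamma> where g: "\<And>k. smooth_curve A (\<gamma> k)" "\<And>k. \<gamma> k 0 \<in> U" "\<And>k. \<phi> (\<gamma> k 0) = \<phi> x"
    "\<And>k i. i \<le> k \<Longrightarrow> nth_vderiv i (\<phi> \<circ> \<gamma> k) 0 = a i" by metis
  have g0: "\<gamma> k 0 = x" for k using inj_onD[OF chartsD(2)[OF U(1)] g(3)] g(2) U(2) by blast
  define u where "u = (\<lambda>k. jet_of A k (\<gamma> k))"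
  have u_proj: "jet_of A i (\<gamma> j) = jet_of A i (\<gamma> i)" if "i \<le> j" for i j
  proof (rule jet_of_eq[OF A g(1) g(1)])
    show "k_equivalent A i (\<gamma> j) (\<gamma> i)"
      using k_equivalent_iff[OF A g(1) g(1) U(1) g(2)] that by (simp add: g0 g(4))
  qed
  have uT: "u \<in> Tinf A"
    unfolding Tinf_def u_def mem_Collect_eq
    by (intro conjI allI impI jet_of_in_Tk[OF g(1)] trans[OF jet_proj_jet_of[OF A g(1)] u_proj])
  have "Tinf_proj u = x" by (simp add: Tinf_proj_def u_def base_point_jet_of[OF A g(1)] g0)
  then have "u \<in> fibre (Tinf_bundle A \<Gamma>) x" using uT by (simp add: fibre_def Tinf_bundle_simps)
  moreover have "fibre_triv (Tinf_bundle A \<Gamma>) (U, \<phi>) x u = v"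
  proof
    fix k
    have "fibre_triv (Tinf_bundle A \<Gamma>) (U, \<phi>) x u k = tuple k (z_coord (\<Gamma> (U, \<phi>)) (\<phi> \<circ> \<gamma> k))"
      by (simp add: Tinf_bundle_simps u_def Phi_jet_of[OF A g(1) U(1) g(2)])
    also have "\<dots> = tuple k (\<lambda>i. apply_bcontfun (v i) i)"
      by (rule tuple_cong) (use a(2) g(4) in simp)
    also have "\<dots> = v k" by (rule model_fibreE[OF v, symmetric])
    finally show "fibre_triv (Tinf_bundle A \<Gamma>) (U, \<phi>) x u k = v k" .
  qed
  ultimately show ?thesis by blast
qed

lemma connection_smooth:
  "linear_connection A \<Gamma> K \<Longrightarrow> (U, \<phi>) \<in> charts A \<Longrightarrow> smooth_on (\<phi> ` U) (\<Gamma> (U, \<phi>))"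
  by (auto simp: linear_connection_def dest!: bspec)

text \<open>Each fibre coordinate of a representing curve is transformed by the same operator dh,
  for every order; this is what \<open>diag\<close> expresses.\<close>

lemma fibre_triv_Tinf_map:
  assumes M: "smooth_atlas M" and N: "smooth_atlas N" and g: "smooth_map M N g"
    and cM: "linear_connection M \<Gamma>M KM" and cN: "linear_connection N \<Gamma>N KN" and rel: "g_related M N g KM KN"
    and U: "(U, \<phi>) \<in> charts M" and V: "(V, \<psi>) \<in> charts N" and x: "x \<in> U" "g x \<in> V"
    and u: "u \<in> fibre (Tinf_bundle M \<Gamma>M) x"
  shows "fibre_triv (Tinf_bundle N \<Gamma>N) (V, \<psi>) (g x) (Tinf_map N g u) =
    H_limit (\<lambda>k. diag k (fderiv (\<psi> \<circ> g \<circ> inv_into U \<phi>) (\<phi> x))) (fibre_triv (Tinf_bundle M \<Gamma>M) (U, \<phi>) x u)"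
proof
  fix k
  let ?h = "\<psi> \<circ> g \<circ> inv_into U \<phi>" and ?T = "\<phi> ` (U \<inter> g -` V)"
  have "u \<in> Tinf M" "Tinf_proj u = x" using u by (auto simp: fibre_def Tinf_bundle_simps)
  then obtain \<gamma> where \<gamma>: "smooth_curve M \<gamma>" "u k = jet_of M k \<gamma>" "\<gamma> 0 = x"
    using TinfE[OF M] by metis
  have gU: "\<gamma> 0 \<in> U" and gV: "(g \<circ> \<gamma>) 0 \<in> V" using \<gamma>(3) x by auto
  obtain S where S: "0 \<in> S" "smooth_on S (\<phi> \<circ> \<gamma>)" "\<gamma> ` S \<subseteq> U"
    using smooth_curve_in_chart[OF M \<gamma>(1) U gU] .
  note sh = smooth_map_local_rep[OF M N g U V] and inj = chartsD(2)[OF U]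
  \<comment> \<open>The times at which the curve runs in the set where the local representative of g
    is smooth; fibre coordinates see a neighbourhood of 0 only.\<close>
  define R where "R = S \<inter> (\<phi> \<circ> \<gamma>) -` ?T"
  have R: "open R" using smooth_on_open_vimage[OF S(2) smooth_on_open[OF sh]] by (simp add: R_def)
  have R0: "0 \<in> R" using S(1) x \<gamma>(3) by (simp add: R_def)
  have sR: "smooth_on R (\<phi> \<circ> \<gamma>)" by (rule smooth_on_subset[OF S(2) R]) (simp add: R_def)
  have hf: "(\<psi> \<circ> (g \<circ> \<gamma>)) t = ?h ((\<phi> \<circ> \<gamma>) t)" if "t \<in> R" for t
  proof -
    have "\<gamma> t \<in> U" using that S(3) unfolding R_def by blast
    then show ?thesis using inj by simp
  qed
  have z: "z_coord (\<Gamma>N (V, \<psi>)) (\<psi> \<circ> (g \<circ> \<gamma>)) i = fderiv ?h (\<phi> x) (z_coord (\<Gamma>M (U, \<phi>)) (\<phi> \<circ> \<gamma>) i)"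
    if i: "1 \<le> i" for i
  proof -
    have "z_coord (\<Gamma>N (V, \<psi>)) (\<psi> \<circ> (g \<circ> \<gamma>)) i = z_coord (\<Gamma>N (V, \<psi>)) (\<lambda>t. ?h ((\<phi> \<circ> \<gamma>) t)) i"
      by (intro z_coord_cong nth_vderiv_cong[OF R _ R0] hf)
    also have "\<dots> = fderiv ?h ((\<phi> \<circ> \<gamma>) 0) (z_coord (\<Gamma>M (U, \<phi>)) (\<phi> \<circ> \<gamma>) i)"
    proof (rule z_coord_related[OF connection_smooth[OF cM U] connection_smooth[OF cN V] sh _ _ _ sR _ R0 i])
      show "?h ` ?T \<subseteq> \<psi> ` V" using inj by auto
    qed (use g_related_local[OF M N g cM cN rel U V _ refl] in \<open>auto simp: R_def\<close>)
    finally show ?thesis by (simp add: \<gamma>(3))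
  qed
  have "fibre_triv (Tinf_bundle N \<Gamma>N) (V, \<psi>) (g x) (Tinf_map N g u) k = tuple k (z_coord (\<Gamma>N (V, \<psi>)) (\<psi> \<circ> (g \<circ> \<gamma>)))"
    unfolding Tinf_bundle_simps Tinf_map_def \<gamma>(2) Tk_map_jet_of[OF M N g \<gamma>(1)]
    by (rule Phi_jet_of[OF N smooth_curve_compose[OF M N g \<gamma>(1)] V gV])
  also have "\<dots> = tuple k (\<lambda>i. fderiv ?h (\<phi> x) (z_coord (\<Gamma>M (U, \<phi>)) (\<phi> \<circ> \<gamma>) i))"
    by (rule tuple_cong) (rule z)
  also have "\<dots> = diag k (fderiv ?h (\<phi> x)) (tuple k (z_coord (\<Gamma>M (U, \<phi>)) (\<phi> \<circ> \<gamma>)))"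
    unfolding diag_apply by (rule tuple_cong) (simp add: apply_tuple)
  also have "tuple k (z_coord (\<Gamma>M (U, \<phi>)) (\<phi> \<circ> \<gamma>)) = fibre_triv (Tinf_bundle M \<Gamma>M) (U, \<phi>) x u k"
    unfolding Tinf_bundle_simps \<gamma>(2) by (rule Phi_jet_of[OF M \<gamma>(1) U gU, symmetric])
  finally show "fibre_triv (Tinf_bundle N \<Gamma>N) (V, \<psi>) (g x) (Tinf_map N g u) k =
    H_limit (\<lambda>k. diag k (fderiv ?h (\<phi> x))) (fibre_triv (Tinf_bundle M \<Gamma>M) (U, \<phi>) x u) k"
    unfolding H_limit_def .
qed

lemma local_rep_Tinf_map:
  assumes M: "smooth_atlas M" and N: "smooth_atlas N" and g: "smooth_map M N g"
    and cM: "linear_connection M \<Gamma>M KM" and cN: "linear_connection N \<Gamma>N KN" and rel: "g_related M N g KM KN"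
    and U: "(U, \<phi>) \<in> charts M" and V: "(V, \<psi>) \<in> charts N" and x: "x \<in> U" "g x \<in> V" and v: "v \<in> model_fibre"
  shows "local_rep (Tinf_bundle M \<Gamma>M) (Tinf_bundle N \<Gamma>N) (Tinf_map N g) g (U, \<phi>) (V, \<psi>) x v =
    H_limit (\<lambda>k. diag k (fderiv (\<psi> \<circ> g \<circ> inv_into U \<phi>) (\<phi> x))) v"
proof -
  let ?X = "Tinf_bundle M \<Gamma>M"
  note s = fibre_triv_surj[OF M U x(1) v, of \<Gamma>M]
  have "inv_into (fibre ?X x) (fibre_triv ?X (U, \<phi>) x) v \<in> fibre ?X x" by (rule inv_into_into[OF s])
  from fibre_triv_Tinf_map[OF M N g cM cN rel U V x this] show ?thesis
    by (simp add: local_rep_def f_inv_into_f[OF s])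
qed

lemma gvb_morphism_Tinf_map:
  assumes M: "smooth_atlas M" and N: "smooth_atlas N" and g: "smooth_map M N g"
    and cM: "linear_connection M \<Gamma>M KM" and cN: "linear_connection N \<Gamma>N KN" and rel: "g_related M N g KM KN"
  shows "gvb_morphism (Tinf_bundle M \<Gamma>M) (Tinf_bundle N \<Gamma>N) (Tinf_map N g) g"
  unfolding gvb_morphism_def Tinf_bundle_simps
proof (intro conjI ballI impI g)
  note rep = local_rep_Tinf_map[OF M N g cM cN rel]
  show "Tinf_map N g \<in> Tinf M \<rightarrow> Tinf N" using Tinf_map_in_Tinf(1)[OF M N g] by blast
  show "Tinf_proj (Tinf_map N g u) = g (Tinf_proj u)" if "u \<in> Tinf M" for u
    by (rule Tinf_map_in_Tinf(2)[OF M N g that])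
  show "continuous_linear_fibre (local_rep (Tinf_bundle M \<Gamma>M) (Tinf_bundle N \<Gamma>N) (Tinf_map N g) g c d x)"
    if c: "c \<in> charts M" and d: "d \<in> charts N" and x: "x \<in> fst c" "g x \<in> fst d" for c d x
  proof -
    obtain U \<phi> V \<psi> where cd: "c = (U, \<phi>)" "d = (V, \<psi>)" by (metis surj_pair)
    show ?thesis
      unfolding cd by (rule continuous_linear_fibre_diag) (use rep c d x cd in auto)
  qed
  show "\<exists>L. generalized_smooth c L \<and> (\<forall>x\<in>fst c. \<forall>v\<in>model_fibre.
      local_rep (Tinf_bundle M \<Gamma>M) (Tinf_bundle N \<Gamma>N) (Tinf_map N g) g c d x v = H_limit (L x) v)"
    if c: "c \<in> charts M" and d: "d \<in> charts N" and gc: "g ` fst c \<subseteq> fst d" for c d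
  proof -
    obtain U \<phi> V \<psi> where cd: "c = (U, \<phi>)" "d = (V, \<psi>)" by (metis surj_pair)
    note U = c[unfolded cd] and V = d[unfolded cd]
    let ?h = "\<psi> \<circ> g \<circ> inv_into U \<phi>"
    let ?L = "\<lambda>x k. diag k (fderiv ?h (\<phi> x))"
    \<comment> \<open>As g maps U into V, the local representative is smooth on the whole image of
      the chart, where L has to be smooth.\<close>
    have UV: "U \<inter> g -` V = U" using gc by (auto simp: cd)
    have "smooth_on (\<phi> ` U) ?h" using smooth_map_local_rep[OF M N g U V] by (simp only: UV)
    then have sm: "smooth_on (\<phi> ` U) (\<lambda>p. tuple k (\<lambda>i. diag i (fderiv ?h p)))" for k
      by (intro smooth_on_bounded_linear[OF bounded_linear_tuple_diag] smooth_on_fderiv)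
    have "generalized_smooth (U, \<phi>) ?L"
      unfolding generalized_smooth_def fst_conv snd_conv
    proof (intro conjI allI)
      show "?L \<in> U \<rightarrow> H_space" using diag_H_space by auto
      show "smooth_on (\<phi> ` U) (\<lambda>p. tuple k (?L (inv_into U \<phi> p)))" for k
        by (rule smooth_on_cong[OF sm]) (simp add: f_inv_into_f)
    qed
    then show ?thesis using rep[OF U V] gc unfolding cd by (intro exI[of _ ?L]) auto
  qed
qed

text \<open>Relatedness for g at TTh \<theta> reads K_N \<theta> = Tg (K_M (TTh \<theta>)), since
  TTg and TTh are mutually inverse; applying Th gives the claim.\<close>

lemma g_related_inverse:
  assumes M: "smooth_atlas M" and N: "smooth_atlas N" and g: "smooth_map M N g" and h: "smooth_map N M h"
    and inv: "inverse_on (carrier M) (carrier N) g h"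
    and cM: "linear_connection M \<Gamma>M KM" and rel: "g_related M N g KM KN"
  shows "g_related N M h KN KM"
  unfolding g_related_def
proof
  fix \<theta> assume th: "\<theta> \<in> Tk 1 (tangent_atlas N)"
  note TM = smooth_atlas_tangent[OF M] and TN = smooth_atlas_tangent[OF N]
    and Tg = smooth_map_tangent[OF M N g] and Th = smooth_map_tangent[OF N M h]
  let ?\<theta>' = "Tk_map 1 (tangent_atlas M) (Tk_map 1 M h) \<theta>"
  have th': "?\<theta>' \<in> Tk 1 (tangent_atlas M)" by (rule Tk_map_in_Tk[OF TN TM Th th])
  have gh: "g (h y) = y" if "y \<in> carrier N" for y using inv that by (simp add: inverse_on_def)
  have hg: "h (g x) = x" if "x \<in> carrier M" for x using inv that by (simp add: inverse_on_def)
  have "Tk_map 1 N g (Tk_map 1 M h u) = u" if "u \<in> carrier (tangent_atlas N)" for u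
    using that Tk_map_inverse[OF N M h g gh] by (simp add: carrier_tangent_atlas[OF N])
  then have TTg_TTh: "Tk_map 1 (tangent_atlas N) (Tk_map 1 N g) ?\<theta>' = \<theta>"
    by (rule Tk_map_inverse[OF TN TM Th Tg _ th])
  \<comment> \<open>\<open>linear_connection\<close> locates the values of KM chart by chart. A
    chart around the base point shows that KM at the transported vector is in TM, where Th inverts
    Tg.\<close>
  obtain \<Delta> where D: "smooth_curve (tangent_atlas M) \<Delta>" "?\<theta>' = jet_of (tangent_atlas M) 1 \<Delta>" using TkE[OF th'] .
  have "\<Delta> 0 \<in> Tk 1 M" using smooth_curve_carrier[OF D(1)] by (simp add: carrier_tangent_atlas[OF M])
  then obtain \<gamma> where \<gamma>: "smooth_curve M \<gamma>" "\<Delta> 0 = jet_of M 1 \<gamma>" by (rule TkE)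
  obtain U \<phi> where U: "(U, \<phi>) \<in> charts M" "\<gamma> 0 \<in> U"
    using atlas_chart_at[OF M smooth_curve_carrier[OF \<gamma>(1)]] by blast
  have "\<Delta> 0 \<in> tdom M U" using jet_of_in_tdom[OF M \<gamma>(1) U(2)] \<gamma>(2) by simp
  then have "?\<theta>' \<in> tdom (tangent_atlas M) (tdom M U)" using jet_of_in_tdom[OF TM D(1)] D(2) by simp
  then have "KM ?\<theta>' \<in> tdom M U"
    using cM U(1) unfolding linear_connection_def double_tangent_chart_def
    by (auto simp: tangent_chart_eq dest!: bspec)
  then have "KM ?\<theta>' \<in> Tk 1 M" using tdom_subset by blast
  then have "Tk_map 1 M h (Tk_map 1 N g (KM ?\<theta>')) = KM ?\<theta>'"
    using Tk_map_inverse[OF M N g h hg] by blast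
  moreover have "KN \<theta> = Tk_map 1 N g (KM ?\<theta>')" using rel th' TTg_TTh unfolding g_related_def by metis
  ultimately show "KM ?\<theta>' = Tk_map 1 M h (KN \<theta>)" by simp
qed

theorem theorem4p2:
  fixes M :: "('m, 'e::banach) atlas" and N :: "('n, 'f::banach) atlas"
    and g :: "'m \<Rightarrow> 'n"
    and \<Gamma>M :: "('m, 'e) christoffel" and KM :: "'m jet jet \<Rightarrow> 'm jet"
    and \<Gamma>N :: "('n, 'f) christoffel" and KN :: "'n jet jet \<Rightarrow> 'n jet"
  assumes "smooth_atlas M" and "smooth_atlas N"
    and "smooth_map M N g"
    and "linear_connection M \<Gamma>M KM" and "linear_connection N \<Gamma>N KN"
    and "g_related M N g KM KN"
  shows "gvb_morphism (Tinf_bundle M \<Gamma>M) (Tinf_bundle N \<Gamma>N) (Tinf_map N g) g \<and>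
    (diffeomorphism M N g \<longrightarrow>
      gvb_isomorphism (Tinf_bundle M \<Gamma>M) (Tinf_bundle N \<Gamma>N) (Tinf_map N g) g)"
proof (intro conjI impI)
  show mor: "gvb_morphism (Tinf_bundle M \<Gamma>M) (Tinf_bundle N \<Gamma>N) (Tinf_map N g) g"
    by (rule gvb_morphism_Tinf_map[OF assms])
  assume "diffeomorphism M N g"
  then obtain h where h: "smooth_map N M h" "inverse_on (carrier M) (carrier N) g h"
    unfolding diffeomorphism_def by blast
  have "gvb_morphism (Tinf_bundle N \<Gamma>N) (Tinf_bundle M \<Gamma>M) (Tinf_map M h) h"
    by (rule gvb_morphism_Tinf_map[OF assms(2,1) h(1) assms(5,4)
          g_related_inverse[OF assms(1-3) h assms(4,6)]])
  moreover have "inverse_on (Tinf M) (Tinf N) (Tinf_map N g) (Tinf_map M h)"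
    using Tinf_map_inverse[OF assms(1-3) h(1)] Tinf_map_inverse[OF assms(2,1) h(1) assms(3)] h(2)
    by (simp add: inverse_on_def)
  ultimately show "gvb_isomorphism (Tinf_bundle M \<Gamma>M) (Tinf_bundle N \<Gamma>N) (Tinf_map N g) g"
    unfolding gvb_isomorphism_def Tinf_bundle_simps using mor h(2) by blast
qed

end
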